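(* Fix $\varepsilon, \delta, \tau > 0$. Let $\Sigma$ be a positive definite $d\times d$ matrix with $\| \Sigma - I \|_F \leq O(\varepsilon \log 1 / \varepsilon)$, and fix $p \in \mathcal{P}_2$. Let $G_0$ be an $(\varepsilon, \delta)$-good set of samples with respect to $\mathcal{N} (0, \Sigma)$, and let $S = \{ X_1, \ldots, X_n \}$ satisfy $\Delta (S, G_0) \leq \varepsilon$. Then for any $C > 0$ there is an algorithm which, given $p, X_1, \ldots, X_n$, and $\varepsilon$, outputs a $\widehat{\mu}$ such that with probability $1 - \tau$ over the randomness of the algorithm, \[ \left| \widehat{\mu} - \mathbb{E}_{X \sim \mathcal{N} (0,\Sigma)} [p(X)] \right| \leq \|\Sigma - I\|_F/C + O(\log(C) \varepsilon) \; . \] Moreover, the algorithm runs in time $O(|S| + \log (1 / \tau) / \varepsilon^2 )$.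
   Context: $\mathcal{P}_2$ is the set of even degree-2 polynomials $p:\mathbb{R}^d\to\mathbb{R}$ (degree at most 2 with no degree-one terms) with $\mathrm{Var}_{X\sim\mathcal{N}(0,I)}[p(X)]=1$. For a multiset $S'$ and a set $G_0$, write $G'=S'\cap G_0$ and $E'=S'\setminus G_0$; define $\phi(S',G_0)=|G_0\setminus G'|/|S'|$, $\psi(S',G_0)=|E'|/|S'|$, $\Delta(S',G_0)=\psi+\phi\log(1/\phi)$. A set $G$ of points of $\mathbb{R}^d$ is $(\eta,\delta)$-good with respect to $\mathcal{N}(0,\Sigma)$ if: (1) every $x\in G$ has $x^T\Sigma^{-1}x=O(d\log(|G|/\delta))$; (2) for every even degree-2 polynomial $p$, $|\mathbb{E}_G[p(X)]-\mathbb{E}_{\mathcal{N}(0,\Sigma)}[p(X)]|\le\eta\,\mathbb{E}_{\mathcal{N}(0,\Sigma)}[p^2(X)]^{1/2}$, $|\mathbb{E}_G[p^2(X)]-\mathbb{E}_{\mathcal{N}(0,\Sigma)}[p^2(X)]|\le\eta\,\mathbb{E}_{\mathcal{N}(0,\Sigma)}[p^2(X)]$, and $\Pr_G[p(X)\ge0]\le\Pr_{\mathcal{N}(0,\Sigma)}[p(X)\ge0]+\eta^2/(d\log(|G|/\delta))$; (3) for every even degree-4 polynomial $p$, $|\mathbb{E}_G[p(X)]-\mathbb{E}_{\mathcal{N}(0,\Sigma)}[p(X)]|\le\eta\,\mathrm{Var}_{\mathcal{N}(0,\Sigma)}[p(X)]^{1/2}$ and $\Pr_G[p(X)\ge0]\le\Pr_{\mathcal{N}(0,\Sigma)}[p(X)\ge0]+\eta^2/(2\log(1/\varepsilon)(d\log(|G|/\delta))^2)$,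 where $\varepsilon$ is the corruption parameter of the statement. $\mathbb{E}_G,\Pr_G$ refer to the uniform distribution on $G$.
   Formalization: φ(S,G_0) ≤ b is assumed for a fixed b<1 (constants depend on b), since otherwise Δ ≤ ε allows S to be a single point; O(log(C)ε) is read as O(max(1, log C)ε), since C=1, Σ=I would demand exact recovery; τ ≤ 1. *)

theory Defs
  imports
    "HOL-Probability.Probability"
    "Jordan_Normal_Form.Determinant"
    "Jordan_Normal_Form.Gauss_Jordan_Elimination"
begin

text \<open>
  The dimension \<open>d\<close> is a variable, because all hidden constants and the algorithm itself
  must be independent of it. A point of \<open>\<real>\<^sup>d\<close> is a function in \<open>extensional {..<d}\<close>, which is
  the space of the product measure over the index set \<open>{..<d}\<close>.
\<close>

type_synonym point = "nat \<Rightarrow> real"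


section \<open>Matrices and Gaussians\<close>

definition frobenius_norm :: "real mat \<Rightarrow> real" where
  "frobenius_norm A = sqrt (\<Sum>i<dim_row A. \<Sum>j<dim_col A. (A $$ (i, j))\<^sup>2)"

definition quad_form :: "nat \<Rightarrow> real mat \<Rightarrow> point \<Rightarrow> real" where
  "quad_form d A x = (\<Sum>i<d. \<Sum>j<d. A $$ (i, j) * x i * x j)"

definition pos_def_mat :: "nat \<Rightarrow> real mat \<Rightarrow> bool" where
  "pos_def_mat d A \<longleftrightarrow>
     A \<in> carrier_mat d d \<and> (\<forall>i<d. \<forall>j<d. A $$ (i, j) = A $$ (j, i)) \<and>
     (\<forall>x. (\<exists>i<d. x i \<noteq> 0) \<longrightarrow> 0 < quad_form d A x)"

text \<open>The library's \<^const>\<open>mat_inverse\<close> is optional; it is \<open>Some\<close> for every invertible matrix.\<close>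

definition inv_mat :: "real mat \<Rightarrow> real mat" where
  "inv_mat A = the (mat_inverse A)"

definition gaussian :: "nat \<Rightarrow> real mat \<Rightarrow> point measure" where
  "gaussian d \<Sigma> = density (\<Pi>\<^sub>M i\<in>{..<d}. lborel)
     (\<lambda>x. ennreal (exp (- quad_form d (inv_mat \<Sigma>) x / 2) / sqrt ((2 * pi) ^ d * Determinant.det \<Sigma>)))"

definition mean :: "'a measure \<Rightarrow> ('a \<Rightarrow> real) \<Rightarrow> real" where
  "mean M f = (LINT x|M. f x)"

definition var :: "'a measure \<Rightarrow> ('a \<Rightarrow> real) \<Rightarrow> real" where
  "var M f = mean M (\<lambda>x. (f x - mean M f)\<^sup>2)"

definition prob_nonneg :: "'a measure \<Rightarrow> ('a \<Rightarrow> real) \<Rightarrow> real" where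
  "prob_nonneg M f = measure M {x \<in> space M. 0 \<le> f x}"


section \<open>Even polynomials\<close>

definition even_deg2 :: "nat \<Rightarrow> (point \<Rightarrow> real) set" where
  "even_deg2 d = {p. \<exists>c a. p = (\<lambda>x. c + (\<Sum>i<d. \<Sum>j<d. a i j * x i * x j))}"

definition even_deg4 :: "nat \<Rightarrow> (point \<Rightarrow> real) set" where
  "even_deg4 d = {p. \<exists>c a b. p = (\<lambda>x. c + (\<Sum>i<d. \<Sum>j<d. a i j * x i * x j)
     + (\<Sum>i<d. \<Sum>j<d. \<Sum>k<d. \<Sum>l<d. b i j k l * x i * x j * x k * x l))}"

definition P2 :: "nat \<Rightarrow> (point \<Rightarrow> real) set" where
  "P2 d = {p \<in> even_deg2 d. var (gaussian d (1\<^sub>m d)) p = 1}"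


section \<open>Good sets and corruption\<close>

text \<open>\<open>K\<close> is the constant hidden in the \<open>O\<close> of the first condition.\<close>

definition good :: "real \<Rightarrow> nat \<Rightarrow> real \<Rightarrow> real \<Rightarrow> real \<Rightarrow> real mat \<Rightarrow> point set \<Rightarrow> bool" where
  "good K d \<epsilon> \<eta> \<delta> \<Sigma> G \<longleftrightarrow>
     (let N = gaussian d \<Sigma>;
          U = measure_pmf (pmf_of_set G);
          L = real d * ln (real (card G) / \<delta>)
      in finite G \<and> G \<noteq> {} \<and> G \<subseteq> extensional {..<d} \<and>
         (\<forall>x\<in>G. quad_form d (inv_mat \<Sigma>) x \<le> K * L) \<and>
         (\<forall>p\<in>even_deg2 d.
            \<bar>mean U p - mean N p\<bar> \<le> \<eta> * sqrt (mean N (\<lambda>x. (p x)\<^sup>2)) \<and>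
            \<bar>mean U (\<lambda>x. (p x)\<^sup>2) - mean N (\<lambda>x. (p x)\<^sup>2)\<bar> \<le> \<eta> * mean N (\<lambda>x. (p x)\<^sup>2) \<and>
            prob_nonneg U p \<le> prob_nonneg N p + \<eta>\<^sup>2 / L) \<and>
         (\<forall>p\<in>even_deg4 d.
            \<bar>mean U p - mean N p\<bar> \<le> \<eta> * sqrt (var N p) \<and>
            prob_nonneg U p \<le> prob_nonneg N p + \<eta>\<^sup>2 / (2 * ln (1 / \<epsilon>) * L\<^sup>2)))"

text \<open>
  Intersections and differences are those of multisets, so surplus copies of a point of
  \<open>G0\<close> in \<open>S\<close> count as corrupted.
\<close>

definition phi :: "point multiset \<Rightarrow> point set \<Rightarrow> real" where
  "phi S G0 = real (size (mset_set G0 - (S \<inter># mset_set G0))) / real (size S)"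

definition psi :: "point multiset \<Rightarrow> point set \<Rightarrow> real" where
  "psi S G0 = real (size (S - mset_set G0)) / real (size S)"

definition Delta :: "point multiset \<Rightarrow> point set \<Rightarrow> real" where
  "Delta S G0 = psi S G0 + phi S G0 * ln (1 / phi S G0)"


section \<open>Randomised real-RAM programs\<close>

text \<open>
  Programs of a real random access machine with real-valued memory cells, indirect addressing,
  rational constants and unit costs. Points are accessed only through handles (natural numbers):
  \<open>Draw r\<close> draws a fresh sample from \<open>N(0,I)\<close> and puts its handle into cell \<open>r\<close>;
  \<open>Eval r a\<close> evaluates the input polynomial at the point whose handle is in cell \<open>a\<close>.
\<close>

datatype arith_op = Plus | Minus | Times | Divide

fun apply_op :: "arith_op \<Rightarrow> real \<Rightarrow> real \<Rightarrow> real" where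
  "apply_op Plus x y = x + y"
| "apply_op Minus x y = x - y"
| "apply_op Times x y = x * y"
| "apply_op Divide x y = x / y"

datatype com =
    Const nat rat
  | Arith arith_op nat nat nat
  | Load nat nat
  | Store nat nat
  | Draw nat
  | Eval nat nat
  | Seq com com
  | IfLess nat nat com com
  | WhileLess nat nat com

type_synonym mem = "nat \<Rightarrow> real"

text \<open>
  \<open>exec p pts c (m, h) t (m', h')\<close>: from memory \<open>m\<close>, program \<open>c\<close> terminates in memory \<open>m'\<close> after
  \<open>t\<close> unit-cost steps. The points with handles below \<open>h\<close> (\<open>h'\<close> afterwards) are available. A cell
  used as an address or handle must contain a natural number, otherwise the program is stuck.
\<close>

inductive exec ::
  "(point \<Rightarrow> real) \<Rightarrow> (nat \<Rightarrow> point) \<Rightarrow> com \<Rightarrow> mem \<times> nat \<Rightarrow> nat \<Rightarrow> mem \<times> nat \<Rightarrow> bool"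
  for p :: "point \<Rightarrow> real" and pts :: "nat \<Rightarrow> point"
where
  Const: "exec p pts (Const r q) (m, h) 1 (m(r := of_rat q), h)"
| Arith: "exec p pts (Arith f r a b) (m, h) 1 (m(r := apply_op f (m a) (m b)), h)"
| Load: "m a = real k \<Longrightarrow> exec p pts (Load r a) (m, h) 1 (m(r := m k), h)"
| Store: "m a = real k \<Longrightarrow> exec p pts (Store a b) (m, h) 1 (m(k := m b), h)"
| Draw: "exec p pts (Draw r) (m, h) 1 (m(r := real h), Suc h)"
| Eval: "m a = real k \<Longrightarrow> k < h \<Longrightarrow> exec p pts (Eval r a) (m, h) 1 (m(r := p (pts k)), h)"
| Seq: "exec p pts c1 s t1 s' \<Longrightarrow> exec p pts c2 s' t2 s'' \<Longrightarrow>
    exec p pts (Seq c1 c2) s (t1 + t2) s''"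
| IfTrue: "m a < m b \<Longrightarrow> exec p pts c1 (m, h) t s' \<Longrightarrow>
    exec p pts (IfLess a b c1 c2) (m, h) (1 + t) s'"
| IfFalse: "\<not> m a < m b \<Longrightarrow> exec p pts c2 (m, h) t s' \<Longrightarrow>
    exec p pts (IfLess a b c1 c2) (m, h) (1 + t) s'"
| WhileFalse: "\<not> m a < m b \<Longrightarrow> exec p pts (WhileLess a b c) (m, h) 1 (m, h)"
| WhileTrue: "m a < m b \<Longrightarrow> exec p pts c (m, h) t1 s' \<Longrightarrow>
    exec p pts (WhileLess a b c) s' t2 s'' \<Longrightarrow>
    exec p pts (WhileLess a b c) (m, h) (1 + t1 + t2) s''"

inductive_cases ConstE: "exec p pts (Const r q) s t s'"
inductive_cases ArithE: "exec p pts (Arith f r a b) s t s'"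
inductive_cases LoadE: "exec p pts (Load r a) s t s'"
inductive_cases StoreE: "exec p pts (Store a b) s t s'"
inductive_cases DrawE: "exec p pts (Draw r) s t s'"
inductive_cases EvalE: "exec p pts (Eval r a) s t s'"
inductive_cases SeqE: "exec p pts (Seq c1 c2) s t s'"
inductive_cases IfE: "exec p pts (IfLess a b c1 c2) s t s'"
inductive_cases WhileE: "exec p pts (WhileLess a b c) s t s'"

lemma exec_deterministic:
  "exec p pts c s t s' \<Longrightarrow> exec p pts c s u s'' \<Longrightarrow> u = t \<and> s'' = s'"
proof (induction arbitrary: u s'' rule: exec.induct)
  case (Const r q m h)
  then show ?case by (rule ConstE) simp
next
  case (Arith f r a b m h)
  then show ?case by (rule ArithE) simp
next
  case (Load m a k r h)
  from Load.prems show ?case by (rule LoadE) (use Load.hyps in simp)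
next
  case (Store m a k b h)
  from Store.prems show ?case by (rule StoreE) (use Store.hyps in simp)
next
  case (Draw r m h)
  then show ?case by (rule DrawE) simp
next
  case (Eval m a k h r)
  from Eval.prems show ?case by (rule EvalE) (use Eval.hyps in simp)
next
  case (Seq c1 s t1 s1 c2 t2 s2)
  from Seq.prems show ?case
  proof (rule SeqE)
    fix u1 s0 u2
    assume A: "u = u1 + u2" and B: "exec p pts c1 s u1 s0" "exec p pts c2 s0 u2 s''"
    from Seq.IH(1)[OF B(1)] have "u1 = t1 \<and> s0 = s1" .
    moreover from this B(2) have "u2 = t2 \<and> s'' = s2" by (intro Seq.IH(2)) simp
    ultimately show ?thesis using A by simp
  qed
next
  case (IfTrue m a b c1 h t s1 c2)
  from IfTrue.prems show ?case
    by (rule IfE) (use IfTrue.hyps in \<open>auto dest: IfTrue.IH\<close>)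
next
  case (IfFalse m a b c2 h t s1 c1)
  from IfFalse.prems show ?case
    by (rule IfE) (use IfFalse.hyps in \<open>auto dest: IfFalse.IH\<close>)
next
  case (WhileFalse m a b c h)
  from WhileFalse.prems show ?case
    by (rule WhileE) (use WhileFalse.hyps in simp_all)
next
  case (WhileTrue m a b c h t1 s1 t2 s2)
  from WhileTrue.prems show ?case
  proof (rule WhileE)
    fix m0 h0 assume "(m, h) = (m0, h0)" "\<not> m0 a < m0 b"
    with WhileTrue.hyps show ?thesis by simp
  next
    fix m0 h0 u1 s0 u2
    assume A: "(m, h) = (m0, h0)" "u = Suc (u1 + u2)"
      and B: "exec p pts c (m0, h0) u1 s0" "exec p pts (WhileLess a b c) s0 u2 s''"
    from A B(1) have "u1 = t1 \<and> s0 = s1" by (intro WhileTrue.IH(1)) simp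
    moreover from this B(2) have "u2 = t2 \<and> s'' = s2" by (intro WhileTrue.IH(2)) simp
    ultimately show ?thesis using A by simp
  qed
qed

text \<open>
  A run on input \<open>p\<close>, \<open>xs\<close>, \<open>\<epsilon>\<close> with failure probability \<open>\<tau>\<close> and random tape \<open>\<omega>\<close>. Handles
  below \<open>length xs\<close> denote the input points, later ones the samples drawn, in order. Cells 0, 1, 2
  initially hold \<open>\<epsilon>\<close>, \<open>\<tau>\<close> and the number of input points; the output is left in cell 0.
\<close>

definition run ::
  "com \<Rightarrow> (point \<Rightarrow> real) \<Rightarrow> point list \<Rightarrow> real \<Rightarrow> real \<Rightarrow> (nat \<Rightarrow> point) \<Rightarrow> nat \<Rightarrow> real \<Rightarrow> bool"
where
  "run prog p xs \<epsilon> \<tau> \<omega> t out \<longleftrightarrow>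
     (\<exists>m h. exec p (\<lambda>k. if k < length xs then xs ! k else \<omega> (k - length xs)) prog
        ((\<lambda>_. 0)(0 := \<epsilon>, 1 := \<tau>, 2 := real (length xs)), length xs) t (m, h) \<and> out = m 0)"

definition tape :: "nat \<Rightarrow> (nat \<Rightarrow> point) measure" where
  "tape d = (\<Pi>\<^sub>M k\<in>UNIV. gaussian d (1\<^sub>m d))"

end

theory Submission
  imports Defs
begin

text \<open>
  After recentring, the polynomial \<open>p\<close> is clipped at a level \<open>T\<close> proportional to \<open>max 1 (ln C)\<close>.
  Averages of the clipped polynomial are robust: an \<open>\<epsilon>\<close>-fraction of corruptions moves them by
  \<open>O(T \<epsilon>)\<close>, and by the layer-cake formula the tail bounds of goodness pass from the good set to
  \<open>N(0,\<Sigma>)\<close>. The bias \<open>E\<^sub>\<Sigma>[p] - E\<^sub>I[p]\<close> differs from that of the clipped polynomial only through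
  the excess \<open>g\<close> of \<open>p\<close> over its clipping; by Cauchy--Schwarz this difference is at most the square
  root of the chi-square divergence, \<open>O(|\<Sigma> - I|)\<close>, times \<open>E\<^sub>I[g\<^sup>2]\<^bsup>1/2\<^esup>\<close>, which is exponentially small
  in \<open>T\<close>. Everything under \<open>N(0,I)\<close>, including the unknown centre, is estimated from
  \<open>O((1 + log (1/\<tau>)) / \<epsilon>\<^sup>2)\<close> fresh draws; since a good set has at least order \<open>1/\<epsilon>\<^sup>2\<close> points, the first
  part is absorbed by the sample size. If \<open>\<epsilon>\<close> is bounded below, the trivial bound on clipped averages
  suffices.
\<close>

section \<open>Gaussian integrals by Schur complements\<close>

text \<open>Clipping alone would not do: pushing its bias below \<epsilon> in general takes a level
  of order log(1/\<epsilon>) and hence costs an error \<epsilon> log(1/\<epsilon>). Subtracting the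
  clipped mean under N(0,I), where the same bias occurs, leaves only the change of the excess
  between the two Gaussians. That change is proportional to the Frobenius distance, and a level of
  order log C makes the factor at most 1/C. The program sees p only through evaluations, so neither
  the centre nor this clipped mean can be read off from coefficients. A rough centre is enough
  because clipping is 1-Lipschitz.

  Nothing relates \<delta> to the size of the good set, so two facts are extracted from goodness
  itself. A lower bound on d log(|G|/\<delta>) comes from condition (1) against the Gaussian moments
  of the form given by the inverse covariance. A lower bound on |G| comes from a quartic that is
  nonnegative at a sample but negative almost everywhere. The Gaussian moment bounds are obtained by
  integrating out one coordinate at a time, which avoids diagonalisation.\<close>

lemma nn_integral_gaussian_line:
  fixes m s l v b :: real
  assumes m: "0 < m" and s: "0 \<le> s"
  shows "(\<integral>\<^sup>+t. ennreal ((s + (l + v * t)\<^sup>2) * exp (- (m * t\<^sup>2 + 2 * t * b) / 2)) \<partial>lborel)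
    = ennreal (sqrt (2 * pi / m) * exp (b\<^sup>2 / (2 * m)) * (s + (l - v * b / m)\<^sup>2 + v\<^sup>2 / m))"
proof -
  \<comment> \<open>Completing the square: the weight is \<open>K\<close> times the normal density
    of mean -b/m and variance 1/m, so the square integrates to its value at the mean plus v^2/m. The
    offset \<open>s\<close> lets one formula give both the total mass and the second
    moments.\<close>
  define \<mu> where "\<mu> = - b / m"
  define \<sigma> where "\<sigma> = 1 / sqrt m"
  have \<sigma>: "\<sigma> > 0" "\<sigma>\<^sup>2 = 1 / m" using m by (auto simp: \<sigma>_def power_divide)
  define K where "K = sqrt (2 * pi / m) * exp (b\<^sup>2 / (2 * m))"
  have K: "K \<ge> 0" using m by (simp add: K_def)
  have dens: "exp (- (m * t\<^sup>2 + 2 * t * b) / 2) = K * normal_density \<mu> \<sigma> t" for t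
  proof -
    have "- (m * t\<^sup>2 + 2 * t * b) / 2 = b\<^sup>2 / (2 * m) + (- (t - \<mu>)\<^sup>2 / (2 * \<sigma>\<^sup>2))"
      using m unfolding \<sigma>(2) \<mu>_def by (simp add: field_simps power2_eq_square)
    moreover have "sqrt (2 * pi / m) * (1 / sqrt (2 * pi * \<sigma>\<^sup>2)) = 1"
      using m unfolding \<sigma>(2) by simp
    ultimately show ?thesis
      using m unfolding K_def normal_density_def by (simp only: exp_add) (simp add: mult_ac)
  qed
  let ?L = "l + v * \<mu>"
  have h0: "has_bochner_integral lborel (normal_density \<mu> \<sigma>) 1"
    using normal_moment_even[OF \<sigma>(1), of \<mu> 0] by simp
  have h1: "has_bochner_integral lborel (\<lambda>t. normal_density \<mu> \<sigma> t * (t - \<mu>)) 0"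
    using normal_moment_odd[OF \<sigma>(1), of \<mu> 0] by simp
  have h2: "has_bochner_integral lborel (\<lambda>t. normal_density \<mu> \<sigma> t * (t - \<mu>)\<^sup>2) (1 / m)"
    using normal_moment_even[OF \<sigma>(1), of \<mu> 1] \<sigma>(2) by simp
  have "has_bochner_integral lborel (\<lambda>t. (K * (s + ?L\<^sup>2)) * normal_density \<mu> \<sigma> t
      + ((K * (2 * ?L * v)) * (normal_density \<mu> \<sigma> t * (t - \<mu>))
      + (K * v\<^sup>2) * (normal_density \<mu> \<sigma> t * (t - \<mu>)\<^sup>2)))
      ((K * (s + ?L\<^sup>2)) * 1 + ((K * (2 * ?L * v)) * 0 + (K * v\<^sup>2) * (1 / m)))"
    by (intro has_bochner_integral_add has_bochner_integral_mult_right h0 h1 h2)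
  also have "(\<lambda>t. (K * (s + ?L\<^sup>2)) * normal_density \<mu> \<sigma> t
      + ((K * (2 * ?L * v)) * (normal_density \<mu> \<sigma> t * (t - \<mu>))
      + (K * v\<^sup>2) * (normal_density \<mu> \<sigma> t * (t - \<mu>)\<^sup>2)))
     = (\<lambda>t. (s + (l + v * t)\<^sup>2) * exp (- (m * t\<^sup>2 + 2 * t * b) / 2))"
    unfolding dens by (rule ext) (simp add: algebra_simps power2_eq_square)
  finally have "(\<integral>\<^sup>+t. ennreal ((s + (l + v * t)\<^sup>2) * exp (- (m * t\<^sup>2 + 2 * t * b) / 2)) \<partial>lborel)
      = ennreal (K * (s + ?L\<^sup>2) + K * v\<^sup>2 / m)"
    by (subst nn_integral_eq_integral)
       (auto simp: has_bochner_integral_iff s intro!: AE_I2 mult_nonneg_nonneg add_nonneg_nonneg)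
  also have "K * (s + ?L\<^sup>2) + K * v\<^sup>2 / m = K * (s + (l - v * b / m)\<^sup>2 + v\<^sup>2 / m)"
    by (simp add: \<mu>_def algebra_simps)
  finally show ?thesis by (simp add: K_def)
qed

section \<open>Eliminating the last variable of a quadratic form\<close>

lemma quad_form_cong: "(\<And>i. i < n \<Longrightarrow> x i = y i) \<Longrightarrow> quad_form n M x = quad_form n M y"
  unfolding quad_form_def by (intro sum.cong) auto

lemma quad_form_Suc:
  assumes sym: "\<And>i. i < n \<Longrightarrow> M $$ (n, i) = M $$ (i, n)"
  shows "quad_form (Suc n) M x
    = quad_form n M x + 2 * x n * (\<Sum>i<n. M $$ (i, n) * x i) + M $$ (n, n) * (x n)\<^sup>2"
proof -
  have "quad_form (Suc n) M x = (quad_form n M x + (\<Sum>i<n. M $$ (i, n) * x i * x n))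
      + ((\<Sum>j<n. M $$ (n, j) * x n * x j) + M $$ (n, n) * x n * x n)"
    by (simp add: quad_form_def sum.distrib)
  also have "(\<Sum>j<n. M $$ (n, j) * x n * x j) = x n * (\<Sum>i<n. M $$ (i, n) * x i)"
    unfolding sum_distrib_left by (intro sum.cong) (auto simp: sym)
  also have "(\<Sum>i<n. M $$ (i, n) * x i * x n) = x n * (\<Sum>i<n. M $$ (i, n) * x i)"
    unfolding sum_distrib_left by (intro sum.cong) auto
  finally show ?thesis by (simp add: power2_eq_square)
qed

definition schur_mat :: "nat \<Rightarrow> real mat \<Rightarrow> real mat" where
  "schur_mat n M = mat n n (\<lambda>(i, j). M $$ (i, j) - M $$ (i, n) * M $$ (j, n) / M $$ (n, n))"

lemma quad_form_schur_mat:
  "quad_form n (schur_mat n M) x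
    = quad_form n M x - (\<Sum>i<n. M $$ (i, n) * x i)\<^sup>2 / M $$ (n, n)"
proof -
  have "(\<Sum>i<n. M $$ (i, n) * x i)\<^sup>2 / M $$ (n, n)
     = (\<Sum>i<n. \<Sum>j<n. M $$ (i, n) * M $$ (j, n) / M $$ (n, n) * x i * x j)"
    unfolding power2_eq_square sum_product sum_divide_distrib by (simp add: mult_ac)
  then show ?thesis
    by (simp add: quad_form_def schur_mat_def algebra_simps sum_subtractf)
qed

lemma pos_def_mat_last_pos:
  assumes "pos_def_mat (Suc n) M"
  shows "0 < M $$ (n, n)"
proof -
  have "0 < quad_form (Suc n) M (\<lambda>i. if i = n then 1 else 0)"
    using assms unfolding pos_def_mat_def by (auto intro!: exI[of _ n])
  also have "\<dots> = M $$ (n, n)"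
    using assms by (subst quad_form_Suc) (auto simp: pos_def_mat_def quad_form_def)
  finally show ?thesis .
qed

text \<open>Setting the last coordinate to its minimiser \<open>- ?b / M $$ (n, n)\<close> turns the
  full form into that of the Schur complement, so positivity is inherited.\<close>

lemma pos_def_schur_mat:
  assumes pd: "pos_def_mat (Suc n) M"
  shows "pos_def_mat n (schur_mat n M)"
  unfolding pos_def_mat_def
proof (intro conjI allI impI)
  note m = pos_def_mat_last_pos[OF pd]
  have sym: "M $$ (i, j) = M $$ (j, i)" if "i < Suc n" "j < Suc n" for i j
    using pd that by (auto simp: pos_def_mat_def)
  show "schur_mat n M \<in> carrier_mat n n" by (simp add: schur_mat_def)
  show "schur_mat n M $$ (i, j) = schur_mat n M $$ (j, i)" if "i < n" "j < n" for i j
    using that sym[of i j] by (simp add: schur_mat_def)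
  fix x :: point assume x: "\<exists>i<n. x i \<noteq> 0"
  let ?b = "\<Sum>i<n. M $$ (i, n) * x i"
  define y where "y = x(n := - ?b / M $$ (n, n))"
  have "\<exists>i<Suc n. y i \<noteq> 0" using x by (auto simp: y_def intro: less_SucI)
  then have "0 < quad_form (Suc n) M y" using pd by (auto simp: pos_def_mat_def)
  also have "quad_form (Suc n) M y = quad_form n M y + 2 * y n * (\<Sum>i<n. M $$ (i, n) * y i)
      + M $$ (n, n) * (y n)\<^sup>2"
    by (rule quad_form_Suc) (simp add: sym)
  also have "quad_form n M y = quad_form n M x" by (rule quad_form_cong) (simp add: y_def)
  also have "(\<Sum>i<n. M $$ (i, n) * y i) = ?b" by (intro sum.cong) (auto simp: y_def)
  also have "quad_form n M x + 2 * y n * ?b + M $$ (n, n) * (y n)\<^sup>2 = quad_form n (schur_mat n M) x"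
    unfolding quad_form_schur_mat y_def using m
    by (simp add: field_simps power2_eq_square)
  finally show "0 < quad_form n (schur_mat n M) x" .
qed

text \<open>Column elimination: right multiplication by the unit lower triangular \<open>U\<close>
  clears the last row up to the pivot, leaving the block upper triangular \<open>V\<close>.\<close>

lemma det_schur_mat:
  assumes pd: "pos_def_mat (Suc n) M"
  shows "Determinant.det M = M $$ (n, n) * Determinant.det (schur_mat n M)"
proof -
  let ?m = "M $$ (n, n)"
  note m = pos_def_mat_last_pos[OF pd]
  have M: "M \<in> carrier_mat (Suc n) (Suc n)" using pd by (simp add: pos_def_mat_def)
  have sym: "M $$ (i, j) = M $$ (j, i)" if "i < Suc n" "j < Suc n" for i j
    using pd that by (auto simp: pos_def_mat_def)
  define R where "R = mat 1 n (\<lambda>(i, j). - M $$ (j, n) / ?m)"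
  define U where "U = four_block_mat (1\<^sub>m n) (0\<^sub>m n 1) R (1\<^sub>m 1)"
  define V where "V = four_block_mat (schur_mat n M) (mat n 1 (\<lambda>(i, j). M $$ (i, n))) (0\<^sub>m 1 n) (mat 1 1 (\<lambda>_. ?m))"
  have U: "U \<in> carrier_mat (Suc n) (Suc n)"
    using four_block_carrier_mat[of "1\<^sub>m n" n n "1\<^sub>m 1" 1 1] by (simp add: U_def)
  have detU: "Determinant.det U = 1"
    unfolding U_def by (subst det_four_block_mat_upper_right_zero[of _ n _ 1]) (auto simp: R_def)
  have S: "schur_mat n M \<in> carrier_mat n n" by (simp add: schur_mat_def)
  have detV: "Determinant.det V = Determinant.det (schur_mat n M) * ?m"
    unfolding V_def by (subst det_four_block_mat_lower_left_zero[of _ n _ 1]) (auto simp: S det_single)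
  have "M * U = V"
  proof (rule eq_matI)
    fix i j assume ij: "i < dim_row V" "j < dim_col V"
    then have ij: "i < Suc n" "j < Suc n" by (auto simp: V_def schur_mat_def)
    have "(M * U) $$ (i, j) = (\<Sum>k<Suc n. M $$ (i, k) * U $$ (k, j))"
      using M U ij by (simp add: scalar_prod_def lessThan_atLeast0)
    also have "\<dots> = (\<Sum>k<n. M $$ (i, k) * U $$ (k, j)) + M $$ (i, n) * U $$ (n, j)" by simp
    also have "(\<Sum>k<n. M $$ (i, k) * U $$ (k, j)) = (\<Sum>k<n. if k = j then M $$ (i, j) else 0)"
      using ij by (intro sum.cong) (auto simp: U_def R_def)
    also have "\<dots> = (if j < n then M $$ (i, j) else 0)" by (simp add: sum.delta)
    also have "\<dots> + M $$ (i, n) * U $$ (n, j) = V $$ (i, j)"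
      using ij m sym[of i j] sym[of n j]
      by (cases "i < n"; cases "j < n") (auto simp: U_def V_def R_def schur_mat_def less_Suc_eq)
    finally show "(M * U) $$ (i, j) = V $$ (i, j)" .
  qed (use M U in \<open>auto simp: V_def schur_mat_def\<close>)
  then have "Determinant.det M * Determinant.det U = Determinant.det V"
    using det_mult[OF M U] by simp
  then show ?thesis using detU detV by (simp add: mult_ac)
qed

abbreviation "lebs n \<equiv> (\<Pi>\<^sub>M i\<in>{..<n}. (lborel :: real measure))"

lemma measurable_quad_form [measurable]: "quad_form n M \<in> borel_measurable (lebs n)"
  unfolding quad_form_def[abs_def] by measurable

lemma product_sigma_finite_lborel: "product_sigma_finite (\<lambda>_::nat. lborel :: real measure)"
  by standard

lemma nn_integral_lebs_Suc:
  assumes "f \<in> borel_measurable (lebs (Suc n))"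
  shows "(\<integral>\<^sup>+x. f x \<partial>lebs (Suc n)) = (\<integral>\<^sup>+x. \<integral>\<^sup>+t. f (x(n := t)) \<partial>lborel \<partial>lebs n)"
  using product_sigma_finite.product_nn_integral_insert[OF product_sigma_finite_lborel, of "{..<n}" n f] assms
  by (simp add: lessThan_Suc)

text \<open>Induction on the dimension, integrating out the last coordinate. The vector
  \<open>w\<close> is M^-1 v, given by its linear system because invertibility is itself part of the
  conclusion; \<open>s\<close> collects the variances of the coordinates already integrated
  out.\<close>

proposition gaussian_integral:
  fixes M :: "real mat"
  assumes "pos_def_mat n M" and "0 \<le> s" and "\<And>i. i < n \<Longrightarrow> (\<Sum>j<n. M $$ (i, j) * w j) = v i"
  shows "0 < Determinant.det M \<and>
    (\<integral>\<^sup>+x. ennreal ((s + (\<Sum>i<n. v i * x i)\<^sup>2) * exp (- quad_form n M x / 2)) \<partial>lebs n)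
      = ennreal (sqrt ((2 * pi) ^ n / Determinant.det M) * (s + (\<Sum>i<n. v i * w i)))"
  using assms
proof (induction n arbitrary: M s v w)
  case 0
  then have "Determinant.det M = 1" by (simp add: pos_def_mat_def det_dim_zero)
  then show ?case by (simp add: PiM_empty nn_integral_count_space_finite quad_form_def)
next
  case (Suc n)
  note pd = Suc.prems(1) and s = Suc.prems(2) and w = Suc.prems(3)
  let ?m = "M $$ (n, n)"
  let ?b = "\<lambda>x. \<Sum>i<n. M $$ (i, n) * x i"
  define N where "N = schur_mat n M"
  note m = pos_def_mat_last_pos[OF pd]
  have sym: "M $$ (i, j) = M $$ (j, i)" if "i < Suc n" "j < Suc n" for i j
    using pd that by (auto simp: pos_def_mat_def)
  \<comment> \<open>Coefficients of the linear form once the last coordinate is replaced by its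
    conditional mean \<open>- ?b x / ?m\<close>.\<close>
  define u where "u i = v i - v n * M $$ (i, n) / ?m" for i
  have wn: "?b w + ?m * w n = v n"
    using w[of n] sym by simp
  \<comment> \<open>Block elimination: without its last entry, \<open>w\<close> solves the Schur
    system for \<open>u\<close>, so the induction hypothesis applies with the same
    \<open>w\<close>.\<close>
  have u: "(\<Sum>j<n. N $$ (i, j) * w j) = u i" if "i < n" for i
  proof -
    have "(\<Sum>j<n. N $$ (i, j) * w j) = (\<Sum>j<n. M $$ (i, j) * w j) - M $$ (i, n) / ?m * ?b w"
      using that by (simp add: N_def schur_mat_def algebra_simps sum_subtractf sum_distrib_left)
    also have "(\<Sum>j<n. M $$ (i, j) * w j) = v i - M $$ (i, n) * w n"
      using w[of i] that by simp
    also have "?b w = v n - ?m * w n" using wn by simp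
    finally show ?thesis using m by (simp add: u_def field_simps)
  qed
  have s': "0 \<le> s + (v n)\<^sup>2 / ?m" using s m by simp
  note IH = Suc.IH[OF pos_def_schur_mat[OF pd, folded N_def] s' u]
  have det: "Determinant.det M = ?m * Determinant.det N" using det_schur_mat[OF pd] by (simp add: N_def)
  have dpos: "0 < Determinant.det N" using IH by blast
  have inner: "(\<integral>\<^sup>+t. ennreal ((s + (\<Sum>i<Suc n. v i * (x(n := t)) i)\<^sup>2) * exp (- quad_form (Suc n) M (x(n := t)) / 2)) \<partial>lborel)
    = ennreal (sqrt (2 * pi / ?m)) * ennreal (((s + (v n)\<^sup>2 / ?m) + (\<Sum>i<n. u i * x i)\<^sup>2) * exp (- quad_form n N x / 2))"
    for x
  proof -
    let ?l = "\<Sum>i<n. v i * x i"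
    have q: "quad_form (Suc n) M (x(n := t)) = quad_form n M x + (?m * t\<^sup>2 + 2 * t * ?b x)" for t
    proof -
      have "quad_form n M (x(n := t)) = quad_form n M x" by (rule quad_form_cong) simp
      moreover have "?b (x(n := t)) = ?b x" by (intro sum.cong) auto
      ultimately show ?thesis using sym by (subst quad_form_Suc) auto
    qed
    have "(\<integral>\<^sup>+t. ennreal ((s + (\<Sum>i<Suc n. v i * (x(n := t)) i)\<^sup>2) * exp (- quad_form (Suc n) M (x(n := t)) / 2)) \<partial>lborel)
      = (\<integral>\<^sup>+t. ennreal (exp (- quad_form n M x / 2)) * ennreal ((s + (?l + v n * t)\<^sup>2) * exp (- (?m * t\<^sup>2 + 2 * t * ?b x) / 2)) \<partial>lborel)"
    proof (intro nn_integral_cong)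
      fix t :: real
      have l: "(\<Sum>i<n. v i * (x(n := t)) i) = ?l" by (intro sum.cong) auto
      have e: "exp (- (a + y) / 2) = exp (- a / 2) * exp (- y / 2)" for a y :: real
        unfolding exp_add[symmetric] by (simp add: add_divide_distrib diff_divide_distrib)
      show "ennreal ((s + (\<Sum>i<Suc n. v i * (x(n := t)) i)\<^sup>2) * exp (- quad_form (Suc n) M (x(n := t)) / 2))
        = ennreal (exp (- quad_form n M x / 2)) * ennreal ((s + (?l + v n * t)\<^sup>2) * exp (- (?m * t\<^sup>2 + 2 * t * ?b x) / 2))"
        unfolding q e sum.lessThan_Suc l fun_upd_same
        using s by (subst ennreal_mult[symmetric]) (simp_all only: mult_ac, auto)
    qed
    also have "\<dots> = ennreal (exp (- quad_form n M x / 2)) *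
        ennreal (sqrt (2 * pi / ?m) * exp ((?b x)\<^sup>2 / (2 * ?m)) * (s + (?l - v n * ?b x / ?m)\<^sup>2 + (v n)\<^sup>2 / ?m))"
      by (subst nn_integral_cmult) (simp, simp only: nn_integral_gaussian_line[OF m s])
    also have "?l - v n * ?b x / ?m = (\<Sum>i<n. u i * x i)"
      by (simp add: u_def algebra_simps sum_subtractf sum_distrib_left sum_divide_distrib)
    also have "ennreal (exp (- quad_form n M x / 2)) *
        ennreal (sqrt (2 * pi / ?m) * exp ((?b x)\<^sup>2 / (2 * ?m)) * (s + (\<Sum>i<n. u i * x i)\<^sup>2 + (v n)\<^sup>2 / ?m))
      = ennreal (sqrt (2 * pi / ?m) * ((s + (v n)\<^sup>2 / ?m + (\<Sum>i<n. u i * x i)\<^sup>2) * (exp (- quad_form n M x / 2) * exp ((?b x)\<^sup>2 / (2 * ?m)))))"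
      using s m by (subst ennreal_mult[symmetric]) (auto simp: algebra_simps)
    also have "exp (- quad_form n M x / 2) * exp ((?b x)\<^sup>2 / (2 * ?m)) = exp (- quad_form n N x / 2)"
      unfolding N_def quad_form_schur_mat exp_add[symmetric] by (simp add: field_simps)
    also have "ennreal (sqrt (2 * pi / ?m) * ((s + (v n)\<^sup>2 / ?m + (\<Sum>i<n. u i * x i)\<^sup>2) * exp (- quad_form n N x / 2)))
      = ennreal (sqrt (2 * pi / ?m)) * ennreal ((s + (v n)\<^sup>2 / ?m + (\<Sum>i<n. u i * x i)\<^sup>2) * exp (- quad_form n N x / 2))"
      using s m by (intro ennreal_mult) auto
    finally show ?thesis .
  qed
  have "(\<integral>\<^sup>+x. ennreal ((s + (\<Sum>i<Suc n. v i * x i)\<^sup>2) * exp (- quad_form (Suc n) M x / 2)) \<partial>lebs (Suc n))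
    = (\<integral>\<^sup>+x. ennreal (sqrt (2 * pi / ?m)) * ennreal (((s + (v n)\<^sup>2 / ?m) + (\<Sum>i<n. u i * x i)\<^sup>2) * exp (- quad_form n N x / 2)) \<partial>lebs n)"
    by (subst nn_integral_lebs_Suc) (measurable, simp only: inner)
  also have "\<dots> = ennreal (sqrt (2 * pi / ?m)) * ennreal (sqrt ((2 * pi) ^ n / Determinant.det N) * ((s + (v n)\<^sup>2 / ?m) + (\<Sum>i<n. u i * w i)))"
    by (subst nn_integral_cmult) (measurable, use IH in simp)
  also have "\<dots> = ennreal (sqrt (2 * pi / ?m) * sqrt ((2 * pi) ^ n / Determinant.det N) * ((s + (v n)\<^sup>2 / ?m) + (\<Sum>i<n. u i * w i)))"
    using m by (subst ennreal_mult'[symmetric]) (auto simp: mult_ac)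
  also have "sqrt (2 * pi / ?m) * sqrt ((2 * pi) ^ n / Determinant.det N) = sqrt ((2 * pi) ^ Suc n / Determinant.det M)"
    unfolding det real_sqrt_mult[symmetric] by simp
  also have "(s + (v n)\<^sup>2 / ?m) + (\<Sum>i<n. u i * w i) = s + (\<Sum>i<Suc n. v i * w i)"
  proof -
    have "(\<Sum>i<n. u i * w i) = (\<Sum>i<n. v i * w i) - v n / ?m * ?b w"
      by (simp add: u_def algebra_simps sum_subtractf sum_distrib_left)
    also have "?b w = v n - ?m * w n" using wn by simp
    finally show ?thesis using m by (simp add: field_simps power2_eq_square)
  qed
  finally show ?case using det dpos m by simp
qed

lemma pos_def_mat_det_pos: "pos_def_mat n M \<Longrightarrow> 0 < Determinant.det M"
  using gaussian_integral[of n M 0 "\<lambda>_. 0" "\<lambda>_. 0"] by simp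

section \<open>Inverses of covariance matrices\<close>

lemma inv_mat:
  assumes pd: "pos_def_mat n S"
  shows "inv_mat S \<in> carrier_mat n n" "S * inv_mat S = 1\<^sub>m n" "inv_mat S * S = 1\<^sub>m n"
proof -
  have S: "S \<in> carrier_mat n n" using pd by (simp add: pos_def_mat_def)
  have "S \<in> Units (ring_mat TYPE(real) n ())"
    using det_non_zero_imp_unit[OF S] pos_def_mat_det_pos[OF pd] by simp
  then have "mat_inverse S \<noteq> None" using mat_inverse(1)[OF S, of "()"] by blast
  then have "mat_inverse S = Some (inv_mat S)" by (auto simp: inv_mat_def)
  from mat_inverse(2)[OF S this]
  show "inv_mat S \<in> carrier_mat n n" "S * inv_mat S = 1\<^sub>m n" "inv_mat S * S = 1\<^sub>m n" by auto
qed

lemma mat_mult_sum: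
  "A \<in> carrier_mat n n \<Longrightarrow> B \<in> carrier_mat n n \<Longrightarrow> i < n \<Longrightarrow> j < n \<Longrightarrow>
    (A * B) $$ (i, j) = (\<Sum>k<n. A $$ (i, k) * B $$ (k, j))"
  by (simp add: scalar_prod_def lessThan_atLeast0)

lemma inv_mat_sum:
  assumes pd: "pos_def_mat n S" and "i < n" "j < n"
  shows "(\<Sum>k<n. S $$ (i, k) * inv_mat S $$ (k, j)) = (if i = j then 1 else 0)"
    "(\<Sum>k<n. inv_mat S $$ (i, k) * S $$ (k, j)) = (if i = j then 1 else 0)"
  using mat_mult_sum[of S n "inv_mat S" i j] mat_mult_sum[of "inv_mat S" n S i j] inv_mat[OF pd] assms
  by (auto simp: pos_def_mat_def)

lemma inv_mat_mult_vec:
  assumes pd: "pos_def_mat n S" and "i < n"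
  shows "(\<Sum>j<n. inv_mat S $$ (i, j) * (\<Sum>k<n. S $$ (j, k) * v k)) = v i"
    "(\<Sum>j<n. S $$ (i, j) * (\<Sum>k<n. inv_mat S $$ (j, k) * v k)) = v i"
proof -
  have *: "(\<Sum>j<n. f j * (\<Sum>k<n. g j k * v k)) = (\<Sum>k<n. (\<Sum>j<n. f j * g j k) * v k)"
    for f :: "nat \<Rightarrow> real" and g
    unfolding sum_distrib_left sum_distrib_right by (subst sum.swap) (simp add: mult_ac)
  show "(\<Sum>j<n. inv_mat S $$ (i, j) * (\<Sum>k<n. S $$ (j, k) * v k)) = v i"
    using assms(2) by (simp add: * inv_mat_sum[OF pd] if_distrib[of "\<lambda>c. c * _"] cong: if_cong)
  show "(\<Sum>j<n. S $$ (i, j) * (\<Sum>k<n. inv_mat S $$ (j, k) * v k)) = v i"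
    using assms(2) by (simp add: * inv_mat_sum[OF pd] if_distrib[of "\<lambda>c. c * _"] cong: if_cong)
qed

lemma inv_mat_sym:
  assumes pd: "pos_def_mat n S" and "i < n" "j < n"
  shows "inv_mat S $$ (i, j) = inv_mat S $$ (j, i)"
proof -
  let ?M = "inv_mat S"
  note M = inv_mat[OF pd]
  have S: "S \<in> carrier_mat n n" using pd by (simp add: pos_def_mat_def)
  have St: "transpose_mat S = S" using pd by (intro eq_matI) (auto simp: pos_def_mat_def)
  have "transpose_mat ?M * S = 1\<^sub>m n"
    using transpose_mult[OF S M(1)] M(2) St by simp
  then have "transpose_mat ?M = ?M"
    using assoc_mult_mat[of "transpose_mat ?M" n n S n ?M n] M S by simp
  then show ?thesis using assms M(1) by (metis index_transpose_mat(1) carrier_matD)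
qed

lemma quad_form_eq_sum: "quad_form n M x = (\<Sum>i<n. x i * (\<Sum>j<n. M $$ (i, j) * x j))"
  unfolding quad_form_def sum_distrib_left by (simp add: mult_ac)

text \<open>The form of the inverse at x equals the form of S at y = S^-1 x, and y is nonzero
  whenever x is.\<close>

lemma pos_def_inv_mat:
  assumes pd: "pos_def_mat n S"
  shows "pos_def_mat n (inv_mat S)"
  unfolding pos_def_mat_def
proof (intro conjI allI impI)
  show "inv_mat S \<in> carrier_mat n n" by (rule inv_mat[OF pd])
  show "inv_mat S $$ (i, j) = inv_mat S $$ (j, i)" if "i < n" "j < n" for i j
    by (rule inv_mat_sym[OF pd that])
  fix x :: point assume x: "\<exists>i<n. x i \<noteq> 0"
  define y where "y j = (\<Sum>k<n. inv_mat S $$ (j, k) * x k)" for j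
  have xy: "(\<Sum>j<n. S $$ (i, j) * y j) = x i" if "i < n" for i
    unfolding y_def by (rule inv_mat_mult_vec[OF pd that])
  have "\<exists>i<n. y i \<noteq> 0"
  proof (rule ccontr)
    assume "\<not> ?thesis"
    then have "x i = 0" if "i < n" for i using xy[OF that] by simp
    then show False using x by blast
  qed
  then have "0 < quad_form n S y" using pd by (auto simp: pos_def_mat_def)
  also have "quad_form n S y = (\<Sum>i<n. y i * x i)"
    unfolding quad_form_eq_sum by (intro sum.cong) (auto simp: xy)
  also have "\<dots> = quad_form n (inv_mat S) x"
    unfolding quad_form_eq_sum by (intro sum.cong) (auto simp: y_def)
  finally show "0 < quad_form n (inv_mat S) x" .
qed

lemma det_inv_mat:
  assumes pd: "pos_def_mat n S"
  shows "Determinant.det (inv_mat S) = 1 / Determinant.det S"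
proof -
  have S: "S \<in> carrier_mat n n" using pd by (simp add: pos_def_mat_def)
  have "Determinant.det S * Determinant.det (inv_mat S) = 1"
    using det_mult[OF S inv_mat(1)[OF pd]] inv_mat(2)[OF pd] by simp
  then show ?thesis using pos_def_mat_det_pos[OF pd] by (simp add: field_simps)
qed

lemma pos_def_one_mat: "pos_def_mat n (1\<^sub>m n)"
  unfolding pos_def_mat_def
proof (intro conjI allI impI)
  fix x :: point assume "\<exists>i<n. x i \<noteq> 0"
  then obtain k where k: "k < n" "x k \<noteq> 0" by blast
  have "quad_form n (1\<^sub>m n) x = (\<Sum>i<n. \<Sum>j<n. if j = i then x i * x j else 0)"
    unfolding quad_form_def by (intro sum.cong) auto
  also have "\<dots> = (\<Sum>i<n. (x i)\<^sup>2)" by (simp add: power2_eq_square)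
  also have "\<dots> > 0" using k by (intro sum_pos2[of _ k]) auto
  finally show "0 < quad_form n (1\<^sub>m n) x" .
qed auto

section \<open>Total mass and moments of the Gaussian measure\<close>

lemma space_gaussian [simp]: "space (gaussian d S) = extensional {..<d}"
  by (simp add: gaussian_def space_PiM PiE_def)

lemma sets_gaussian [measurable_cong, simp]: "sets (gaussian d S) = sets (lebs d)"
  by (simp add: gaussian_def)

lemma nn_integral_gaussian:
  assumes "f \<in> borel_measurable (lebs d)"
  shows "(\<integral>\<^sup>+x. f x \<partial>gaussian d S)
    = (\<integral>\<^sup>+x. ennreal (exp (- quad_form d (inv_mat S) x / 2) / sqrt ((2 * pi) ^ d * Determinant.det S)) * f x \<partial>lebs d)"
  unfolding gaussian_def by (intro nn_integral_density assms) measurable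

text \<open>An instance of \<open>gaussian_integral\<close> for the inverse covariance, whose linear
  system is solved by w = S v. Taking s = 1 and v = 0 gives the total mass, s = 0 the second
  moments.\<close>

lemma nn_integral_gaussian_affine_square:
  assumes pd: "pos_def_mat d S" and s: "0 \<le> s"
  shows "(\<integral>\<^sup>+x. ennreal (s + (\<Sum>i<d. v i * x i)\<^sup>2) \<partial>gaussian d S)
    = ennreal (s + quad_form d S v)"
proof -
  note dS = pos_def_mat_det_pos[OF pd]
  let ?D = "sqrt ((2 * pi) ^ d * Determinant.det S)"
  have D: "?D > 0" using dS by simp
  have "(\<integral>\<^sup>+x. ennreal (s + (\<Sum>i<d. v i * x i)\<^sup>2) \<partial>gaussian d S)
     = (\<integral>\<^sup>+x. ennreal (1 / ?D) * ennreal ((s + (\<Sum>i<d. v i * x i)\<^sup>2) * exp (- quad_form d (inv_mat S) x / 2)) \<partial>lebs d)"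
    by (subst nn_integral_gaussian, measurable)
       (use s D in \<open>auto intro!: nn_integral_cong simp: ennreal_mult[symmetric] field_simps\<close>)
  also have "\<dots> = ennreal (1 / ?D) * ennreal (sqrt ((2 * pi) ^ d / Determinant.det (inv_mat S)) * (s + (\<Sum>i<d. v i * (\<Sum>k<d. S $$ (i, k) * v k))))"
    using gaussian_integral[OF pos_def_inv_mat[OF pd] s, of "\<lambda>j. \<Sum>k<d. S $$ (j, k) * v k" v]
      inv_mat_mult_vec(1)[OF pd]
    by (subst nn_integral_cmult) auto
  also have "\<dots> = ennreal (1 / ?D * (?D * (s + quad_form d S v)))"
    using D by (subst ennreal_mult'[symmetric]) (auto simp: det_inv_mat[OF pd] quad_form_eq_sum)
  finally show ?thesis using D dS by simp
qed

lemma prob_space_gaussian: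
  assumes "pos_def_mat d S"
  shows "prob_space (gaussian d S)"
proof
  show "emeasure (gaussian d S) (space (gaussian d S)) = 1"
    using nn_integral_gaussian_affine_square[OF assms, of 1 "\<lambda>_. 0"] by (simp add: quad_form_def)
qed

text \<open>Polarisation: the moment of x_i x_j is read off from the squares of x_i + x_j, x_i and
  x_j.\<close>

lemma gaussian_second_moment:
  assumes pd: "pos_def_mat d S" and ij: "i < d" "j < d"
  shows "has_bochner_integral (gaussian d S) (\<lambda>x. x i * x j) (S $$ (i, j))"
proof -
  have sq: "has_bochner_integral (gaussian d S) (\<lambda>x. (\<Sum>i<d. v i * x i)\<^sup>2) (quad_form d S v)" for v
  proof (rule has_bochner_integral_nn_integral)
    show "0 \<le> quad_form d S v"
    proof (cases "\<exists>i<d. v i \<noteq> 0")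
      case True
      then show ?thesis using pd by (auto simp: pos_def_mat_def intro: less_imp_le)
    next
      case False
      then show ?thesis by (simp add: quad_form_def)
    qed
    show "(\<integral>\<^sup>+x. ennreal ((\<Sum>i<d. v i * x i)\<^sup>2) \<partial>gaussian d S) = ennreal (quad_form d S v)"
      using nn_integral_gaussian_affine_square[OF pd, of 0 v] by simp
  qed measurable
  define e :: "nat \<Rightarrow> nat \<Rightarrow> real" where "e i k = (if k = i then 1 else 0)" for i k
  have e1: "(\<Sum>k<d. e l k * x k) = x l" if "l < d" for l and x :: "nat \<Rightarrow> real"
  proof -
    have "(\<Sum>k<d. e l k * x k) = (\<Sum>k<d. if k = l then x k else 0)"
      by (intro sum.cong) (auto simp: e_def)
    then show ?thesis using that by simp
  qed
  have e1': "(\<Sum>k<d. x k * e l k) = x l" if "l < d" for l and x :: "nat \<Rightarrow> real"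
    using e1[OF that, of x] by (simp add: mult.commute)
  have e2: "(\<Sum>k<d. (e i k + e j k) * x k) = x i + x j" for x :: "nat \<Rightarrow> real"
    using e1 ij by (simp add: distrib_right sum.distrib)
  have e3: "(\<Sum>k<d. x k * (e i k + e j k)) = x i + x j" for x :: "nat \<Rightarrow> real"
    using e2[of x] by (simp add: mult.commute)
  have "has_bochner_integral (gaussian d S)
     (\<lambda>x. ((\<Sum>k<d. (e i k + e j k) * x k)\<^sup>2 - (\<Sum>k<d. e i k * x k)\<^sup>2 - (\<Sum>k<d. e j k * x k)\<^sup>2) / 2)
     ((quad_form d S (\<lambda>k. e i k + e j k) - quad_form d S (e i) - quad_form d S (e j)) / 2)"
    by (intro has_bochner_integral_divide_zero has_bochner_integral_diff sq)
  also have "(\<lambda>x. ((\<Sum>k<d. (e i k + e j k) * x k)\<^sup>2 - (\<Sum>k<d. e i k * x k)\<^sup>2 - (\<Sum>k<d. e j k * x k)\<^sup>2) / 2)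
     = (\<lambda>x :: nat \<Rightarrow> real. x i * x j)"
    unfolding e2 e1[OF ij(1)] e1[OF ij(2)] by (simp add: power2_eq_square algebra_simps)
  also have "(quad_form d S (\<lambda>k. e i k + e j k) - quad_form d S (e i) - quad_form d S (e j)) / 2 = S $$ (i, j)"
    unfolding quad_form_eq_sum e3 e2 e1[OF ij(1)] e1[OF ij(2)] e1'[OF ij(1)] e1'[OF ij(2)]
    using pd ij by (simp add: pos_def_mat_def)
  finally show ?thesis .
qed

definition quad :: "nat \<Rightarrow> real \<Rightarrow> (nat \<Rightarrow> nat \<Rightarrow> real) \<Rightarrow> point \<Rightarrow> real" where
  "quad d c a x = c + (\<Sum>i<d. \<Sum>j<d. a i j * x i * x j)"

lemma measurable_quad [measurable]: "quad d c a \<in> borel_measurable (lebs d)"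
  unfolding quad_def[abs_def] by measurable

lemma gaussian_mean_quad:
  assumes pd: "pos_def_mat d S"
  shows "has_bochner_integral (gaussian d S) (quad d c a) (c + (\<Sum>i<d. \<Sum>j<d. a i j * S $$ (i, j)))"
proof -
  interpret prob_space "gaussian d S" by (rule prob_space_gaussian[OF pd])
  have "has_bochner_integral (gaussian d S) (\<lambda>x. c) c"
    using prob_space by (auto simp: has_bochner_integral_iff)
  moreover have "has_bochner_integral (gaussian d S) (\<lambda>x. \<Sum>i<d. \<Sum>j<d. a i j * (x i * x j))
      (\<Sum>i<d. \<Sum>j<d. a i j * S $$ (i, j))"
    by (intro has_bochner_integral_sum has_bochner_integral_mult_right gaussian_second_moment pd) auto
  ultimately show ?thesis
    unfolding quad_def[abs_def] mult.assoc by (rule has_bochner_integral_add)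
qed

section \<open>Quadratic forms under the standard Gaussian\<close>

lemma inv_mat_one: "inv_mat (1\<^sub>m n) = 1\<^sub>m n"
  using inv_mat(1,2)[OF pos_def_one_mat[of n]] by simp

lemma quad_form_one: "quad_form n (1\<^sub>m n) x = (\<Sum>i<n. (x i)\<^sup>2)"
proof -
  have "quad_form n (1\<^sub>m n) x = (\<Sum>i<n. \<Sum>j<n. if j = i then x i * x j else 0)"
    unfolding quad_form_def by (intro sum.cong) auto
  then show ?thesis by (simp add: power2_eq_square)
qed

abbreviation "std_gaussian d \<equiv> gaussian d (1\<^sub>m d)"

lemma std_gaussian_mean_quad:
  "has_bochner_integral (std_gaussian d) (quad d c a) (c + (\<Sum>i<d. a i i))"
proof -
  have "(\<Sum>i<d. \<Sum>j<d. a i j * (1\<^sub>m d) $$ (i, j)) = (\<Sum>i<d. \<Sum>j<d. if j = i then a i j else 0)"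
    by (intro sum.cong) auto
  also have "\<dots> = (\<Sum>i<d. a i i)" by simp
  finally show ?thesis using gaussian_mean_quad[OF pos_def_one_mat, of d c a] by simp
qed

text \<open>Splits off one independent standard normal coordinate; the two inductions on the
  dimension below rest on it.\<close>

lemma nn_integral_std_gaussian_Suc:
  assumes [measurable]: "f \<in> borel_measurable (lebs (Suc n))"
  shows "(\<integral>\<^sup>+x. f x \<partial>std_gaussian (Suc n))
    = (\<integral>\<^sup>+x. \<integral>\<^sup>+t. ennreal (std_normal_density t) * f (x(n := t)) \<partial>lborel \<partial>std_gaussian n)"
proof -
  define D where "D n x = exp (- (\<Sum>i<n. (x i)\<^sup>2) / 2) / sqrt ((2 * pi) ^ n)" for n and x :: "nat \<Rightarrow> real"
  have D0: "D n x \<ge> 0" for n x by (simp add: D_def)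
  have D: "D (Suc n) (x(n := t)) = D n x * std_normal_density t" for x t
  proof -
    have "(\<Sum>i<n. ((x(n := t)) i)\<^sup>2) = (\<Sum>i<n. (x i)\<^sup>2)" by (intro sum.cong) auto
    moreover have "exp (- (a + t\<^sup>2) / 2) = exp (- a / 2) * exp (- t\<^sup>2 / 2)" for a :: real
      unfolding exp_add[symmetric] by (simp add: add_divide_distrib diff_divide_distrib)
    ultimately show ?thesis by (simp add: D_def std_normal_density_def real_sqrt_mult)
  qed
  have gen: "(\<integral>\<^sup>+x. g x \<partial>std_gaussian k) = (\<integral>\<^sup>+x. ennreal (D k x) * g x \<partial>lebs k)"
    if "g \<in> borel_measurable (lebs k)" for k and g :: "(nat \<Rightarrow> real) \<Rightarrow> ennreal"
    unfolding nn_integral_gaussian[OF that] by (simp add: inv_mat_one quad_form_one D_def)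
  have up [measurable]: "(\<lambda>(x, t). x(n := t)) \<in> measurable (lebs n \<Otimes>\<^sub>M lborel) (lebs (Suc n))"
    unfolding lessThan_Suc by measurable
  have [measurable]: "(\<lambda>x. D k x) \<in> borel_measurable (lebs k)" for k unfolding D_def by measurable
  have "(\<integral>\<^sup>+x. f x \<partial>std_gaussian (Suc n)) = (\<integral>\<^sup>+x. ennreal (D (Suc n) x) * f x \<partial>lebs (Suc n))"
    by (rule gen) measurable
  also have "\<dots> = (\<integral>\<^sup>+x. \<integral>\<^sup>+t. ennreal (D n x) * (ennreal (std_normal_density t) * f (x(n := t))) \<partial>lborel \<partial>lebs n)"
    by (subst nn_integral_lebs_Suc) (measurable, simp add: D D0 ennreal_mult mult.assoc)
  also have "\<dots> = (\<integral>\<^sup>+x. ennreal (D n x) * (\<integral>\<^sup>+t. ennreal (std_normal_density t) * f (x(n := t)) \<partial>lborel) \<partial>lebs n)"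
  proof (rule nn_integral_cong)
    fix x assume x [measurable]: "x \<in> space (lebs n)"
    have [measurable]: "(\<lambda>t. f (x(n := t))) \<in> borel_measurable lborel"
      using measurable_compose[OF measurable_Pair1'[OF x] measurable_compose[OF up assms]] by simp
    show "(\<integral>\<^sup>+t. ennreal (D n x) * (ennreal (std_normal_density t) * f (x(n := t))) \<partial>lborel)
      = ennreal (D n x) * (\<integral>\<^sup>+t. ennreal (std_normal_density t) * f (x(n := t)) \<partial>lborel)"
      by (rule nn_integral_cmult) measurable
  qed
  also have "\<dots> = (\<integral>\<^sup>+x. \<integral>\<^sup>+t. ennreal (std_normal_density t) * f (x(n := t)) \<partial>lborel \<partial>std_gaussian n)"
    by (rule gen[symmetric]) measurable
  finally show ?thesis .
qed

lemma quad_Suc: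
  assumes sym: "\<And>i. i < n \<Longrightarrow> a n i = a i n"
  shows "quad (Suc n) c a (x(n := t)) = quad n c a x + 2 * t * (\<Sum>i<n. a i n * x i) + a n n * t\<^sup>2"
proof -
  let ?S = "\<Sum>i<n. a i n * x i"
  have "quad (Suc n) c a (x(n := t)) = c + (\<Sum>i<n. \<Sum>j<n. a i j * x i * x j) + (\<Sum>i<n. a i n * x i * t)
      + (\<Sum>j<n. a n j * t * x j) + a n n * t * t"
    by (simp add: quad_def sum.distrib)
  also have "(\<Sum>i<n. a i n * x i * t) = t * ?S" by (simp add: sum_distrib_left mult_ac)
  also have "(\<Sum>j<n. a n j * t * x j) = t * ?S" by (simp add: sum_distrib_left mult_ac sym)
  finally show ?thesis by (simp add: quad_def power2_eq_square)
qed

lemma sum2_Suc: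
  assumes sym: "\<And>i. i < n \<Longrightarrow> a n i = a i n"
  shows "(\<Sum>i<Suc n. \<Sum>j<Suc n. (a i j)\<^sup>2)
    = (\<Sum>i<n. \<Sum>j<n. (a i j)\<^sup>2) + 2 * (\<Sum>i<n. (a i n)\<^sup>2) + (a n n :: real)\<^sup>2"
  by (simp add: sum.distrib sym)

lemma sum2_Cauchy_Schwarz:
  fixes f g :: "nat \<Rightarrow> nat \<Rightarrow> real"
  shows "(\<Sum>i<n. \<Sum>j<n. f i j * g i j)\<^sup>2 \<le> (\<Sum>i<n. \<Sum>j<n. (f i j)\<^sup>2) * (\<Sum>i<n. \<Sum>j<n. (g i j)\<^sup>2)"
  using Cauchy_Schwarz_ineq_sum[of "\<lambda>(i, j). f i j" "\<lambda>(i, j). g i j" "{..<n} \<times> {..<n}"]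
  by (simp add: sum.cartesian_product case_prod_unfold)

text \<open>Integrating out the last coordinate leaves the square of a \<open>quad\<close> with
  constant c + a_nn, to which the induction hypothesis applies, plus 2 a_nn^2 and the square of a
  linear form. In effect the variance is twice the squared Frobenius norm of the
  coefficients.\<close>

proposition std_gaussian_quad_square:
  assumes "\<And>i j. i < d \<Longrightarrow> j < d \<Longrightarrow> a i j = a j i"
  shows "(\<integral>\<^sup>+x. ennreal ((quad d c a x)\<^sup>2) \<partial>std_gaussian d)
    = ennreal ((c + (\<Sum>i<d. a i i))\<^sup>2 + 2 * (\<Sum>i<d. \<Sum>j<d. (a i j)\<^sup>2))"
  using assms
proof (induction d arbitrary: c)
  case 0
  interpret prob_space "std_gaussian 0" by (rule prob_space_gaussian[OF pos_def_one_mat])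
  show ?case using emeasure_space_1 by (simp add: quad_def)
next
  case (Suc n)
  let ?b = "a n n" and ?l = "\<lambda>x. \<Sum>i<n. a i n * x i"
  have sym: "\<And>i. i < n \<Longrightarrow> a n i = a i n" using Suc.prems by auto
  have m: "has_bochner_integral lborel (\<lambda>t. std_normal_density t * t ^ k) v"
    if "(k, v) \<in> {(0, 1), (1, 0), (2, 1), (3, 0), (4, 3)}" for k v
    using that std_normal_moment_even[of 0] std_normal_moment_even[of 1] std_normal_moment_even[of 2]
      std_normal_moment_odd[of 0] std_normal_moment_odd[of 1]
    by (auto simp: fact_numeral numeral_3_eq_3)
  have inner: "(\<integral>\<^sup>+t. ennreal (std_normal_density t) * ennreal ((q + 2 * t * l + b * t\<^sup>2)\<^sup>2) \<partial>lborel)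
     = ennreal ((q + b)\<^sup>2 + (2 * b\<^sup>2 + (2 * l)\<^sup>2))" for q l b :: real
  proof -
    have "has_bochner_integral lborel (\<lambda>t. q\<^sup>2 * (std_normal_density t * t ^ 0)
       + ((4 * q * l) * (std_normal_density t * t ^ 1)
       + ((2 * q * b + 4 * l\<^sup>2) * (std_normal_density t * t ^ 2)
       + ((4 * l * b) * (std_normal_density t * t ^ 3)
       + b\<^sup>2 * (std_normal_density t * t ^ 4)))))
       (q\<^sup>2 * 1 + ((4 * q * l) * 0 + ((2 * q * b + 4 * l\<^sup>2) * 1 + ((4 * l * b) * 0 + b\<^sup>2 * 3))))"
      by (intro has_bochner_integral_add has_bochner_integral_mult_right m) simp_all
    also have "(\<lambda>t. q\<^sup>2 * (std_normal_density t * t ^ 0)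
       + ((4 * q * l) * (std_normal_density t * t ^ 1)
       + ((2 * q * b + 4 * l\<^sup>2) * (std_normal_density t * t ^ 2)
       + ((4 * l * b) * (std_normal_density t * t ^ 3)
       + b\<^sup>2 * (std_normal_density t * t ^ 4))))) = (\<lambda>t. std_normal_density t * (q + 2 * t * l + b * t\<^sup>2)\<^sup>2)"
      by (rule ext) (simp add: algebra_simps power2_eq_square power3_eq_cube power4_eq_xxxx)
    finally have "(\<integral>\<^sup>+t. ennreal (std_normal_density t * (q + 2 * t * l + b * t\<^sup>2)\<^sup>2) \<partial>lborel)
      = ennreal (q\<^sup>2 * 1 + ((4 * q * l) * 0 + ((2 * q * b + 4 * l\<^sup>2) * 1 + ((4 * l * b) * 0 + b\<^sup>2 * 3))))"
      by (subst nn_integral_eq_integral) (auto simp: has_bochner_integral_iff)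
    also have "(q\<^sup>2 * 1 + ((4 * q * l) * 0 + ((2 * q * b + 4 * l\<^sup>2) * 1 + ((4 * l * b) * 0 + b\<^sup>2 * 3))))
       = (q + b)\<^sup>2 + (2 * b\<^sup>2 + (2 * l)\<^sup>2)" by (simp add: algebra_simps power2_eq_square)
    finally show ?thesis by (simp add: ennreal_mult)
  qed
  have "(\<integral>\<^sup>+x. ennreal ((quad (Suc n) c a x)\<^sup>2) \<partial>std_gaussian (Suc n))
     = (\<integral>\<^sup>+x. ennreal ((quad n c a x + ?b)\<^sup>2 + (2 * ?b\<^sup>2 + (2 * ?l x)\<^sup>2)) \<partial>std_gaussian n)"
    by (subst nn_integral_std_gaussian_Suc, measurable) (simp only: quad_Suc[where a = a and n = n, OF sym] inner)
  also have "\<dots> = (\<integral>\<^sup>+x. ennreal ((quad n (c + ?b) a x)\<^sup>2) + ennreal (2 * ?b\<^sup>2 + (\<Sum>i<n. (2 * a i n) * x i)\<^sup>2) \<partial>std_gaussian n)"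
    by (intro nn_integral_cong) (simp add: ennreal_plus[symmetric] quad_def algebra_simps sum_distrib_left del: ennreal_plus)
  also have "\<dots> = (\<integral>\<^sup>+x. ennreal ((quad n (c + ?b) a x)\<^sup>2) \<partial>std_gaussian n) + (\<integral>\<^sup>+x. ennreal (2 * ?b\<^sup>2 + (\<Sum>i<n. (2 * a i n) * x i)\<^sup>2) \<partial>std_gaussian n)"
    by (rule nn_integral_add) measurable
  also have "\<dots> = ennreal ((c + ?b + (\<Sum>i<n. a i i))\<^sup>2 + 2 * (\<Sum>i<n. \<Sum>j<n. (a i j)\<^sup>2)) + ennreal (2 * ?b\<^sup>2 + (\<Sum>i<n. (2 * a i n)\<^sup>2))"
    using Suc.IH[of "c + ?b"] Suc.prems
      nn_integral_gaussian_affine_square[OF pos_def_one_mat[of n], of "2 * ?b\<^sup>2" "\<lambda>i. 2 * a i n"]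
    unfolding quad_form_one by simp
  also have "\<dots> = ennreal ((c + (\<Sum>i<Suc n. a i i))\<^sup>2 + 2 * (\<Sum>i<Suc n. \<Sum>j<Suc n. (a i j)\<^sup>2))"
    by (subst sum2_Suc, erule sym, subst ennreal_plus[symmetric])
       (auto intro!: add_nonneg_nonneg sum_nonneg arg_cong[of _ _ ennreal] simp: sum_distrib_left power_mult_distrib algebra_simps)
  finally show ?case .
qed

lemma inverse_sqrt_eq_exp:
  fixes m :: real
  assumes m: "0 < m"
  shows "1 / sqrt m = exp (- (1/2) * ln m)"
proof -
  have "exp (ln (sqrt m)) = sqrt m" using m by (intro exp_ln) simp
  then have 1: "exp (ln m / 2) = sqrt m" unfolding ln_sqrt[OF less_imp_le[OF m]] .
  have "exp (ln m / 2) * exp (- (1/2) * ln m) = 1"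
    unfolding exp_add[symmetric] by simp
  then have "sqrt m * exp (- (1/2) * ln m) = 1" unfolding 1 .
  then show ?thesis using m by (metis nonzero_eq_divide_eq mult.commute real_sqrt_gt_zero less_irrefl)
qed

text \<open>For standard normal t the left side is the logarithm of the mean of exp(b t^2). Its
  linear part b joins the trace, and the remainder matches the factor 4 in
  \<open>std_gaussian_exp_quad\<close>.\<close>

lemma ln_one_minus_lower:
  fixes b :: real
  assumes "\<bar>b\<bar> \<le> 1 / 4"
  shows "- (1/2) * ln (1 - 2 * b) \<le> b + 4 * b\<^sup>2"
proof (cases "b \<ge> 0")
  case True
  then have "- (2 * b) - 2 * (2 * b)\<^sup>2 \<le> ln (1 - 2 * b)"
    using assms by (intro ln_one_minus_pos_lower_bound) auto
  then show ?thesis by (simp add: power_mult_distrib)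
next
  case False
  then have "(-2 * b) - (-2 * b)\<^sup>2 \<le> ln (1 + (-2 * b))"
    using assms by (intro ln_one_plus_pos_lower_bound) auto
  then have "- (1/2) * ln (1 - 2 * b) \<le> b + 2 * b\<^sup>2" by (simp add: power_mult_distrib)
  then show ?thesis using zero_le_power2[of b] by linarith
qed

text \<open>Integrating out the last variable adds a rank-one term to the remaining form; the
  threshold on the Frobenius norm keeps that norm from growing.\<close>

proposition std_gaussian_exp_quad:
  assumes "\<And>i j. i < d \<Longrightarrow> j < d \<Longrightarrow> a i j = a j i"
    and "(\<Sum>i<d. \<Sum>j<d. (a i j)\<^sup>2) \<le> 1 / 64"
  shows "(\<integral>\<^sup>+x. ennreal (exp (quad d c a x)) \<partial>std_gaussian d)
    \<le> ennreal (exp (c + (\<Sum>i<d. a i i) + 4 * (\<Sum>i<d. \<Sum>j<d. (a i j)\<^sup>2)))"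
  using assms
proof (induction d arbitrary: a)
  case 0
  interpret prob_space "std_gaussian 0" by (rule prob_space_gaussian[OF pos_def_one_mat])
  show ?case using emeasure_space_1 by (simp add: quad_def)
next
  case (Suc n)
  let ?b = "a n n" and ?l = "\<lambda>x. \<Sum>i<n. a i n * x i"
  define m where "m = 1 - 2 * ?b"
  define P where "P = (\<Sum>i<n. \<Sum>j<n. (a i j)\<^sup>2)"
  define s where "s = (\<Sum>i<n. (a i n)\<^sup>2)"
  have sym: "\<And>i. i < n \<Longrightarrow> a n i = a i n" using Suc.prems by auto
  have Ps: "P \<ge> 0" "s \<ge> 0" by (auto simp: P_def s_def intro!: sum_nonneg)
  have S2: "(\<Sum>i<Suc n. \<Sum>j<Suc n. (a i j)\<^sup>2) = P + 2 * s + ?b\<^sup>2"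
    unfolding P_def s_def by (rule sum2_Suc) (rule sym)
  have nrm: "P + 2 * s + ?b\<^sup>2 \<le> 1 / 64"
    using Suc.prems(2) unfolding S2 .
  then have "?b\<^sup>2 \<le> (1 / 8)\<^sup>2" using Ps by (simp add: power2_eq_square)
  then have b: "\<bar>?b\<bar> \<le> 1 / 8" using abs_le_square_iff[of ?b "1 / 8"] by simp
  have m: "m \<ge> 3 / 4" using b by (simp add: m_def)
  \<comment> \<open>Completing the square in the last variable, with linear term 2 t l and precision
    m, leaves (2 l)^2 / (2 m) = k l^2 in the exponent.\<close>
  define k where "k = 2 / m"
  have k: "0 < k" "k \<le> 8 / 3" using m by (auto simp: k_def field_simps)
  define g where "g i j = a i j + k * (a i n * a j n)" for i j
  have qg: "quad n c g x = quad n c a x + k * (?l x)\<^sup>2" for x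
    by (simp add: quad_def g_def power2_eq_square sum_product algebra_simps sum.distrib sum_distrib_left)
  have inner: "(\<integral>\<^sup>+t. ennreal (std_normal_density t) * ennreal (exp (q + 2 * t * l + ?b * t\<^sup>2)) \<partial>lborel)
      = ennreal (1 / sqrt m) * ennreal (exp (q + k * l\<^sup>2))" for q l :: real
  proof -
    have "(\<integral>\<^sup>+t. ennreal (std_normal_density t) * ennreal (exp (q + 2 * t * l + ?b * t\<^sup>2)) \<partial>lborel)
      = (\<integral>\<^sup>+t. ennreal (exp q / sqrt (2 * pi)) * ennreal ((1 + (0 + 0 * t)\<^sup>2) * exp (- (m * t\<^sup>2 + 2 * t * (- 2 * l)) / 2)) \<partial>lborel)"
    proof (intro nn_integral_cong)
      fix t :: real
      have "exp (- t\<^sup>2 / 2) * exp (q + 2 * t * l + ?b * t\<^sup>2) = exp q * exp (- (m * t\<^sup>2 + 2 * t * (- 2 * l)) / 2)"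
        unfolding exp_add[symmetric] m_def by (simp add: field_simps)
      then show "ennreal (std_normal_density t) * ennreal (exp (q + 2 * t * l + ?b * t\<^sup>2))
        = ennreal (exp q / sqrt (2 * pi)) * ennreal ((1 + (0 + 0 * t)\<^sup>2) * exp (- (m * t\<^sup>2 + 2 * t * (- 2 * l)) / 2))"
        by (simp add: ennreal_mult[symmetric] std_normal_density_def)
    qed
    also have "\<dots> = ennreal (exp q / sqrt (2 * pi)) * ennreal (sqrt (2 * pi / m) * exp ((- 2 * l)\<^sup>2 / (2 * m)) * (1 + (0 - 0 * (- 2 * l) / m)\<^sup>2 + 0\<^sup>2 / m))"
      by (subst nn_integral_cmult, simp, subst nn_integral_gaussian_line) (use m in auto)
    also have "\<dots> = ennreal (1 / sqrt m) * ennreal (exp (q + k * l\<^sup>2))"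
      using m by (simp add: ennreal_mult[symmetric] k_def exp_add real_sqrt_divide power_mult_distrib)
    finally show ?thesis .
  qed
  \<comment> \<open>The old norm counts the off-diagonal column twice, as P + 2 s + b^2. Keeping the
    new norm below P + s leaves 4 s of the exponent for the growth of the trace, which is k s \<le>
    8/3 s.\<close>
  have gn: "(\<Sum>i<n. \<Sum>j<n. (g i j)\<^sup>2) \<le> P + s"
  proof -
    define c where "c = (\<Sum>i<n. \<Sum>j<n. a i j * (a i n * a j n))"
    have ss: "(\<Sum>i<n. \<Sum>j<n. (a i n * a j n)\<^sup>2) = s\<^sup>2"
      by (simp add: s_def power2_eq_square sum_product mult_ac)
    have "c\<^sup>2 \<le> P * s\<^sup>2"
      using sum2_Cauchy_Schwarz[of a "\<lambda>i j. a i n * a j n" n] by (simp add: c_def P_def ss)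
    also have "\<dots> \<le> (1 / 64) * s\<^sup>2"
    proof (rule mult_right_mono)
      show "P \<le> 1 / 64" using nrm Ps zero_le_power2[of ?b] by linarith
    qed simp
    also have "\<dots> = (s / 8)\<^sup>2" by (simp add: power2_eq_square)
    finally have c: "c \<le> s / 8" using Ps by (simp add: abs_le_square_iff[symmetric])
    have "(\<Sum>i<n. \<Sum>j<n. (g i j)\<^sup>2) = P + (2 * k * c + k\<^sup>2 * s\<^sup>2)"
      unfolding ss[symmetric] c_def P_def g_def
      by (simp add: power2_sum sum.distrib sum_distrib_left algebra_simps power_mult_distrib)
    also have "2 * k * c + k\<^sup>2 * s\<^sup>2 \<le> s"
    proof -
      have "2 * k * c \<le> 2 * k * (s / 8)" using c k by (intro mult_left_mono) auto
      also have "\<dots> \<le> 2 * (8 / 3) * (s / 8)" using k Ps by (intro mult_right_mono) auto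
      finally have 1: "2 * k * c \<le> (2 / 3) * s" by simp
      have s: "s \<le> 1 / 128" using nrm Ps zero_le_power2[of ?b] by linarith
      have "k\<^sup>2 * s\<^sup>2 \<le> (8 / 3)\<^sup>2 * (s * (1 / 128))"
        unfolding power2_eq_square[of s] using k Ps s by (intro mult_mono power_mono) auto
      also have "\<dots> \<le> s / 3" using Ps by (simp add: power2_eq_square)
      finally show ?thesis using 1 Ps by linarith
    qed
    finally show ?thesis by simp
  qed
  then have gn': "(\<Sum>i<n. \<Sum>j<n. (g i j)\<^sup>2) \<le> 1 / 64"
    using nrm Ps zero_le_power2[of ?b] by linarith
  have "(\<integral>\<^sup>+x. ennreal (exp (quad (Suc n) c a x)) \<partial>std_gaussian (Suc n))
     = (\<integral>\<^sup>+x. ennreal (1 / sqrt m) * ennreal (exp (quad n c g x)) \<partial>std_gaussian n)"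
    by (subst nn_integral_std_gaussian_Suc, measurable) (simp only: quad_Suc[where a = a and n = n, OF sym] inner qg)
  also have "\<dots> = ennreal (1 / sqrt m) * (\<integral>\<^sup>+x. ennreal (exp (quad n c g x)) \<partial>std_gaussian n)"
    by (rule nn_integral_cmult) measurable
  also have "\<dots> \<le> ennreal (1 / sqrt m) * ennreal (exp (c + (\<Sum>i<n. g i i) + 4 * (\<Sum>i<n. \<Sum>j<n. (g i j)\<^sup>2)))"
    using Suc.prems(1) by (intro mult_left_mono Suc.IH gn') (auto simp: g_def mult_ac)
  also have "\<dots> = ennreal (exp (- (1/2) * ln m + (c + (\<Sum>i<n. g i i) + 4 * (\<Sum>i<n. \<Sum>j<n. (g i j)\<^sup>2))))"
  proof -
    have "0 < m" using m by linarith
    then have sq: "1 / sqrt m = exp (- (1/2) * ln m)" by (rule inverse_sqrt_eq_exp)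
    show ?thesis unfolding sq exp_add[of "- (1/2) * ln m"] by (rule ennreal_mult[symmetric]) auto
  qed
  also have "\<dots> \<le> ennreal (exp (c + (\<Sum>i<Suc n. a i i) + 4 * (\<Sum>i<Suc n. \<Sum>j<Suc n. (a i j)\<^sup>2)))"
  proof -
    have 1: "- (1/2) * ln m \<le> ?b + 4 * ?b\<^sup>2"
      unfolding m_def using b by (intro ln_one_minus_lower) auto
    have "(\<Sum>i<n. g i i) = (\<Sum>i<n. a i i) + k * s"
      by (simp add: g_def s_def sum.distrib sum_distrib_left power2_eq_square)
    moreover have "k * s \<le> 8 / 3 * s" using k Ps by (intro mult_right_mono) auto
    ultimately have 2: "(\<Sum>i<n. g i i) \<le> (\<Sum>i<n. a i i) + 8 / 3 * s" by linarith
    have "4 * (\<Sum>i<Suc n. \<Sum>j<Suc n. (a i j)\<^sup>2) = 4 * P + 8 * s + 4 * ?b\<^sup>2"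
      unfolding S2 by simp
    moreover have "(\<Sum>i<Suc n. a i i) = (\<Sum>i<n. a i i) + ?b" by simp
    ultimately have "- (1/2) * ln m + (c + (\<Sum>i<n. g i i) + 4 * (\<Sum>i<n. \<Sum>j<n. (g i j)\<^sup>2))
       \<le> c + (\<Sum>i<Suc n. a i i) + 4 * (\<Sum>i<Suc n. \<Sum>j<Suc n. (a i j)\<^sup>2)"
      using 1 2 gn Ps by linarith
    then show ?thesis by (intro ennreal_leI iffD2[OF exp_le_cancel_iff])
  qed
  finally show ?case .
qed

section \<open>Clipping and comparison of Gaussians\<close>

lemma quad_affine: "l * (quad d c a x - u) = quad d (l * (c - u)) (\<lambda>i j. l * a i j) x"
  by (simp add: quad_def algebra_simps sum_distrib_left)

text \<open>Scaling by \<open>l\<close> gives coefficients of squared norm l^2/2, at most 1/72 and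
  so below the threshold 1/64; the centring cancels the trace. Quadratic forms have only exponential
  tails, so \<open>l\<close> has to be bounded.\<close>

lemma std_gaussian_quad_mgf:
  assumes sym: "\<And>i j. i < d \<Longrightarrow> j < d \<Longrightarrow> a i j = a j i"
    and nrm: "(\<Sum>i<d. \<Sum>j<d. (a i j)\<^sup>2) = 1 / 2"
    and l: "\<bar>l\<bar> \<le> 1 / 6"
  shows "(\<integral>\<^sup>+x. ennreal (exp (l * (quad d c a x - (c + (\<Sum>i<d. a i i))))) \<partial>std_gaussian d)
    \<le> ennreal (exp (2 * l\<^sup>2))"
proof -
  have n: "(\<Sum>i<d. \<Sum>j<d. (l * a i j)\<^sup>2) = l\<^sup>2 / 2"
    using nrm by (simp add: power_mult_distrib sum_distrib_left[symmetric])
  have "l\<^sup>2 \<le> (1 / 6)\<^sup>2" using l abs_le_square_iff[of l "1/6"] by simp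
  then have l2: "l\<^sup>2 / 2 \<le> 1 / 64" by (simp add: power2_eq_square)
  have "(\<integral>\<^sup>+x. ennreal (exp (l * (quad d c a x - (c + (\<Sum>i<d. a i i))))) \<partial>std_gaussian d)
    \<le> ennreal (exp (l * (c - (c + (\<Sum>i<d. a i i))) + (\<Sum>i<d. l * a i i) + 4 * (\<Sum>i<d. \<Sum>j<d. (l * a i j)\<^sup>2)))"
    unfolding quad_affine by (rule std_gaussian_exp_quad) (use sym n l2 in auto)
  also have "l * (c - (c + (\<Sum>i<d. a i i))) + (\<Sum>i<d. l * a i i) + 4 * (\<Sum>i<d. \<Sum>j<d. (l * a i j)\<^sup>2) = 2 * l\<^sup>2"
    unfolding n by (simp add: sum_distrib_left[symmetric])
  finally show ?thesis .
qed

definition clip :: "real \<Rightarrow> real \<Rightarrow> real" where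
  "clip T y = max (- T) (min T y)"

lemma clip_bounds: "0 \<le> T \<Longrightarrow> - T \<le> clip T y" "0 \<le> T \<Longrightarrow> clip T y \<le> T" "0 \<le> T \<Longrightarrow> \<bar>clip T y\<bar> \<le> T"
  by (auto simp: clip_def)

lemma clip_lipschitz: "\<bar>clip T y - clip T z\<bar> \<le> \<bar>y - z\<bar>"
  by (auto simp: clip_def max_def min_def)

lemma clip_minus: "0 \<le> T \<Longrightarrow> clip T (- y) = - clip T y"
  by (auto simp: clip_def max_def min_def)

lemma measurable_clip [measurable]: "clip T \<in> borel_measurable borel"
  unfolding clip_def[abs_def] by measurable

text \<open>For y > T the square is at most 288 exp(y/12), and y/12 \<le> y/6 - T/12 trades the rest
  of the exponent for decay in T. Negative y follow by oddness of clipping.\<close>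

lemma clip_excess_square:
  assumes T: "0 \<le> T"
  shows "(y - clip T y)\<^sup>2 \<le> 288 * exp (- T / 12) * (exp (y / 6) + exp (- y / 6))"
proof -
  have main: "(y - clip T y)\<^sup>2 \<le> 288 * exp (- T / 12) * exp (y / 6)" if "y \<ge> 0" for y
  proof (cases "y \<le> T")
    case True
    then show ?thesis using that T by (simp add: clip_def)
  next
    case False
    then have "(y - clip T y)\<^sup>2 \<le> y\<^sup>2" using T that by (intro power_mono) (auto simp: clip_def)
    also have "y\<^sup>2 = 288 * ((y / 12)\<^sup>2 / 2)" by (simp add: power2_eq_square)
    also have "(y / 12)\<^sup>2 / 2 \<le> exp (y / 12)"
      using exp_lower_Taylor_quadratic[of "y / 12"] that by linarith
    also have "exp (y / 12) \<le> exp (- T / 12 + y / 6)" using False that by simp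
    also have "\<dots> = exp (- T / 12) * exp (y / 6)" by (rule exp_add)
    finally show ?thesis by simp
  qed
  show ?thesis
  proof (cases "y \<ge> 0")
    case True
    have "288 * exp (- T / 12) * exp (y / 6) \<le> 288 * exp (- T / 12) * (exp (y / 6) + exp (- y / 6))"
      by (intro mult_left_mono) auto
    then show ?thesis using main[OF True] by linarith
  next
    case False
    have "288 * exp (- T / 12) * exp (- y / 6) \<le> 288 * exp (- T / 12) * (exp (y / 6) + exp (- y / 6))"
      by (intro mult_left_mono) auto
    moreover have "(- y - clip T (- y))\<^sup>2 = (y - clip T y)\<^sup>2"
      using T by (simp add: clip_minus power2_eq_square algebra_simps)
    moreover have "(- y - clip T (- y))\<^sup>2 \<le> 288 * exp (- T / 12) * exp (- y / 6)"
      using main[of "- y"] False by simp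
    ultimately show ?thesis by linarith
  qed
qed

lemma std_gaussian_clip_excess:
  assumes sym: "\<And>i j. i < d \<Longrightarrow> j < d \<Longrightarrow> a i j = a j i"
    and nrm: "(\<Sum>i<d. \<Sum>j<d. (a i j)\<^sup>2) = 1 / 2"
    and T: "0 \<le> T" and u: "u = c + (\<Sum>i<d. a i i)"
  shows "(\<integral>\<^sup>+x. ennreal (((quad d c a x - u) - clip T (quad d c a x - u))\<^sup>2) \<partial>std_gaussian d)
    \<le> ennreal ((25 * exp (- T / 24))\<^sup>2)"
proof -
  let ?y = "\<lambda>x. quad d c a x - u"
  have e: "(\<integral>\<^sup>+x. ennreal (exp (l * ?y x)) \<partial>std_gaussian d) \<le> ennreal (exp (1 / 18))" if "\<bar>l\<bar> = 1 / 6" for l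
  proof -
    have "l\<^sup>2 = (1 / 6)\<^sup>2" using that by (metis power2_abs)
    then have l2: "2 * l\<^sup>2 = 1 / 18" by (simp add: power2_eq_square)
    have "\<bar>l\<bar> \<le> 1 / 6" using that by simp
    from std_gaussian_quad_mgf[OF sym nrm this, of c] show ?thesis unfolding u l2 .
  qed
  have "(\<integral>\<^sup>+x. ennreal ((?y x - clip T (?y x))\<^sup>2) \<partial>std_gaussian d)
    \<le> (\<integral>\<^sup>+x. ennreal (288 * exp (- T / 12)) * (ennreal (exp ((1 / 6) * ?y x)) + ennreal (exp ((- (1 / 6)) * ?y x))) \<partial>std_gaussian d)"
  proof (intro nn_integral_mono)
    fix x
    have "ennreal ((?y x - clip T (?y x))\<^sup>2) \<le> ennreal (288 * exp (- T / 12) * (exp (?y x / 6) + exp (- ?y x / 6)))"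
      by (intro ennreal_leI clip_excess_square T)
    also have "\<dots> = ennreal (288 * exp (- T / 12)) * (ennreal (exp ((1 / 6) * ?y x)) + ennreal (exp ((- (1 / 6)) * ?y x)))"
    proof -
      have 1: "exp (z / 6) = exp ((1 / 6) * z)" for z :: real by (rule arg_cong[of _ _ exp]) simp
      have 2: "exp (- z / 6) = exp ((- (1 / 6)) * z)" for z :: real by (rule arg_cong[of _ _ exp]) simp
      have "ennreal (exp ((1 / 6) * ?y x)) + ennreal (exp ((- (1 / 6)) * ?y x)) = ennreal (exp (?y x / 6) + exp (- ?y x / 6))"
        unfolding 1[symmetric] 2[symmetric] by (rule ennreal_plus[symmetric]) auto
      moreover have "ennreal (288 * exp (- T / 12) * (exp (?y x / 6) + exp (- ?y x / 6)))
          = ennreal (288 * exp (- T / 12)) * ennreal (exp (?y x / 6) + exp (- ?y x / 6))"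
        by (rule ennreal_mult) (auto intro: add_nonneg_nonneg)
      ultimately show ?thesis by (simp only:)
    qed
    finally show "ennreal ((?y x - clip T (?y x))\<^sup>2) \<le> \<dots>" .
  qed
  also have "\<dots> = ennreal (288 * exp (- T / 12)) * ((\<integral>\<^sup>+x. ennreal (exp ((1 / 6) * ?y x)) \<partial>std_gaussian d) + (\<integral>\<^sup>+x. ennreal (exp ((- (1 / 6)) * ?y x)) \<partial>std_gaussian d))"
  proof -
    have "(\<integral>\<^sup>+x. ennreal K * (ennreal (exp (l * ?y x)) + ennreal (exp (m * ?y x))) \<partial>std_gaussian d)
       = ennreal K * ((\<integral>\<^sup>+x. ennreal (exp (l * ?y x)) \<partial>std_gaussian d) + (\<integral>\<^sup>+x. ennreal (exp (m * ?y x)) \<partial>std_gaussian d))" for K l m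
      by (subst nn_integral_cmult, measurable, subst nn_integral_add, measurable)
    then show ?thesis .
  qed
  also have "\<dots> \<le> ennreal (288 * exp (- T / 12)) * (ennreal (exp (1 / 18)) + ennreal (exp (1 / 18)))"
    by (intro mult_left_mono add_mono e) auto
  also have "\<dots> = ennreal (288 * exp (- T / 12) * (exp (1 / 18) + exp (1 / 18)))"
    by (subst ennreal_mult) (auto simp: ennreal_plus[symmetric] simp del: ennreal_plus)
  also have "\<dots> \<le> ennreal ((25 * exp (- T / 24))\<^sup>2)"
  proof (intro ennreal_leI)
    \<comment> \<open>The constant 625 is the square of 25 and exceeds 2 * 288 * exp(1/18), where
      1/18 is the exponent 2 l^2 at l = 1/6.\<close>
    have "exp (1 / 18) \<le> 1 + 1 / 18 + (1 / 18 :: real)\<^sup>2" by (rule exp_bound) auto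
    then have "exp (1 / 18) + exp (1 / 18) \<le> (625 / 288 :: real)" by (simp add: power2_eq_square)
    then have "288 * exp (- T / 12) * (exp (1 / 18) + exp (1 / 18)) \<le> 288 * exp (- T / 12) * (625 / 288)"
      by (intro mult_left_mono) auto
    also have "\<dots> = (25 * exp (- T / 24))\<^sup>2"
      by (simp add: power_mult_distrib power2_eq_square[of "exp _"] exp_add[symmetric])
    finally show "288 * exp (- T / 12) * (exp (1 / 18) + exp (1 / 18)) \<le> (25 * exp (- T / 24))\<^sup>2" .
  qed
  finally show ?thesis .
qed

section \<open>Likelihood ratio and chi-square divergence of the two Gaussians\<close>

definition gaussian_ratio :: "nat \<Rightarrow> real mat \<Rightarrow> point \<Rightarrow> real" where
  "gaussian_ratio d S x =
    exp (quad d 0 (\<lambda>i j. (1\<^sub>m d $$ (i, j) - inv_mat S $$ (i, j)) / 2) x) / sqrt (Determinant.det S)"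

lemma measurable_gaussian_ratio [measurable]: "gaussian_ratio d S \<in> borel_measurable (lebs d)"
  unfolding gaussian_ratio_def[abs_def] by measurable

lemma gaussian_eq_density:
  assumes pd: "pos_def_mat d S"
  shows "gaussian d S = density (std_gaussian d) (\<lambda>x. ennreal (gaussian_ratio d S x))"
proof -
  note dS = pos_def_mat_det_pos[OF pd]
  have "density (std_gaussian d) (\<lambda>x. ennreal (gaussian_ratio d S x))
    = density (lebs d) (\<lambda>x. ennreal (exp (- quad_form d (1\<^sub>m d) x / 2) / sqrt ((2 * pi) ^ d)) * ennreal (gaussian_ratio d S x))"
    unfolding gaussian_def by (subst density_density_eq) (measurable, simp add: inv_mat_one)
  also have "\<dots> = gaussian d S"
    unfolding gaussian_def
  proof (rule arg_cong[where f = "density (lebs d)"], rule ext)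
    fix x :: point
    have "exp (- quad_form d (1\<^sub>m d) x / 2) * exp (quad d 0 (\<lambda>i j. (1\<^sub>m d $$ (i, j) - inv_mat S $$ (i, j)) / 2) x)
       = exp (- quad_form d (inv_mat S) x / 2)"
      unfolding exp_add[symmetric] quad_def quad_form_def
      by (simp add: sum_subtractf algebra_simps diff_divide_distrib sum_divide_distrib[symmetric])
    then show "ennreal (exp (- quad_form d (1\<^sub>m d) x / 2) / sqrt ((2 * pi) ^ d)) * ennreal (gaussian_ratio d S x)
       = ennreal (exp (- quad_form d (inv_mat S) x / 2) / sqrt ((2 * pi) ^ d * Determinant.det S))"
      using dS by (simp add: gaussian_ratio_def ennreal_mult[symmetric] real_sqrt_mult)
  qed
  finally show ?thesis ..
qed

lemma frobenius_norm_square: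
  assumes "S \<in> carrier_mat d d"
  shows "(frobenius_norm (S - 1\<^sub>m d))\<^sup>2 = (\<Sum>i<d. \<Sum>j<d. (S $$ (i, j) - 1\<^sub>m d $$ (i, j))\<^sup>2)"
  using assms by (auto simp: frobenius_norm_def intro!: sum_nonneg sum.cong)

lemma frobenius_norm_nonneg: "0 \<le> frobenius_norm A"
  by (auto simp: frobenius_norm_def intro!: sum_nonneg)

text \<open>With E = S - I and B = I - S^-1 one has B = E - B E. Submultiplicativity gives |B| \<le>
  s + |B| s, hence |B| \<le> 9/8 s for s \<le> 1/9.\<close>

lemma sum2_inv_mat_deviation:
  assumes pd: "pos_def_mat d S" and s: "frobenius_norm (S - 1\<^sub>m d) \<le> 1 / 9"
  shows "(\<Sum>i<d. \<Sum>j<d. (1\<^sub>m d $$ (i, j) - inv_mat S $$ (i, j))\<^sup>2) \<le> (9 / 8 * frobenius_norm (S - 1\<^sub>m d))\<^sup>2"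
proof -
  let ?s = "frobenius_norm (S - 1\<^sub>m d)"
  let ?X = "{..<d} \<times> {..<d}"
  have S: "S \<in> carrier_mat d d" using pd by (simp add: pos_def_mat_def)
  define U where "U i j = (1\<^sub>m d :: real mat) $$ (i, j)" for i j
  define M where "M i j = inv_mat S $$ (i, j)" for i j
  define E where "E i j = S $$ (i, j) - U i j" for i j
  define B where "B i j = U i j - M i j" for i j
  define F where "F i j = (\<Sum>k<d. B i k * E k j)" for i j
  have s0: "?s \<ge> 0" by (rule frobenius_norm_nonneg)
  have delta: "(\<Sum>k<d. U i k * f k) = f i" "(\<Sum>k<d. f k * U k i) = f i" if "i < d" for i and f :: "nat \<Rightarrow> real"
  proof -
    have "(\<Sum>k<d. U i k * f k) = (\<Sum>k<d. if k = i then f k else 0)"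
      using that by (intro sum.cong) (auto simp: U_def)
    then show "(\<Sum>k<d. U i k * f k) = f i" using that by simp
    have "(\<Sum>k<d. f k * U k i) = (\<Sum>k<d. if k = i then f k else 0)"
      using that by (intro sum.cong) (auto simp: U_def)
    then show "(\<Sum>k<d. f k * U k i) = f i" using that by simp
  qed
  have MS: "(\<Sum>k<d. M i k * S $$ (k, j)) = U i j" if "i < d" "j < d" for i j
    using inv_mat_sum(2)[OF pd that] that by (simp add: M_def U_def)
  have BE: "B i j = E i j + - F i j" if "i < d" "j < d" for i j
  proof -
    have alg: "(u - m) * (s - v) = (u * s - m * s) - (u * v - m * v)" for u m s v :: real
      by (simp add: algebra_simps)
    have "F i j = (\<Sum>k<d. (U i k * S $$ (k, j) - M i k * S $$ (k, j)) - (U i k * U k j - M i k * U k j))"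
      unfolding F_def B_def E_def by (rule sum.cong[OF refl], rule alg)
    also have "\<dots> = S $$ (i, j) - U i j - (U i j - M i j)"
      unfolding sum_subtractf using that by (simp only: delta MS)
    finally show ?thesis by (simp add: B_def E_def)
  qed
  define N where "N f = L2_set (\<lambda>(i, j). f i j) ?X" for f :: "nat \<Rightarrow> nat \<Rightarrow> real"
  have N2: "(N f)\<^sup>2 = (\<Sum>i<d. \<Sum>j<d. (f i j)\<^sup>2)" and N0: "N f \<ge> 0" for f
    unfolding N_def L2_set_def
    by (auto simp: sum.cartesian_product case_prod_unfold intro!: sum_nonneg)
  have NE: "N E = ?s"
  proof (rule power2_eq_imp_eq)
    show "(N E)\<^sup>2 = ?s\<^sup>2" unfolding N2 frobenius_norm_square[OF S] E_def U_def ..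
  qed (use N0 s0 in auto)
  have "(N F)\<^sup>2 \<le> (N B * N E)\<^sup>2"
  proof -
    have "(N F)\<^sup>2 \<le> (\<Sum>i<d. \<Sum>j<d. (\<Sum>k<d. (B i k)\<^sup>2) * (\<Sum>k<d. (E k j)\<^sup>2))"
      unfolding N2 F_def by (intro sum_mono Cauchy_Schwarz_ineq_sum)
    also have "\<dots> = (\<Sum>i<d. \<Sum>k<d. (B i k)\<^sup>2) * (\<Sum>j<d. \<Sum>k<d. (E k j)\<^sup>2)"
      by (simp add: sum_product)
    also have "(\<Sum>j<d. \<Sum>k<d. (E k j)\<^sup>2) = (\<Sum>k<d. \<Sum>j<d. (E k j)\<^sup>2)" by (rule sum.swap)
    finally show ?thesis by (simp add: N2 power_mult_distrib)
  qed
  then have NF: "N F \<le> N B * N E" by (rule power2_le_imp_le) (use N0 in auto)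
  have "N B = N (\<lambda>i j. E i j + - F i j)"
    unfolding N_def by (intro L2_set_cong) (auto simp: BE)
  also have "\<dots> \<le> N E + N (\<lambda>i j. - F i j)"
    unfolding N_def using L2_set_triangle_ineq[of "\<lambda>(i, j). E i j" "\<lambda>(i, j). - F i j" ?X]
    by (simp add: case_prod_unfold)
  also have "N (\<lambda>i j. - F i j) = N F" by (simp add: N_def L2_set_def case_prod_unfold)
  finally have "N B \<le> ?s + N B * ?s" using NF NE by simp
  also have "N B * ?s \<le> N B * (1 / 9)" using s N0 by (intro mult_left_mono) auto
  finally have "N B \<le> 9 / 8 * ?s" by simp
  then have "(N B)\<^sup>2 \<le> (9 / 8 * ?s)\<^sup>2" using N0 by (intro power_mono) auto
  then show ?thesis unfolding N2 B_def U_def M_def .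
qed

text \<open>This second moment is one plus the chi-square divergence. The squared ratio is the
  exponential of a \<open>quad\<close> divided by the determinant, so the exponential moment bound
  applies; the trace term cancels against the determinant, and a term quadratic in the distance
  remains.\<close>

lemma nn_integral_ratio_square:
  assumes pd: "pos_def_mat d S" and s: "frobenius_norm (S - 1\<^sub>m d) \<le> 1 / 9"
  shows "(\<integral>\<^sup>+x. ennreal ((gaussian_ratio d S x)\<^sup>2) \<partial>std_gaussian d)
    \<le> ennreal (1 + (3 * frobenius_norm (S - 1\<^sub>m d))\<^sup>2)"
proof -
  let ?s = "frobenius_norm (S - 1\<^sub>m d)"
  let ?D = "Determinant.det S"
  define B where "B i j = (1\<^sub>m d :: real mat) $$ (i, j) - inv_mat S $$ (i, j)" for i j
  note D0 = pos_def_mat_det_pos[OF pd]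
  have s0: "?s \<ge> 0" by (rule frobenius_norm_nonneg)
  interpret I: prob_space "std_gaussian d" by (rule prob_space_gaussian[OF pos_def_one_mat])
  interpret G: prob_space "gaussian d S" by (rule prob_space_gaussian[OF pd])
  have symB: "B i j = B j i" if "i < d" "j < d" for i j
    using that inv_mat_sym[OF pd that] by (simp add: B_def)
  have nB: "(\<Sum>i<d. \<Sum>j<d. (B i j)\<^sup>2) \<le> (9 / 8 * ?s)\<^sup>2"
    unfolding B_def by (rule sum2_inv_mat_deviation[OF pd s])
  have "(9 / 8 * ?s)\<^sup>2 \<le> (1 / 8)\<^sup>2" using s s0 by (intro power_mono) auto
  then have nB': "(\<Sum>i<d. \<Sum>j<d. (B i j)\<^sup>2) \<le> 1 / 64"
    using nB by (simp add: power2_eq_square)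
  let ?t = "\<Sum>i<d. B i i"
  let ?h = "quad d 0 (\<lambda>i j. B i j / 2)"
  have ratio: "gaussian_ratio d S x = exp (?h x) / sqrt ?D" for x
    by (simp add: gaussian_ratio_def B_def)
  have "(\<integral>\<^sup>+x. 1 \<partial>gaussian d S) = (\<integral>\<^sup>+x. ennreal (gaussian_ratio d S x) * 1 \<partial>std_gaussian d)"
    unfolding gaussian_eq_density[OF pd] by (rule nn_integral_density) measurable
  then have one: "(\<integral>\<^sup>+x. ennreal (gaussian_ratio d S x) \<partial>std_gaussian d) = 1"
    using G.emeasure_space_1 by simp
  \<comment> \<open>Jensen, via the tangent of exp at \<open>?t / 2\<close>: as the ratio has mean
    1, \<open>sqrt ?D\<close> is the mean of exp of \<open>?h\<close>, which is at least exp of the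
    mean \<open>?t / 2\<close>.\<close>
  have det: "exp ?t \<le> ?D"
  proof -
    have h: "has_bochner_integral (std_gaussian d) ?h (?t / 2)"
      using std_gaussian_mean_quad[of d 0 "\<lambda>i j. B i j / 2"] by (simp add: sum_divide_distrib)
    have hw: "has_bochner_integral (std_gaussian d) (gaussian_ratio d S) 1"
      by (rule has_bochner_integral_nn_integral)
         (use one D0 in \<open>auto simp: ratio\<close>)
    have "integral\<^sup>L (std_gaussian d) (\<lambda>x. exp (?t / 2) * (1 + (?h x - ?t / 2)))
       \<le> integral\<^sup>L (std_gaussian d) (\<lambda>x. sqrt ?D * gaussian_ratio d S x)"
    proof (rule integral_mono)
      show "integrable (std_gaussian d) (\<lambda>x. exp (?t / 2) * (1 + (?h x - ?t / 2)))"
        using h by (auto simp: has_bochner_integral_iff)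
      show "integrable (std_gaussian d) (\<lambda>x. sqrt ?D * gaussian_ratio d S x)"
        using hw by (auto simp: has_bochner_integral_iff)
      fix x
      have "exp (?t / 2) * (1 + (?h x - ?t / 2)) \<le> exp (?t / 2) * exp (?h x - ?t / 2)"
        by (intro mult_left_mono exp_ge_add_one_self) auto
      also have "\<dots> = sqrt ?D * gaussian_ratio d S x"
        using D0 unfolding ratio exp_add[symmetric] by simp
      finally show "exp (?t / 2) * (1 + (?h x - ?t / 2)) \<le> sqrt ?D * gaussian_ratio d S x" .
    qed
    moreover have "integral\<^sup>L (std_gaussian d) (\<lambda>x. exp (?t / 2) * (1 + (?h x - ?t / 2))) = exp (?t / 2)"
    proof -
      have "has_bochner_integral (std_gaussian d) (\<lambda>x. 1) (1 :: real)"
        using I.prob_space by (auto simp: has_bochner_integral_iff)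
      then have "has_bochner_integral (std_gaussian d) (\<lambda>x. exp (?t / 2) * (1 + (?h x - ?t / 2)))
          (exp (?t / 2) * (1 + (?t / 2 - ?t / 2)))"
        using h by (intro has_bochner_integral_mult_right has_bochner_integral_add has_bochner_integral_diff)
          (auto simp: has_bochner_integral_iff I.prob_space[simplified])
      from has_bochner_integral_integral_eq[OF this] show ?thesis by simp
    qed
    moreover have "integral\<^sup>L (std_gaussian d) (\<lambda>x. sqrt ?D * gaussian_ratio d S x) = sqrt ?D"
      using has_bochner_integral_integral_eq[OF hw] by simp
    ultimately have "exp (?t / 2) \<le> sqrt ?D" by (simp only:)
    then have "(exp (?t / 2))\<^sup>2 \<le> (sqrt ?D)\<^sup>2" by (intro power_mono) auto
    moreover have "(exp (?t / 2))\<^sup>2 = exp ?t"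
      unfolding power2_eq_square exp_add[symmetric] by simp
    ultimately show ?thesis using D0 by simp
  qed
  have sq: "(gaussian_ratio d S x)\<^sup>2 = exp (quad d 0 B x) / ?D" for x
  proof -
    have "2 * ?h x = quad d 0 B x" unfolding quad_def by (simp add: sum_distrib_left)
    then have "exp (?h x) * exp (?h x) = exp (quad d 0 B x)"
      unfolding exp_add[symmetric] by simp
    then show ?thesis
      using D0 by (simp add: ratio power_divide power2_eq_square)
  qed
  have "(\<integral>\<^sup>+x. ennreal ((gaussian_ratio d S x)\<^sup>2) \<partial>std_gaussian d)
     = (\<integral>\<^sup>+x. ennreal (1 / ?D) * ennreal (exp (quad d 0 B x)) \<partial>std_gaussian d)"
  proof (intro nn_integral_cong)
    fix x
    show "ennreal ((gaussian_ratio d S x)\<^sup>2) = ennreal (1 / ?D) * ennreal (exp (quad d 0 B x))"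
      unfolding sq using D0 by (subst ennreal_mult[symmetric]) auto
  qed
  also have "\<dots> = ennreal (1 / ?D) * (\<integral>\<^sup>+x. ennreal (exp (quad d 0 B x)) \<partial>std_gaussian d)"
    by (rule nn_integral_cmult) measurable
  also have "\<dots> \<le> ennreal (1 / ?D) * ennreal (exp (0 + ?t + 4 * (\<Sum>i<d. \<Sum>j<d. (B i j)\<^sup>2)))"
    by (intro mult_left_mono std_gaussian_exp_quad symB nB') auto
  also have "\<dots> = ennreal (exp (4 * (\<Sum>i<d. \<Sum>j<d. (B i j)\<^sup>2)) * (exp ?t / ?D))"
  proof -
    have "1 / ?D * exp (0 + ?t + y) = exp y * (exp ?t / ?D)" for y by (simp add: exp_add)
    then show ?thesis using D0 by (subst ennreal_mult[symmetric]) auto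
  qed
  also have "\<dots> \<le> ennreal (exp (4 * (9 / 8 * ?s)\<^sup>2) * 1)"
  proof (intro ennreal_leI mult_mono)
    show "exp (4 * (\<Sum>i<d. \<Sum>j<d. (B i j)\<^sup>2)) \<le> exp (4 * (9 / 8 * ?s)\<^sup>2)"
      using nB by (intro iffD2[OF exp_le_cancel_iff] mult_left_mono) auto
    show "exp ?t / ?D \<le> 1" using det D0 by simp
  qed (use D0 in auto)
  \<comment> \<open>The exponent y is 81/16 s^2, at most 1/16, so exp y \<le> 1 + 17/16 y; the
    resulting 1377/256 is rounded up to 9 = 3^2.\<close>
  also have "\<dots> \<le> ennreal (1 + (3 * ?s)\<^sup>2)"
  proof (rule ennreal_leI)
    let ?y = "4 * (9 / 8 * ?s)\<^sup>2"
    have y: "?y \<le> 1 / 16" using \<open>(9 / 8 * ?s)\<^sup>2 \<le> (1 / 8)\<^sup>2\<close> by (simp add: power2_eq_square)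
    have "exp ?y \<le> 1 + ?y + ?y\<^sup>2" using y by (intro exp_bound) auto
    also have "?y\<^sup>2 \<le> ?y * (1 / 16)" unfolding power2_eq_square[of ?y] using y by (intro mult_left_mono) auto
    finally have "exp ?y \<le> 1 + (17 / 16) * ?y" by simp
    moreover have "(17 / 16) * ?y = 1377 / 256 * ?s\<^sup>2" by (simp add: power2_eq_square)
    moreover have "1377 / 256 * ?s\<^sup>2 \<le> 9 * ?s\<^sup>2" by (intro mult_right_mono) auto
    moreover have "9 * ?s\<^sup>2 = (3 * ?s)\<^sup>2" by (simp add: power_mult_distrib)
    ultimately show "exp ?y * 1 \<le> 1 + (3 * ?s)\<^sup>2" by linarith
  qed
  finally show ?thesis .
qed

text \<open>Cauchy--Schwarz against the chi-square divergence of the two Gaussians.\<close>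

proposition gaussian_mean_diff_le:
  assumes pd: "pos_def_mat d S" and s: "frobenius_norm (S - 1\<^sub>m d) \<le> 1 / 9"
    and h [measurable]: "h \<in> borel_measurable (lebs d)"
    and V: "(\<integral>\<^sup>+x. ennreal ((h x)\<^sup>2) \<partial>std_gaussian d) \<le> ennreal (V\<^sup>2)" "0 \<le> V"
  shows "\<bar>mean (gaussian d S) h - mean (std_gaussian d) h\<bar> \<le> 3 * frobenius_norm (S - 1\<^sub>m d) * V"
proof -
  let ?s = "frobenius_norm (S - 1\<^sub>m d)"
  let ?I = "std_gaussian d" and ?w = "gaussian_ratio d S"
  have s0: "?s \<ge> 0" by (rule frobenius_norm_nonneg)
  interpret I: prob_space ?I by (rule prob_space_gaussian[OF pos_def_one_mat])
  interpret G: prob_space "gaussian d S" by (rule prob_space_gaussian[OF pd])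
  have w0: "?w x \<ge> 0" for x using pos_def_mat_det_pos[OF pd] by (simp add: gaussian_ratio_def)
  have int_sq2: "integrable ?I (\<lambda>x. (f x)\<^sup>2)"
    if f [measurable]: "f \<in> borel_measurable ?I" and "(\<integral>\<^sup>+x. ennreal ((f x)\<^sup>2) \<partial>?I) \<le> ennreal c" for f c
  proof (rule integrableI_bounded)
    show "(\<integral>\<^sup>+x. ennreal (norm ((f x)\<^sup>2)) \<partial>?I) < \<infinity>"
      using that(2) by (simp add: le_less_trans[OF _ ennreal_less_top])
  qed measurable
  have [measurable]: "?w \<in> borel_measurable ?I" "h \<in> borel_measurable ?I" by measurable
  have iw2: "integrable ?I (\<lambda>x. (?w x)\<^sup>2)" and ih2: "integrable ?I (\<lambda>x. (h x)\<^sup>2)"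
    by (rule int_sq2[OF _ nn_integral_ratio_square[OF pd s]], measurable) (rule int_sq2[OF _ V(1)], measurable)
  have iw: "integrable ?I ?w" "integrable ?I (\<lambda>x. (?w x)\<^sup>2)" and ih: "integrable ?I h"
    using I.square_integrable_imp_integrable[OF _ iw2] I.square_integrable_imp_integrable[OF _ ih2] iw2 by auto
  have Ew: "(\<integral>x. ?w x \<partial>?I) = 1"
  proof -
    have "mean (gaussian d S) (\<lambda>_. 1) = (\<integral>x. ?w x *\<^sub>R 1 \<partial>?I)"
      unfolding mean_def gaussian_eq_density[OF pd] by (rule integral_density) (auto simp: w0)
    then show ?thesis using G.prob_space by (simp add: mean_def)
  qed
  have Ew2: "(\<integral>x. (?w x)\<^sup>2 \<partial>?I) \<le> 1 + (3 * ?s)\<^sup>2"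
  proof -
    have "ennreal (\<integral>x. (?w x)\<^sup>2 \<partial>?I) = (\<integral>\<^sup>+x. ennreal ((?w x)\<^sup>2) \<partial>?I)"
      by (rule nn_integral_eq_integral[symmetric]) (use iw in auto)
    also note nn_integral_ratio_square[OF pd s]
    finally show ?thesis by (subst (asm) ennreal_le_iff) auto
  qed
  have iw1: "integrable ?I (\<lambda>x. (?w x - 1)\<^sup>2)" using iw by (simp add: power2_diff)
  have "(\<integral>x. (?w x - 1)\<^sup>2 \<partial>?I) = (\<integral>x. (?w x)\<^sup>2 \<partial>?I) - 1"
    using iw Ew I.prob_space by (simp add: power2_diff)
  then have chi: "(\<integral>x. (?w x - 1)\<^sup>2 \<partial>?I) \<le> (3 * ?s)\<^sup>2" using Ew2 by simp
  have CS: "(\<integral>\<^sup>+x. ennreal \<bar>h x * (?w x - 1)\<bar> \<partial>?I)\<^sup>2 \<le> ennreal ((V * (3 * ?s))\<^sup>2)"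
  proof -
    have "(\<integral>\<^sup>+x. ennreal \<bar>h x * (?w x - 1)\<bar> \<partial>?I)\<^sup>2 = (\<integral>\<^sup>+x. ennreal \<bar>h x\<bar> * ennreal \<bar>?w x - 1\<bar> \<partial>?I)\<^sup>2"
      by (simp add: abs_mult ennreal_mult)
    also have "\<dots> \<le> (\<integral>\<^sup>+x. (ennreal \<bar>h x\<bar>)\<^sup>2 \<partial>?I) * (\<integral>\<^sup>+x. (ennreal \<bar>?w x - 1\<bar>)\<^sup>2 \<partial>?I)"
      by (rule Cauchy_Schwarz_nn_integral) measurable
    also have "\<dots> = (\<integral>\<^sup>+x. ennreal ((h x)\<^sup>2) \<partial>?I) * (\<integral>\<^sup>+x. ennreal ((?w x - 1)\<^sup>2) \<partial>?I)"
      by (simp add: ennreal_power)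
    also have "\<dots> \<le> ennreal (V\<^sup>2) * ennreal ((3 * ?s)\<^sup>2)"
      using V(1) chi iw1 by (intro mult_mono) (auto simp: nn_integral_eq_integral intro: ennreal_leI)
    finally show ?thesis by (simp add: ennreal_mult[symmetric] power_mult_distrib)
  qed
  \<comment> \<open>\<open>h\<close> is only square integrable under N(0,I), so integrability of the
    product has to come from Cauchy--Schwarz.\<close>
  have hw: "integrable ?I (\<lambda>x. h x * (?w x - 1))"
  proof (rule integrableI_bounded)
    have "(\<integral>\<^sup>+x. ennreal \<bar>h x * (?w x - 1)\<bar> \<partial>?I)\<^sup>2 < \<infinity>"
      using CS by (rule le_less_trans) simp
    then show "(\<integral>\<^sup>+x. ennreal (norm (h x * (?w x - 1))) \<partial>?I) < \<infinity>"
      by (cases "(\<integral>\<^sup>+x. ennreal \<bar>h x * (?w x - 1)\<bar> \<partial>?I) = \<infinity>") (auto simp: power2_eq_square top.not_eq_extremum ennreal_top_mult)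
  qed measurable
  have "mean (gaussian d S) h = (\<integral>x. ?w x *\<^sub>R h x \<partial>?I)"
    unfolding mean_def gaussian_eq_density[OF pd] by (rule integral_density) (auto simp: w0)
  also have "\<dots> = (\<integral>x. h x * (?w x - 1) + h x \<partial>?I)"
    by (intro Bochner_Integration.integral_cong) (auto simp: algebra_simps)
  also have "\<dots> = (\<integral>x. h x * (?w x - 1) \<partial>?I) + mean ?I h"
    using hw ih by (simp add: mean_def)
  finally have "\<bar>mean (gaussian d S) h - mean ?I h\<bar> = \<bar>\<integral>x. h x * (?w x - 1) \<partial>?I\<bar>" by simp
  also have "\<dots> \<le> (\<integral>x. \<bar>h x * (?w x - 1)\<bar> \<partial>?I)" by (rule integral_abs_bound)
  also have "\<dots> \<le> V * (3 * ?s)"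
  proof (rule power2_le_imp_le)
    have e: "(\<integral>\<^sup>+x. ennreal \<bar>h x * (?w x - 1)\<bar> \<partial>?I) = ennreal (\<integral>x. \<bar>h x * (?w x - 1)\<bar> \<partial>?I)"
      using hw by (intro nn_integral_eq_integral integrable_abs) auto
    show "(\<integral>x. \<bar>h x * (?w x - 1)\<bar> \<partial>?I)\<^sup>2 \<le> (V * (3 * ?s))\<^sup>2"
      using CS unfolding e by (subst (asm) ennreal_power) (auto simp: ennreal_le_iff2 intro: integral_nonneg)
    show "0 \<le> V * (3 * ?s)" using V s0 by simp
  qed
  finally show ?thesis by (simp add: mult_ac)
qed

section \<open>Good sets and corrupted samples\<close>

lemma ennreal_clip_layer_cake:
  assumes T: "0 \<le> T"
  shows "ennreal (clip T y + T) = (\<integral>\<^sup>+t. (if t \<le> y \<and> - T \<le> t \<and> t \<le> T then 1 else 0) \<partial>lborel)"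
proof -
  have "(\<integral>\<^sup>+t. (if t \<le> y \<and> - T \<le> t \<and> t \<le> T then 1 else 0) \<partial>lborel)
    = (\<integral>\<^sup>+t. indicator {- T..min T y} t \<partial>lborel)"
    by (intro nn_integral_cong) (auto split: split_indicator)
  also have "\<dots> = emeasure lborel {- T..min T y}" by simp
  also have "\<dots> = ennreal (clip T y + T)"
    using T by (cases "- T \<le> min T y") (auto simp: clip_def max_def)
  finally show ?thesis ..
qed

lemma integrable_clip:
  assumes "prob_space M" and [measurable]: "f \<in> borel_measurable M" and T: "0 \<le> T"
  shows "integrable M (\<lambda>x. clip T (f x))"
proof -
  interpret prob_space M by fact
  show ?thesis
    using clip_bounds(3)[OF T] by (intro integrable_const_bound[where B = T]) auto
qed

text \<open>Shifted up by T, the clipped function is the integral over thresholds t in [-T, T] of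
  the indicators of f \<ge> t; Tonelli exchanges the two integrals.\<close>

lemma mean_clip_layer_cake:
  assumes M: "prob_space M" and f [measurable]: "f \<in> borel_measurable M" and T: "0 \<le> T"
  shows "ennreal (mean M (\<lambda>x. clip T (f x)) + T)
    = (\<integral>\<^sup>+t. ennreal (prob_nonneg M (\<lambda>x. f x - t)) * indicator {- T..T} t \<partial>lborel)"
proof -
  interpret prob_space M by fact
  interpret P: pair_sigma_finite M lborel by standard
  let ?h = "\<lambda>x t. (if t \<le> f x \<and> - T \<le> t \<and> t \<le> T then 1 else 0 :: ennreal)"
  have "ennreal (mean M (\<lambda>x. clip T (f x)) + T) = ennreal (\<integral>x. clip T (f x) + T \<partial>M)"
    using integrable_clip[OF M f T] prob_space by (simp add: mean_def)
  also have "\<dots> = (\<integral>\<^sup>+x. ennreal (clip T (f x) + T) \<partial>M)"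
  proof (rule nn_integral_eq_integral[symmetric])
    show "AE x in M. 0 \<le> clip T (f x) + T"
    proof (rule AE_I2)
      fix x show "0 \<le> clip T (f x) + T" using clip_bounds(1)[OF T, of "f x"] by linarith
    qed
  qed (use integrable_clip[OF M f T] in simp)
  also have "\<dots> = (\<integral>\<^sup>+x. \<integral>\<^sup>+t. ?h x t \<partial>lborel \<partial>M)"
    unfolding ennreal_clip_layer_cake[OF T] ..
  also have "\<dots> = (\<integral>\<^sup>+t. \<integral>\<^sup>+x. ?h x t \<partial>M \<partial>lborel)"
    by (rule P.Fubini'[symmetric]) measurable
  also have "\<dots> = (\<integral>\<^sup>+t. ennreal (prob_nonneg M (\<lambda>x. f x - t)) * indicator {- T..T} t \<partial>lborel)"
  proof (rule nn_integral_cong)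
    fix t :: real
    have "(\<integral>\<^sup>+x. ?h x t \<partial>M) = (\<integral>\<^sup>+x. indicator {- T..T} t * indicator {x \<in> space M. t \<le> f x} x \<partial>M)"
      by (intro nn_integral_cong) (auto split: split_indicator)
    also have "\<dots> = indicator {- T..T} t * emeasure M {x \<in> space M. t \<le> f x}"
      by (subst nn_integral_cmult) auto
    finally show "(\<integral>\<^sup>+x. ?h x t \<partial>M) = ennreal (prob_nonneg M (\<lambda>x. f x - t)) * indicator {- T..T} t"
      by (simp add: prob_nonneg_def emeasure_eq_measure mult.commute)
  qed
  finally show ?thesis .
qed

text \<open>A bound on all upper tails becomes a bound on clipped means, the slack \<open>k\<close>
  being integrated over an interval of length 2 T. For an unclipped function it would be integrated
  over the whole line.\<close>

lemma mean_clip_mono: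
  assumes M: "prob_space M" "f \<in> borel_measurable M"
    and N: "prob_space N" "f \<in> borel_measurable N"
    and T: "0 \<le> T" and k: "0 \<le> k"
    and le: "\<And>t. prob_nonneg M (\<lambda>x. f x - t) \<le> prob_nonneg N (\<lambda>x. f x - t) + k"
  shows "mean M (\<lambda>x. clip T (f x)) \<le> mean N (\<lambda>x. clip T (f x)) + 2 * T * k"
proof -
  interpret N: prob_space N by fact
  note [measurable] = N(2)
  \<comment> \<open>The tail is measurable in t as the measure of a section of a measurable set in
    the product space.\<close>
  have meas: "(\<lambda>t. ennreal (prob_nonneg N (\<lambda>x. f x - t))) \<in> borel_measurable lborel"
  proof -
    have "(\<lambda>t. emeasure N (Pair t -` {z \<in> space (lborel \<Otimes>\<^sub>M N). fst z \<le> f (snd z)})) \<in> borel_measurable lborel"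
      by (intro N.measurable_emeasure_Pair) measurable
    also have "(\<lambda>t. emeasure N (Pair t -` {z \<in> space (lborel \<Otimes>\<^sub>M N). fst z \<le> f (snd z)}))
       = (\<lambda>t. ennreal (prob_nonneg N (\<lambda>x. f x - t)))"
      by (rule ext) (auto simp: prob_nonneg_def N.emeasure_eq_measure space_pair_measure intro!: arg_cong[of _ _ "measure N"])
    finally show ?thesis .
  qed
  have Nge: "0 \<le> mean N (\<lambda>x. clip T (f x)) + T"
  proof -
    have "- T = (\<integral>x. - T \<partial>N)" using N.prob_space by simp
    also have "\<dots> \<le> mean N (\<lambda>x. clip T (f x))"
      unfolding mean_def using clip_bounds(1)[OF T] by (intro integral_mono integrable_clip N T) auto
    finally show ?thesis by simp
  qed
  have "ennreal (mean M (\<lambda>x. clip T (f x)) + T)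
    = (\<integral>\<^sup>+t. ennreal (prob_nonneg M (\<lambda>x. f x - t)) * indicator {- T..T} t \<partial>lborel)"
    by (rule mean_clip_layer_cake[OF M T])
  also have "\<dots> \<le> (\<integral>\<^sup>+t. ennreal (prob_nonneg N (\<lambda>x. f x - t)) * indicator {- T..T} t + ennreal k * indicator {- T..T} t \<partial>lborel)"
  proof (rule nn_integral_mono)
    fix t :: real
    have "ennreal (prob_nonneg M (\<lambda>x. f x - t)) \<le> ennreal (prob_nonneg N (\<lambda>x. f x - t) + k)"
      by (intro ennreal_leI le)
    also have "\<dots> = ennreal (prob_nonneg N (\<lambda>x. f x - t)) + ennreal k"
      using k by (intro ennreal_plus) (auto simp: prob_nonneg_def)
    finally show "ennreal (prob_nonneg M (\<lambda>x. f x - t)) * indicator {- T..T} t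
      \<le> ennreal (prob_nonneg N (\<lambda>x. f x - t)) * indicator {- T..T} t + ennreal k * indicator {- T..T} t"
      by (auto split: split_indicator)
  qed
  also have "\<dots> = (\<integral>\<^sup>+t. ennreal (prob_nonneg N (\<lambda>x. f x - t)) * indicator {- T..T} t \<partial>lborel)
      + (\<integral>\<^sup>+t. ennreal k * indicator {- T..T} t \<partial>lborel)"
    using meas by (intro nn_integral_add) auto
  also have "(\<integral>\<^sup>+t. ennreal k * indicator {- T..T} t \<partial>lborel) = ennreal (k * (2 * T))"
    using T k by (subst nn_integral_cmult_indicator) (auto simp: ennreal_mult)
  also have "(\<integral>\<^sup>+t. ennreal (prob_nonneg N (\<lambda>x. f x - t)) * indicator {- T..T} t \<partial>lborel)
    = ennreal (mean N (\<lambda>x. clip T (f x)) + T)"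
    by (rule mean_clip_layer_cake[OF N T, symmetric])
  also have "ennreal (mean N (\<lambda>x. clip T (f x)) + T) + ennreal (k * (2 * T))
     = ennreal (mean N (\<lambda>x. clip T (f x)) + T + k * (2 * T))"
    using Nge k T by (subst ennreal_plus) auto
  finally show ?thesis using Nge k T by (subst (asm) ennreal_le_iff) (auto simp: mult_ac)
qed

section \<open>Consequences of goodness\<close>

lemma even_deg2_quad: "quad d c a \<in> even_deg2 d"
  by (auto simp: even_deg2_def quad_def[abs_def])

lemma mean_pmf_of_set:
  "finite G \<Longrightarrow> G \<noteq> {} \<Longrightarrow> mean (measure_pmf (pmf_of_set G)) f = (\<Sum>x\<in>G. f x) / card G"
  by (simp add: mean_def integral_pmf_of_set)

text \<open>Shifting the threshold changes only the constant of the polynomial, so the tail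
  condition covers all thresholds. Goodness bounds upper tails only; the other direction comes from
  the negated polynomial, as clipping is odd.\<close>

lemma good_mean_clip:
  assumes pd: "pos_def_mat d S" and good: "good K d \<epsilon> \<eta> \<delta> S G" and T: "0 \<le> T"
    and L: "0 < real d * ln (real (card G) / \<delta>)"
  shows "\<bar>mean (measure_pmf (pmf_of_set G)) (\<lambda>x. clip T (quad d c a x - u)) - mean (gaussian d S) (\<lambda>x. clip T (quad d c a x - u))\<bar>
    \<le> 2 * T * (\<eta>\<^sup>2 / (real d * ln (real (card G) / \<delta>)))"
proof -
  let ?U = "measure_pmf (pmf_of_set G)" and ?N = "gaussian d S"
  let ?k = "\<eta>\<^sup>2 / (real d * ln (real (card G) / \<delta>))"
  have k: "0 \<le> ?k" using L by simp
  have pr: "prob_nonneg ?U p \<le> prob_nonneg ?N p + ?k" if "p \<in> even_deg2 d" for p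
    using good that by (auto simp: good_def Let_def)
  have le: "mean ?U (\<lambda>x. clip T (quad d c a x)) \<le> mean ?N (\<lambda>x. clip T (quad d c a x)) + 2 * T * ?k" for c a
  proof (rule mean_clip_mono)
    fix t
    have "(\<lambda>x. quad d c a x - t) = quad d (c - t) a" by (rule ext) (simp add: quad_def)
    then show "prob_nonneg ?U (\<lambda>x. quad d c a x - t) \<le> prob_nonneg ?N (\<lambda>x. quad d c a x - t) + ?k"
      using pr[OF even_deg2_quad] by simp
  qed (use k T in \<open>auto intro: prob_space_gaussian[OF pd] prob_space_measure_pmf\<close>)
  have e1: "quad d c a x - u = quad d (c - u) a x" for x by (simp add: quad_def)
  have e2: "clip T (quad d (- (c - u)) (\<lambda>i j. - a i j) x) = - clip T (quad d (c - u) a x)" for x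
    unfolding clip_minus[OF T, symmetric] by (simp add: quad_def sum_negf)
  show ?thesis
    using le[of "c - u" a] le[of "- (c - u)" "\<lambda>i j. - a i j"]
    unfolding e1 e2 by (simp add: mean_def abs_le_iff)
qed

text \<open>The comparison of the squares is void if the square is not integrable (the Bochner integral
  is then \<open>0\<close>), but in that case the comparison of the means is exact.\<close>

lemma good_log_factor_lower:
  assumes pd: "pos_def_mat d S" and good: "good K d \<epsilon> \<eta> \<delta> S G" and \<eta>: "0 < \<eta>" "\<eta> \<le> 1 / 2" and d: "0 < d"
  shows "1 / 2 \<le> K * (real d * ln (real (card G) / \<delta>))"
proof (rule ccontr)
  \<comment> \<open>Condition (1) would then confine the form of the inverse covariance to [0, 1/2]
    on \<open>G\<close>, although its Gaussian mean is d and its second moment, if finite, is at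
    least d^2. The bound so obtained is what turns the tail slack \<eta>^2 / L into
    O(\<eta>^2).\<close>
  assume neg: "\<not> ?thesis"
  let ?U = "measure_pmf (pmf_of_set G)" and ?N = "gaussian d S"
  let ?q = "quad d 0 (\<lambda>i j. inv_mat S $$ (i, j))"
  interpret N: prob_space ?N by (rule prob_space_gaussian[OF pd])
  have G: "finite G" "G \<noteq> {}" using good by (auto simp: good_def Let_def)
  have card: "0 < card G" using G by (simp add: card_gt_0_iff)
  have q: "quad_form d (inv_mat S) x = ?q x" for x by (simp add: quad_form_def quad_def)
  have qb: "0 \<le> ?q x \<and> ?q x \<le> 1 / 2" if "x \<in> G" for x
  proof
    show "?q x \<le> 1 / 2" using good that neg unfolding good_def Let_def q by fastforce
    show "0 \<le> ?q x"
    proof (cases "\<exists>i<d. x i \<noteq> 0")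
      case True
      then show ?thesis using pos_def_inv_mat[OF pd] unfolding q[symmetric] pos_def_mat_def by (auto intro: less_imp_le)
    next
      case False
      then show ?thesis by (simp add: quad_def)
    qed
  qed
  have mean_le: "mean ?U f \<le> b" if "\<And>x. x \<in> G \<Longrightarrow> f x \<le> b" for f and b :: real
    using sum_bounded_above[of G f b] that G card by (simp add: mean_pmf_of_set field_simps)
  have U1: "mean ?U ?q \<le> 1 / 2" by (rule mean_le) (use qb in blast)
  have U2: "mean ?U (\<lambda>x. (?q x)\<^sup>2) \<le> 1 / 4"
  proof (rule mean_le)
    fix x assume "x \<in> G"
    then have "(?q x)\<^sup>2 \<le> (1 / 2)\<^sup>2" using qb by (intro power_mono) auto
    then show "(?q x)\<^sup>2 \<le> 1 / 4" by (simp add: power2_eq_square)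
  qed
  have "has_bochner_integral ?N ?q (0 + (\<Sum>i<d. \<Sum>j<d. inv_mat S $$ (i, j) * S $$ (i, j)))"
    by (rule gaussian_mean_quad[OF pd])
  also have "(\<Sum>i<d. \<Sum>j<d. inv_mat S $$ (i, j) * S $$ (i, j)) = (\<Sum>i<d. \<Sum>j<d. inv_mat S $$ (i, j) * S $$ (j, i))"
    using pd by (intro sum.cong refl) (auto simp: pos_def_mat_def)
  also have "\<dots> = (\<Sum>i<d. 1)" by (intro sum.cong refl) (auto simp: inv_mat_sum[OF pd])
  finally have N1: "has_bochner_integral ?N ?q (real d)" by simp
  have cmp: "\<bar>mean ?U ?q - mean ?N ?q\<bar> \<le> \<eta> * sqrt (mean ?N (\<lambda>x. (?q x)\<^sup>2))"
    "\<bar>mean ?U (\<lambda>x. (?q x)\<^sup>2) - mean ?N (\<lambda>x. (?q x)\<^sup>2)\<bar> \<le> \<eta> * mean ?N (\<lambda>x. (?q x)\<^sup>2)"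
    using good even_deg2_quad[of d 0 "\<lambda>i j. inv_mat S $$ (i, j)"] unfolding good_def Let_def by blast+
  have m1: "mean ?N ?q = real d" using N1 by (simp add: mean_def has_bochner_integral_iff)
  show False
  proof (cases "integrable ?N (\<lambda>x. (?q x)\<^sup>2)")
    case True
    have one: "has_bochner_integral ?N (\<lambda>x. (real d)\<^sup>2) ((real d)\<^sup>2)"
      using N.prob_space by (auto simp: has_bochner_integral_iff)
    have "has_bochner_integral ?N (\<lambda>x. ((?q x)\<^sup>2 - (2 * real d) * ?q x) + (real d)\<^sup>2)
       ((mean ?N (\<lambda>x. (?q x)\<^sup>2) - (2 * real d) * real d) + (real d)\<^sup>2)"
      unfolding mean_def by (intro has_bochner_integral_add has_bochner_integral_diff
        has_bochner_integral_mult_right has_bochner_integral_integrable True N1 one)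
    also have "(\<lambda>x. ((?q x)\<^sup>2 - (2 * real d) * ?q x) + (real d)\<^sup>2) = (\<lambda>x. (?q x - real d)\<^sup>2)"
      by (rule ext) (simp add: power2_diff)
    finally have "(\<integral>x. (?q x - real d)\<^sup>2 \<partial>?N)
        = (mean ?N (\<lambda>x. (?q x)\<^sup>2) - (2 * real d) * real d) + (real d)\<^sup>2"
      by (rule has_bochner_integral_integral_eq)
    moreover have "0 \<le> (\<integral>x. (?q x - real d)\<^sup>2 \<partial>?N)" by simp
    ultimately have "0 \<le> (mean ?N (\<lambda>x. (?q x)\<^sup>2) - (2 * real d) * real d) + (real d)\<^sup>2" by simp
    then have m2: "(real d)\<^sup>2 \<le> mean ?N (\<lambda>x. (?q x)\<^sup>2)" by (simp add: power2_eq_square)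
    have "1 \<le> (real d)\<^sup>2" using d by simp
    with m2 have m2': "1 \<le> mean ?N (\<lambda>x. (?q x)\<^sup>2)" by linarith
    \<comment> \<open>The uniform second moment is then at least half of the Gaussian one, hence at
      least 1/2, whereas \<open>U2\<close> allows only 1/4.\<close>
    have "\<eta> * mean ?N (\<lambda>x. (?q x)\<^sup>2) \<le> 1 / 2 * mean ?N (\<lambda>x. (?q x)\<^sup>2)"
      using \<eta> m2' by (intro mult_right_mono) auto
    then show False using cmp(2) U2 m2' by linarith
  next
    case False
    then have "mean ?N (\<lambda>x. (?q x)\<^sup>2) = 0" by (simp add: mean_def not_integrable_integral_eq)
    then show False using cmp(1) U1 m1 d by simp
  qed
qed

lemma AE_gaussian_coordinate_neq:
  assumes pd: "pos_def_mat d S" and k: "k < d"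
  shows "AE x in gaussian d S. x k \<noteq> y"
proof -
  let ?A = "PiE {..<d} (\<lambda>i. if i = k then {y} else UNIV)"
  have "emeasure (lebs d) ?A = (\<Prod>i<d. emeasure lborel (if i = k then {y} else UNIV :: real set))"
    by (rule product_sigma_finite.emeasure_PiM[OF product_sigma_finite_lborel]) auto
  also have "\<dots> = 0" using k by (intro prod_zero) auto
  finally have "?A \<in> null_sets (lebs d)"
    by (intro null_setsI) (auto intro!: sets_PiM_I_finite)
  then have "AE x in lebs d. x \<notin> ?A" by (rule AE_not_in)
  then have "AE x in lebs d. x k \<noteq> y"
    using AE_space by eventually_elim (auto simp: space_PiM PiE_def Pi_def split: if_splits)
  then show ?thesis unfolding gaussian_def by (subst AE_density) auto
qed

text \<open>The quartic -(x_0^2 - z_0^2)^2 with z in \<open>G\<close> is nonnegative at z but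
  negative Gaussian-almost everywhere. The tail condition then bounds the mass 1/|G| of z by its
  slack alone.\<close>

lemma good_card_lower:
  assumes pd: "pos_def_mat d S" and good: "good K d \<epsilon> \<eta> \<delta> S G" and d: "0 < d"
  shows "1 / real (card G) \<le> \<eta>\<^sup>2 / (2 * ln (1 / \<epsilon>) * (real d * ln (real (card G) / \<delta>))\<^sup>2)"
proof -
  let ?U = "measure_pmf (pmf_of_set G)" and ?N = "gaussian d S"
  interpret N: prob_space ?N by (rule prob_space_gaussian[OF pd])
  have G: "finite G" "G \<noteq> {}" using good by (auto simp: good_def Let_def)
  then obtain z where z: "z \<in> G" by blast
  define y where "y = z 0"
  define r :: "point \<Rightarrow> real" where "r x = - ((x 0)\<^sup>2 - y\<^sup>2)\<^sup>2" for x
  have "r \<in> even_deg4 d"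
  proof -
    \<comment> \<open>Nested conditionals in place of a conjunction let \<open>i0\<close> and
      \<open>z0\<close> collapse the sums one index at a time.\<close>
    define a :: "nat \<Rightarrow> nat \<Rightarrow> real" where "a i j = (if i = 0 then if j = 0 then 2 * y\<^sup>2 else 0 else 0)" for i j
    define b :: "nat \<Rightarrow> nat \<Rightarrow> nat \<Rightarrow> nat \<Rightarrow> real" where
      "b i j k l = (if i = 0 then if j = 0 then if k = 0 then if l = 0 then - 1 else 0 else 0 else 0 else 0)" for i j k l
    have z0: "(\<Sum>i<d. if i = 0 then f i else 0) = f 0" for f :: "nat \<Rightarrow> real"
      using d by simp
    have i0: "(\<Sum>j\<in>A. if P then f j else 0) = (if P then \<Sum>j\<in>A. f j else 0)" for P A and f :: "nat \<Rightarrow> real"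
      by simp
    have m0: "(if P then u else 0) * v = (if P then u * v else 0)" for P and u v :: real by simp
    have A: "(\<Sum>i<d. \<Sum>j<d. a i j * x i * x j) = 2 * y\<^sup>2 * x 0 * x 0" for x
      unfolding a_def by (simp only: m0 i0 z0)
    have B: "(\<Sum>i<d. \<Sum>j<d. \<Sum>k<d. \<Sum>l<d. b i j k l * x i * x j * x k * x l) = - 1 * x 0 * x 0 * x 0 * x 0" for x
      unfolding b_def by (simp only: m0 i0 z0)
    have "r = (\<lambda>x. - (y\<^sup>2 * y\<^sup>2) + (\<Sum>i<d. \<Sum>j<d. a i j * x i * x j)
     + (\<Sum>i<d. \<Sum>j<d. \<Sum>k<d. \<Sum>l<d. b i j k l * x i * x j * x k * x l))"
      unfolding A B r_def by (rule ext) (simp add: power2_eq_square algebra_simps)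
    then show ?thesis unfolding even_deg4_def by blast
  qed
  then have "prob_nonneg ?U r \<le> prob_nonneg ?N r + \<eta>\<^sup>2 / (2 * ln (1 / \<epsilon>) * (real d * ln (real (card G) / \<delta>))\<^sup>2)"
    using good unfolding good_def Let_def by blast
  moreover have "prob_nonneg ?N r = 0"
  proof -
    have "AE x in ?N. \<not> 0 \<le> r x"
      using AE_gaussian_coordinate_neq[OF pd d, of y] AE_gaussian_coordinate_neq[OF pd d, of "- y"]
    proof eventually_elim
      case (elim x)
      then have "(x 0)\<^sup>2 \<noteq> y\<^sup>2" by (simp add: power2_eq_iff)
      then have "((x 0)\<^sup>2 - y\<^sup>2)\<^sup>2 > 0" by simp
      then show ?case unfolding r_def by linarith
    qed
    then show ?thesis unfolding prob_nonneg_def by (intro N.prob_eq_0_AE) 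
  qed
  moreover have "1 / real (card G) \<le> prob_nonneg ?U r"
  proof -
    have "1 / real (card G) = measure ?U {z}" using G z by (simp add: measure_pmf_single)
    also have "\<dots> \<le> measure ?U {x \<in> space ?U. 0 \<le> r x}"
      by (intro measure_pmf.finite_measure_mono) (auto simp: r_def y_def)
    finally show ?thesis by (simp add: prob_nonneg_def)
  qed
  ultimately show ?thesis by linarith
qed

section \<open>Averages over a corrupted sample\<close>

lemma abs_sum_mset_le:
  fixes f :: "'a \<Rightarrow> real"
  assumes "\<And>x. \<bar>f x\<bar> \<le> T"
  shows "\<bar>\<Sum>x\<in>#A. f x\<bar> \<le> T * size A"
proof (induction A)
  case (add x A)
  then show ?case using assms[of x] by (simp add: algebra_simps)
qed simp

lemma phi_psi_size:
  fixes xs :: "point list"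
  assumes n: "xs \<noteq> []" and G: "finite G"
  defines "I \<equiv> mset xs \<inter># mset_set G"
  shows "size (mset_set G - I) = real (length xs) * phi (mset xs) G"
    "size (mset xs - mset_set G) = real (length xs) * psi (mset xs) G"
    "real (length xs) = size I + real (length xs) * psi (mset xs) G"
    "real (card G) = size I + real (length xs) * phi (mset xs) G"
proof -
  have n: "length xs > 0" using n by simp
  show 1: "size (mset_set G - I) = real (length xs) * phi (mset xs) G"
    "size (mset xs - mset_set G) = real (length xs) * psi (mset xs) G"
    using n by (auto simp: phi_def psi_def I_def)
  have "mset xs = I + (mset xs - mset_set G)" by (rule multiset_eqI) (simp add: I_def)
  from arg_cong[OF this, of size] have "size (mset xs) = size I + size (mset xs - mset_set G)"
    unfolding size_union .
  then show "real (length xs) = size I + real (length xs) * psi (mset xs) G"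
    using 1(2) size_mset[of xs] by linarith
  have "mset_set G = I + (mset_set G - I)" by (rule multiset_eqI) (simp add: I_def)
  from arg_cong[OF this, of size] have "size (mset_set G) = size I + size (mset_set G - I)"
    unfolding size_union .
  then show "real (card G) = size I + real (length xs) * phi (mset xs) G"
    using 1(1) size_mset_set[of G] by linarith
qed

lemma phi_psi_nonneg: "0 \<le> phi S G" "0 \<le> psi S G"
  by (auto simp: phi_def psi_def)

text \<open>The two sums share the common part, and each point outside it costs at most T. The
  denominators differ by n (phi - psi), which costs at most the same amount once more; hence the
  factor 2.\<close>

lemma corrupted_mean_bounded:
  fixes xs :: "point list"
  assumes n: "xs \<noteq> []" and G: "finite G" "G \<noteq> {}" and f: "\<And>x. \<bar>f x\<bar> \<le> T"
  shows "\<bar>(\<Sum>x\<leftarrow>xs. f x) / length xs - mean (measure_pmf (pmf_of_set G)) f\<bar>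
    \<le> 2 * T * (psi (mset xs) G + phi (mset xs) G)"
proof -
  let ?n = "real (length xs)" and ?g = "real (card G)" and ?I = "mset xs \<inter># mset_set G"
  let ?ph = "phi (mset xs) G" and ?ps = "psi (mset xs) G"
  have n0: "?n > 0" and g0: "?g > 0" using n G by (auto simp: card_gt_0_iff)
  have T: "0 \<le> T" using f[of undefined] by linarith
  note sz = phi_psi_size[OF n G(1)]
  have e1: "mset xs = ?I + (mset xs - mset_set G)" by (rule multiset_eqI) simp
  have e2: "mset_set G = ?I + (mset_set G - ?I)" by (rule multiset_eqI) simp
  have s1: "(\<Sum>x\<leftarrow>xs. f x) = (\<Sum>x\<in>#?I. f x) + (\<Sum>x\<in>#mset xs - mset_set G. f x)"
  proof -
    have "(\<Sum>x\<leftarrow>xs. f x) = (\<Sum>x\<in>#mset xs. f x)" by (simp flip: sum_mset_sum_list)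
    also have "\<dots> = (\<Sum>x\<in>#?I + (mset xs - mset_set G). f x)" using e1 by simp
    finally show ?thesis by simp
  qed
  have s2: "(\<Sum>x\<in>G. f x) = (\<Sum>x\<in>#?I. f x) + (\<Sum>x\<in>#mset_set G - ?I. f x)"
  proof -
    have "(\<Sum>x\<in>G. f x) = (\<Sum>x\<in>#mset_set G. f x)" by (simp add: sum_unfold_sum_mset)
    also have "\<dots> = (\<Sum>x\<in>#?I + (mset_set G - ?I). f x)" using e2 by simp
    finally show ?thesis by simp
  qed
  have d1: "\<bar>(\<Sum>x\<leftarrow>xs. f x) - (\<Sum>x\<in>G. f x)\<bar> \<le> T * (?n * ?ps) + T * (?n * ?ph)"
    using abs_sum_mset_le[of f T "mset xs - mset_set G", OF f] abs_sum_mset_le[of f T "mset_set G - ?I", OF f]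
    unfolding s1 s2 sz(1) sz(2) by linarith
  have "\<bar>\<Sum>x\<in>G. f x\<bar> \<le> T * ?g"
    using abs_sum_mset_le[of f T "mset_set G", OF f] by (simp add: sum_unfold_sum_mset)
  then have mG: "\<bar>(\<Sum>x\<in>G. f x) / ?g\<bar> \<le> T" using g0 by (simp add: field_simps)
  have "?n * ((\<Sum>x\<leftarrow>xs. f x) / ?n - (\<Sum>x\<in>G. f x) / ?g)
     = ((\<Sum>x\<leftarrow>xs. f x) - (\<Sum>x\<in>G. f x)) + (\<Sum>x\<in>G. f x) / ?g * (?g - ?n)"
    using n0 g0 by (simp add: field_simps)
  also have "?g - ?n = ?n * ?ph - ?n * ?ps" using sz(3,4) by linarith
  finally have eq: "?n * ((\<Sum>x\<leftarrow>xs. f x) / ?n - (\<Sum>x\<in>G. f x) / ?g)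
     = ((\<Sum>x\<leftarrow>xs. f x) - (\<Sum>x\<in>G. f x)) + (\<Sum>x\<in>G. f x) / ?g * (?n * ?ph - ?n * ?ps)" .
  have "?n * \<bar>(\<Sum>x\<leftarrow>xs. f x) / ?n - (\<Sum>x\<in>G. f x) / ?g\<bar>
     = \<bar>?n * ((\<Sum>x\<leftarrow>xs. f x) / ?n - (\<Sum>x\<in>G. f x) / ?g)\<bar>"
    unfolding abs_mult by simp
  also have "\<dots> \<le> \<bar>(\<Sum>x\<leftarrow>xs. f x) - (\<Sum>x\<in>G. f x)\<bar> + \<bar>(\<Sum>x\<in>G. f x) / ?g * (?n * ?ph - ?n * ?ps)\<bar>"
    unfolding eq by (rule abs_triangle_ineq)
  also have "\<dots> \<le> (T * (?n * ?ps) + T * (?n * ?ph)) + T * (?n * ?ph + ?n * ?ps)"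
  proof (rule add_mono[OF d1])
    have "0 \<le> ?n * ?ph" "0 \<le> ?n * ?ps"
      using phi_psi_nonneg[of "mset xs" G] by (intro mult_nonneg_nonneg; simp)+
    then have "\<bar>?n * ?ph - ?n * ?ps\<bar> \<le> ?n * ?ph + ?n * ?ps" by linarith
    then show "\<bar>(\<Sum>x\<in>G. f x) / ?g * (?n * ?ph - ?n * ?ps)\<bar> \<le> T * (?n * ?ph + ?n * ?ps)"
      unfolding abs_mult[of "(\<Sum>x\<in>G. f x) / ?g"] using mG T by (intro mult_mono) simp_all
  qed
  also have "\<dots> = ?n * (2 * T * (?ps + ?ph))" by (simp add: algebra_simps)
  finally have "\<bar>(\<Sum>x\<leftarrow>xs. f x) / ?n - (\<Sum>x\<in>G. f x) / ?g\<bar> \<le> 2 * T * (?ps + ?ph)"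
    using n0 by (rule mult_left_le_imp_le)
  then show ?thesis unfolding mean_pmf_of_set[OF G] .
qed

text \<open>The function x log(1/x) vanishes at 1 as well as at 0, so a small \<open>Delta\<close>
  controls \<open>phi\<close> only if \<open>phi\<close> stays below some b < 1, where log(1/phi) is
  at least log(1/b).\<close>

lemma phi_psi_le:
  assumes b: "phi S G \<le> b" "0 < b" "b < 1" and D: "Delta S G \<le> \<epsilon>"
  shows "psi S G \<le> \<epsilon>" "phi S G \<le> \<epsilon> / ln (1 / b)"
proof -
  note nn = phi_psi_nonneg[of S G]
  have lb: "0 < ln (1 / b)" using b by simp
  have "phi S G * ln (1 / b) \<le> phi S G * ln (1 / phi S G)"
  proof (cases "phi S G = 0")
    case False
    then have "1 / b \<le> 1 / phi S G" using nn b by (intro divide_left_mono) auto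
    then show ?thesis using nn b False by (intro mult_left_mono) (auto simp: ln_le_cancel_iff)
  qed simp
  then have "psi S G + phi S G * ln (1 / b) \<le> \<epsilon>" using D by (simp add: Delta_def)
  moreover have "0 \<le> phi S G * ln (1 / b)" using nn lb by simp
  ultimately have "psi S G \<le> \<epsilon>" "phi S G * ln (1 / b) \<le> \<epsilon>" using nn by linarith+
  then show "psi S G \<le> \<epsilon>" "phi S G \<le> \<epsilon> / ln (1 / b)"
    using pos_le_divide_eq[OF lb] by auto
qed

section \<open>Concentration of the draws\<close>

lemma indep_vars_coordinates:
  assumes "prob_space P"
  shows "prob_space.indep_vars (Pi\<^sub>M UNIV (\<lambda>_::nat. P)) (\<lambda>_. P) (\<lambda>i \<omega>. \<omega> i) UNIV"
proof -
  let ?T = "Pi\<^sub>M UNIV (\<lambda>_::nat. P)"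
  interpret T: prob_space ?T by (rule prob_space_PiM) (rule assms)
  have "distr ?T ?T (\<lambda>x. \<lambda>i\<in>UNIV. x i) = distr ?T ?T (\<lambda>x. x)"
    by (intro distr_cong) auto
  also have "\<dots> = ?T" by (rule distr_id)
  also have "\<dots> = (\<Pi>\<^sub>M i\<in>UNIV. distr ?T P (\<lambda>\<omega>. \<omega> i))"
    using assms by (intro PiM_cong refl distr_PiM_component[symmetric]) auto
  finally show ?thesis by (subst T.indep_vars_iff_distr_eq_PiM') auto
qed

text \<open>Exponential Markov plus independence. The moment bound is assumed at a single
  \<open>l\<close>, which suits both uses: quadratic forms, bounded only for small \<open>l\<close>,
  and clipped functions.\<close>

lemma chernoff_iid:
  assumes P: "prob_space P" and f [measurable]: "f \<in> borel_measurable P" and l: "0 < l"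
    and mgf: "(\<integral>\<^sup>+x. ennreal (exp (l * f x)) \<partial>P) \<le> ennreal (exp c)"
  shows "measure (Pi\<^sub>M UNIV (\<lambda>_::nat. P))
      {\<omega> \<in> space (Pi\<^sub>M UNIV (\<lambda>_. P)). real N * u \<le> (\<Sum>j<N. f (\<omega> j))} \<le> exp (real N * (c - l * u))"
proof -
  let ?T = "Pi\<^sub>M UNIV (\<lambda>_::nat. P)"
  interpret T: prob_space ?T by (rule prob_space_PiM) (rule P)
  have ind: "T.indep_vars (\<lambda>_. borel) (\<lambda>i \<omega>. ennreal (exp (l * f (\<omega> i)))) {..<N}"
    by (rule T.indep_vars_compose2[OF T.indep_vars_subset[OF indep_vars_coordinates[OF P]]]) auto
  have one: "(\<integral>\<^sup>+\<omega>. ennreal (exp (l * f (\<omega> i))) \<partial>?T) \<le> ennreal (exp c)" for i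
  proof -
    have "(\<integral>\<^sup>+\<omega>. ennreal (exp (l * f (\<omega> i))) \<partial>?T) = (\<integral>\<^sup>+x. ennreal (exp (l * f x)) \<partial>distr ?T P (\<lambda>\<omega>. \<omega> i))"
      by (subst nn_integral_distr) auto
    then show ?thesis using mgf P by (subst (asm) distr_PiM_component) auto
  qed
  have "emeasure ?T {\<omega> \<in> space ?T. real N * u \<le> (\<Sum>j<N. f (\<omega> j))}
    \<le> ennreal (exp (- l * (real N * u))) * (\<integral>\<^sup>+\<omega>. ennreal (exp (l * (\<Sum>j<N. f (\<omega> j)))) * indicator (space ?T) \<omega> \<partial>?T)"
    by (rule Chernoff_ineq_nn_integral_ge[OF l]) auto
  also have "(\<integral>\<^sup>+\<omega>. ennreal (exp (l * (\<Sum>j<N. f (\<omega> j)))) * indicator (space ?T) \<omega> \<partial>?T)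
    = (\<integral>\<^sup>+\<omega>. (\<Prod>j<N. ennreal (exp (l * f (\<omega> j)))) \<partial>?T)"
    by (intro nn_integral_cong) (simp add: sum_distrib_left exp_sum prod_ennreal)
  also have "\<dots> = (\<Prod>j<N. \<integral>\<^sup>+\<omega>. ennreal (exp (l * f (\<omega> j))) \<partial>?T)"
    by (rule T.indep_vars_nn_integral[OF _ ind]) auto
  also have "\<dots> \<le> (\<Prod>j<N. ennreal (exp c))"
    by (intro prod_mono_ennreal one)
  also have "\<dots> = ennreal (exp (real N * c))"
    by (simp add: ennreal_power exp_of_nat_mult)
  also have "ennreal (exp (- l * (real N * u))) * ennreal (exp (real N * c)) = ennreal (exp (real N * (c - l * u)))"
    by (simp add: ennreal_mult[symmetric] exp_add[symmetric] algebra_simps)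
  finally have "emeasure ?T {\<omega> \<in> space ?T. real N * u \<le> (\<Sum>j<N. f (\<omega> j))} \<le> ennreal (exp (real N * (c - l * u)))"
    by (simp add: mult_left_mono)
  then show ?thesis by (simp add: T.emeasure_eq_measure)
qed

lemma chernoff_iid_abs:
  assumes P: "prob_space P" and f [measurable]: "f \<in> borel_measurable P" and l: "0 < l"
    and mgf: "(\<integral>\<^sup>+x. ennreal (exp (l * f x)) \<partial>P) \<le> ennreal (exp c)"
      "(\<integral>\<^sup>+x. ennreal (exp (- l * f x)) \<partial>P) \<le> ennreal (exp c)"
  shows "measure (Pi\<^sub>M UNIV (\<lambda>_::nat. P))
      {\<omega> \<in> space (Pi\<^sub>M UNIV (\<lambda>_. P)). real N * u \<le> \<bar>\<Sum>j<N. f (\<omega> j)\<bar>} \<le> 2 * exp (real N * (c - l * u))"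
proof -
  let ?T = "Pi\<^sub>M UNIV (\<lambda>_::nat. P)"
  interpret T: prob_space ?T by (rule prob_space_PiM) (rule P)
  let ?A = "{\<omega> \<in> space ?T. real N * u \<le> (\<Sum>j<N. f (\<omega> j))}"
  let ?B = "{\<omega> \<in> space ?T. real N * u \<le> (\<Sum>j<N. - f (\<omega> j))}"
  have "{\<omega> \<in> space ?T. real N * u \<le> \<bar>\<Sum>j<N. f (\<omega> j)\<bar>} \<subseteq> ?A \<union> ?B"
    by (auto simp: sum_negf abs_if split: if_splits)
  then have "measure ?T {\<omega> \<in> space ?T. real N * u \<le> \<bar>\<Sum>j<N. f (\<omega> j)\<bar>} \<le> measure ?T (?A \<union> ?B)"
    by (intro T.finite_measure_mono) auto
  also have "\<dots> \<le> measure ?T ?A + measure ?T ?B"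
    by (intro measure_Un_le) auto
  also have "\<dots> \<le> exp (real N * (c - l * u)) + exp (real N * (c - l * u))"
    using mgf by (intro add_mono chernoff_iid[OF P _ l]) auto
  finally show ?thesis by simp
qed

text \<open>With l = \<epsilon>/6 the exponent 2 l^2 - l \<epsilon> is - \<epsilon>^2/9; the bound
  \<epsilon> \<le> 1 keeps l within the range of the exponential moment.\<close>

lemma tape_mean_quad_concentration:
  assumes sym: "\<And>i j. i < d \<Longrightarrow> j < d \<Longrightarrow> a i j = a j i"
    and nrm: "(\<Sum>i<d. \<Sum>j<d. (a i j)\<^sup>2) = 1 / 2"
    and u: "u = c + (\<Sum>i<d. a i i)" and e: "0 < \<epsilon>" "\<epsilon> \<le> 1"
  shows "measure (tape d) {\<omega> \<in> space (tape d). real N * \<epsilon> \<le> \<bar>\<Sum>j<N. quad d c a (\<omega> j) - u\<bar>}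
    \<le> 2 * exp (- (real N * \<epsilon>\<^sup>2 / 9))"
proof -
  have "measure (tape d) {\<omega> \<in> space (tape d). real N * \<epsilon> \<le> \<bar>\<Sum>j<N. quad d c a (\<omega> j) - u\<bar>}
     \<le> 2 * exp (real N * (2 * (\<epsilon> / 6)\<^sup>2 - \<epsilon> / 6 * \<epsilon>))"
    unfolding tape_def
  proof (rule chernoff_iid_abs[OF prob_space_gaussian[OF pos_def_one_mat]])
    show "(\<integral>\<^sup>+x. ennreal (exp (\<epsilon> / 6 * (quad d c a x - u))) \<partial>std_gaussian d) \<le> ennreal (exp (2 * (\<epsilon> / 6)\<^sup>2))"
      unfolding u using e by (intro std_gaussian_quad_mgf sym nrm) auto
    have "(\<integral>\<^sup>+x. ennreal (exp (- (\<epsilon> / 6) * (quad d c a x - u))) \<partial>std_gaussian d) \<le> ennreal (exp (2 * (- (\<epsilon> / 6))\<^sup>2))"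
      unfolding u using e by (intro std_gaussian_quad_mgf sym nrm) auto
    then show "(\<integral>\<^sup>+x. ennreal (exp (- (\<epsilon> / 6) * (quad d c a x - u))) \<partial>std_gaussian d) \<le> ennreal (exp (2 * (\<epsilon> / 6)\<^sup>2))"
      by simp
  qed (use e in auto)
  also have "2 * (\<epsilon> / 6)\<^sup>2 - \<epsilon> / 6 * \<epsilon> = - (\<epsilon>\<^sup>2 / 9)" by (simp add: power2_eq_square)
  finally show ?thesis by simp
qed

text \<open>Hoeffding with l = \<epsilon>/T. Measuring the deviation in units of T makes the
  exponent, and so the number of draws, independent of T and hence of C.\<close>

lemma tape_mean_clip_concentration:
  assumes T: "0 < T" and e: "0 < \<epsilon>"
  shows "measure (tape d) {\<omega> \<in> space (tape d). real N * (T * \<epsilon>)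
        \<le> \<bar>\<Sum>j<N. clip T (quad d c a (\<omega> j) - u) - mean (std_gaussian d) (\<lambda>x. clip T (quad d c a x - u))\<bar>}
    \<le> 2 * exp (- (real N * \<epsilon>\<^sup>2 / 2))"
proof -
  interpret I: prob_space "std_gaussian d" by (rule prob_space_gaussian[OF pos_def_one_mat])
  let ?f = "\<lambda>x. clip T (quad d c a x - u)"
  have [measurable]: "?f \<in> borel_measurable (std_gaussian d)" by measurable
  interpret X: interval_bounded_random_variable "std_gaussian d" ?f "- T" T
    by unfold_locales (use T clip_bounds in auto)
  interpret Y: interval_bounded_random_variable "std_gaussian d" "\<lambda>x. - ?f x" "- T" T
    by unfold_locales (use T clip_bounds[of T] in \<open>auto simp: minus_le_iff\<close>)
  have "measure (tape d) {\<omega> \<in> space (tape d). real N * (T * \<epsilon>) \<le> \<bar>\<Sum>j<N. ?f (\<omega> j) - mean (std_gaussian d) ?f\<bar>}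
    \<le> 2 * exp (real N * ((\<epsilon> / T)\<^sup>2 * (T - (- T))\<^sup>2 / 8 - \<epsilon> / T * (T * \<epsilon>)))"
    unfolding tape_def
  proof (rule chernoff_iid_abs[OF I.prob_space_axioms])
    show "(\<integral>\<^sup>+x. ennreal (exp (\<epsilon> / T * (?f x - mean (std_gaussian d) ?f))) \<partial>std_gaussian d)
      \<le> ennreal (exp ((\<epsilon> / T)\<^sup>2 * (T - (- T))\<^sup>2 / 8))"
      unfolding mean_def using T e by (intro X.Hoeffdings_lemma_nn_integral) auto
    have "(\<integral>\<^sup>+x. ennreal (exp (\<epsilon> / T * (- ?f x - I.expectation (\<lambda>x. - ?f x)))) \<partial>std_gaussian d)
      \<le> ennreal (exp ((\<epsilon> / T)\<^sup>2 * (T - (- T))\<^sup>2 / 8))"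
      using T e by (intro Y.Hoeffdings_lemma_nn_integral) auto
    moreover have "\<epsilon> / T * (- ?f x - I.expectation (\<lambda>x. - ?f x)) = - (\<epsilon> / T) * (?f x - mean (std_gaussian d) ?f)" for x
      by (simp add: mean_def algebra_simps)
    ultimately show "(\<integral>\<^sup>+x. ennreal (exp (- (\<epsilon> / T) * (?f x - mean (std_gaussian d) ?f))) \<partial>std_gaussian d)
      \<le> ennreal (exp ((\<epsilon> / T)\<^sup>2 * (T - (- T))\<^sup>2 / 8))" by (simp only:)
  qed (use T e in auto)
  also have "(\<epsilon> / T)\<^sup>2 * (T - (- T))\<^sup>2 / 8 - \<epsilon> / T * (T * \<epsilon>) = - (\<epsilon>\<^sup>2 / 2)"
    using T by (simp add: power2_eq_square)
  finally show ?thesis by simp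
qed

section \<open>The program\<close>

text \<open>A rule for loops with a known number of passes: the invariant counts them, each pass
  costs one extra step for its test, and the final failing test costs one more.\<close>

lemma exec_while:
  assumes step: "\<And>j m h. j < N \<Longrightarrow> Inv j m h \<Longrightarrow>
      m a < m b \<and> (\<exists>t'\<le>t. \<exists>m' h'. exec p pts c (m, h) t' (m', h') \<and> Inv (Suc j) m' h')"
    and stop: "\<And>m h. Inv N m h \<Longrightarrow> \<not> m a < m b"
    and init: "Inv 0 m h"
  shows "\<exists>t'\<le>1 + N * (1 + t). \<exists>m' h'. exec p pts (WhileLess a b c) (m, h) t' (m', h') \<and> Inv N m' h'"
proof -
  have "\<exists>t'\<le>1 + (N - j) * (1 + t). \<exists>m' h'. exec p pts (WhileLess a b c) (m, h) t' (m', h') \<and> Inv N m' h'"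
    if "j \<le> N" "Inv j m h" for j m h
    using that
  proof (induction "N - j" arbitrary: j m h)
    case 0
    then have "j = N" by simp
    then have I: "Inv N m h" using 0 by simp
    have "exec p pts (WhileLess a b c) (m, h) 1 (m, h)" by (rule exec.WhileFalse[OF stop[OF I]])
    then show ?case using I by (intro exI[of _ 1]) auto
  next
    case (Suc k)
    then have j: "j < N" by simp
    then obtain t1 m1 h1 where 1: "m a < m b" "t1 \<le> t" "exec p pts c (m, h) t1 (m1, h1)" "Inv (Suc j) m1 h1"
      using step Suc.prems by blast
    have k: "k = N - Suc j" using Suc.hyps(2) by simp
    have "Suc j \<le> N" using j by simp
    from Suc.hyps(1)[OF k this 1(4)] obtain t2 m2 h2 where 2: "t2 \<le> 1 + (N - Suc j) * (1 + t)"
      "exec p pts (WhileLess a b c) (m1, h1) t2 (m2, h2)" "Inv N m2 h2" by blast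
    have "exec p pts (WhileLess a b c) (m, h) (1 + t1 + t2) (m2, h2)"
      using 1 2 by (intro exec.WhileTrue)
    moreover have "N - j = Suc (N - Suc j)" using j by simp
    then have "1 + t1 + t2 \<le> 1 + (N - j) * (1 + t)" using 1(2) 2(1) by simp
    ultimately show ?case using 2(3) by blast
  qed
  from this[of 0 m h] init show ?thesis by simp
qed

lemma exec_eqI: "exec p pts c s t s1 \<Longrightarrow> s1 = s' \<Longrightarrow> exec p pts c s t s'"
  by simp

text \<open>Makes the effect of constant and arithmetic instructions a function, so that
  straight-line blocks are run by simplification. The default clause is harmless because execution
  is only claimed under \<open>is_arith\<close>.\<close>

fun arith_eff :: "com \<Rightarrow> mem \<Rightarrow> mem" where
  "arith_eff (Const r q) m = m(r := of_rat q)"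
| "arith_eff (Arith f r a b) m = m(r := apply_op f (m a) (m b))"
| "arith_eff _ m = m"

fun is_arith :: "com \<Rightarrow> bool" where
  "is_arith (Const r q) = True"
| "is_arith (Arith f r a b) = True"
| "is_arith _ = False"

fun seqs :: "com list \<Rightarrow> com \<Rightarrow> com" where
  "seqs [] c = c"
| "seqs (c' # cs) c = Seq c' (seqs cs c)"

lemma exec_arith: "is_arith c \<Longrightarrow> exec p pts c (m, h) 1 (arith_eff c m, h)"
  by (cases c) (auto simp: exec.Const[simplified] exec.Arith[simplified])

lemma exec_seqs:
  assumes "list_all is_arith cs" and "exec p pts c (foldl (\<lambda>m c. arith_eff c m) m cs, h) t s'"
  shows "exec p pts (seqs cs c) (m, h) (length cs + t) s'"
  using assms
proof (induction cs arbitrary: m)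
  case (Cons c' cs)
  have "exec p pts (Seq c' (seqs cs c)) (m, h) (1 + (length cs + t)) s'"
    using Cons by (intro exec.Seq[OF exec_arith]) auto
  then show ?case by simp
qed simp

lemma exec_arith_seqs:
  assumes "list_all is_arith cs" "is_arith c"
  shows "exec p pts (seqs cs c) (m, h) (length cs + 1) (arith_eff c (foldl (\<lambda>m c. arith_eff c m) m cs), h)"
  by (rule exec_seqs[OF assms(1) exec_arith[OF assms(2)]])

text \<open>Cells 16 and 17 hold T and - T. Cell 18 stays 0, so adding it copies a cell or does
  nothing; the idle branches make every path cost 4 steps.\<close>

definition clip_com :: com where
  "clip_com = Seq (IfLess 16 11 (Arith Plus 11 16 18) (Arith Plus 11 11 18))
     (IfLess 11 17 (Arith Plus 11 17 18) (Arith Plus 11 11 18))"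

lemma exec_clip_com:
  assumes "m 16 = T" "m 17 = - T" "m 18 = 0" "0 \<le> T"
  shows "exec p pts clip_com (m, h) 4 (m(11 := clip T (m 11)), h)"
proof -
  have 1: "exec p pts (IfLess 16 11 (Arith Plus 11 16 18) (Arith Plus 11 11 18)) (m, h) (1 + 1) (m(11 := min T (m 11)), h)"
  proof (cases "m 16 < m 11")
    case True
    have "exec p pts (Arith Plus 11 16 18) (m, h) 1 (m(11 := apply_op Plus (m 16) (m 18)), h)" by (rule exec.Arith)
    also have "m(11 := apply_op Plus (m 16) (m 18)) = m(11 := min T (m 11))" using True assms by simp
    finally show ?thesis using True by (intro exec.IfTrue)
  next
    case False
    have "exec p pts (Arith Plus 11 11 18) (m, h) 1 (m(11 := apply_op Plus (m 11) (m 18)), h)" by (rule exec.Arith)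
    also have "m(11 := apply_op Plus (m 11) (m 18)) = m(11 := min T (m 11))" using False assms by simp
    finally show ?thesis using False by (intro exec.IfFalse)
  qed
  let ?m = "m(11 := min T (m 11))"
  have 2: "exec p pts (IfLess 11 17 (Arith Plus 11 17 18) (Arith Plus 11 11 18)) (?m, h) (1 + 1) (m(11 := clip T (m 11)), h)"
  proof (cases "?m 11 < ?m 17")
    case True
    have "exec p pts (Arith Plus 11 17 18) (?m, h) 1 (?m(11 := apply_op Plus (?m 17) (?m 18)), h)" by (rule exec.Arith)
    also have "?m(11 := apply_op Plus (?m 17) (?m 18)) = m(11 := clip T (m 11))" using True assms by (simp add: clip_def)
    finally show ?thesis using True by (intro exec.IfTrue)
  next
    case False
    have "exec p pts (Arith Plus 11 11 18) (?m, h) 1 (?m(11 := apply_op Plus (?m 11) (?m 18)), h)" by (rule exec.Arith)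
    also have "?m(11 := apply_op Plus (?m 11) (?m 18)) = m(11 := clip T (m 11))" using False assms by (simp add: clip_def)
    finally show ?thesis using False by (intro exec.IfFalse)
  qed
  from exec.Seq[OF 1 2] show ?thesis unfolding clip_com_def by (simp add: eval_nat_numeral)
qed

section \<open>Loops, the complete program and its output\<close>

definition halve_loop :: com where
  "halve_loop = WhileLess 1 4 (seqs [Arith Times 4 4 6] (Arith Plus 5 5 3))"

definition draw_loop :: com where
  "draw_loop = WhileLess 8 7 (Seq (Draw 10) (Seq (Eval 11 10) (seqs [Arith Plus 9 9 11] (Arith Plus 8 8 3))))"

text \<open>Cell 13 is both counter and point handle. Draws have the handles following those of the
  input, so the second pass goes on where the first stopped, and it evaluates the draws again
  instead of storing their values.\<close>

definition clip_loop :: "nat \<Rightarrow> nat \<Rightarrow> com" where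
  "clip_loop b r = WhileLess 13 b (Seq (Eval 11 13) (Seq (Arith Minus 11 11 9)
     (Seq clip_com (seqs [Arith Plus r r 11] (Arith Plus 13 13 3)))))"

text \<open>Cell 4 is halved until it drops below \<open>\<tau>\<close>, with one more than the number of halvings in
  cell 5; this replaces the logarithm of \<open>1 / \<tau>\<close>. Cell 7 holds the resulting bound on the number of
  draws, cell 9 the mean of \<open>p\<close> over the draws, and cells 14 and 15 the clipped means over the
  input and over the draws.\<close>

definition estimator :: "rat \<Rightarrow> com" where
  "estimator T =
    seqs [Const 3 1, Const 4 1, Const 5 1, Const 6 (1 / 2), Const 16 T, Const 17 (- T), Const 7 27]
   (Seq halve_loop
   (seqs [Arith Times 7 7 5, Arith Divide 7 7 0, Arith Divide 7 7 0]
   (Seq draw_loop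
   (seqs [Arith Divide 9 9 8, Arith Plus 12 2 8]
   (Seq (clip_loop 2 14)
   (seqs [Arith Divide 14 14 2]
   (Seq (clip_loop 12 15)
   (seqs [Arith Divide 15 15 8, Arith Minus 0 14 15] (Arith Plus 0 0 9)))))))))"

definition halvings :: "real \<Rightarrow> nat" where
  "halvings \<tau> = (LEAST j. (1 / 2) ^ j \<le> \<tau>)"

text \<open>With J halvings, the factor 27 = 9 * 3 makes N \<epsilon>^2 / 9 at least 3 (J + 1). The
  two divisions and the ceiling mirror the program, which counts draws up to a real bound.\<close>

definition num_draws :: "real \<Rightarrow> real \<Rightarrow> nat" where
  "num_draws \<epsilon> \<tau> = nat \<lceil>27 * (real (halvings \<tau>) + 1) / \<epsilon> / \<epsilon>\<rceil>"

lemma halvings: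
  assumes "0 < \<tau>"
  shows "(1 / 2) ^ halvings \<tau> \<le> \<tau>" "j < halvings \<tau> \<Longrightarrow> \<tau> < (1 / 2) ^ j"
proof -
  have "\<exists>j. (1 / 2) ^ j < \<tau>" using assms by (intro real_arch_pow_inv) auto
  then have "\<exists>j. (1 / 2) ^ j \<le> \<tau>" by (blast intro: less_imp_le)
  then show "(1 / 2) ^ halvings \<tau> \<le> \<tau>" unfolding halvings_def by (rule LeastI_ex)
  show "\<tau> < (1 / 2) ^ j" if "j < halvings \<tau>"
    using not_less_Least[of j "\<lambda>j. (1 / 2) ^ j \<le> \<tau>"] that unfolding halvings_def by simp
qed

definition draw_mean :: "(point \<Rightarrow> real) \<Rightarrow> nat \<Rightarrow> (nat \<Rightarrow> point) \<Rightarrow> real" where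
  "draw_mean p N \<omega> = (\<Sum>j<N. p (\<omega> j)) / N"

text \<open>A control variate: the average over the draws removes the truncation bias. Clipping is
  done around the random \<open>draw_mean\<close>, so the summands over the draws are not
  independent until a fixed centre replaces it.\<close>

definition estimate :: "real \<Rightarrow> (point \<Rightarrow> real) \<Rightarrow> point list \<Rightarrow> nat \<Rightarrow> (nat \<Rightarrow> point) \<Rightarrow> real" where
  "estimate T p xs N \<omega> = (\<Sum>x\<leftarrow>xs. clip T (p x - draw_mean p N \<omega>)) / length xs
     - (\<Sum>j<N. clip T (p (\<omega> j) - draw_mean p N \<omega>)) / N + draw_mean p N \<omega>"

definition consts_ok :: "real \<Rightarrow> real \<Rightarrow> real \<Rightarrow> nat \<Rightarrow> mem \<Rightarrow> bool" where
  "consts_ok T \<epsilon> \<tau> n m \<longleftrightarrow> m 0 = \<epsilon> \<and> m 1 = \<tau> \<and> m 2 = real n \<and> m 3 = 1 \<and> m 16 = T \<and> m 17 = - T \<and> m 18 = 0"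

section \<open>Correctness and cost of the loops\<close>

lemma exec_halve_loop:
  assumes \<tau>: "0 < \<tau>"
    and m: "consts_ok T \<epsilon> \<tau> n m" "m 4 = 1" "m 5 = 1" "m 6 = 1 / 2" "m 7 = 27" "\<forall>k\<in>{8, 9, 13, 14, 15}. m k = 0"
  shows "\<exists>t\<le>1 + halvings \<tau> * (1 + 2). \<exists>m' h'. exec p pts halve_loop (m, h) t (m', h') \<and>
    (consts_ok T \<epsilon> \<tau> n m' \<and> m' 5 = real (halvings \<tau>) + 1 \<and> m' 7 = 27 \<and> (\<forall>k\<in>{8, 9, 13, 14, 15}. m' k = 0) \<and> h' = h)"
proof -
  define Inv where "Inv j m' h' \<longleftrightarrow> consts_ok T \<epsilon> \<tau> n m' \<and> m' 4 = (1 / 2) ^ j \<and> m' 5 = real j + 1 \<and> m' 6 = 1 / 2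
    \<and> m' 7 = 27 \<and> (\<forall>k\<in>{8, 9, 13, 14, 15}. m' k = 0) \<and> h' = h" for j :: nat and m' :: mem and h' :: nat
  have "\<exists>t\<le>1 + halvings \<tau> * (1 + 2). \<exists>m' h'. exec p pts halve_loop (m, h) t (m', h') \<and> Inv (halvings \<tau>) m' h'"
    unfolding halve_loop_def
  proof (rule exec_while)
    fix j m1 h1 assume j: "j < halvings \<tau>" and I: "Inv j m1 h1"
    let ?m = "m1(4 := m1 4 * m1 6, 5 := m1 5 + m1 3)"
    have "exec p pts (seqs [Arith Times 4 4 6] (Arith Plus 5 5 3)) (m1, h1) (length [Arith Times 4 4 6] + 1) (?m, h1)"
      by (rule exec_eqI[OF exec_arith_seqs]) auto
    moreover have "length [Arith Times 4 4 6] + 1 = 2" by simp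
    ultimately have "exec p pts (seqs [Arith Times 4 4 6] (Arith Plus 5 5 3)) (m1, h1) 2 (?m, h1)" by metis
    moreover have "Inv (Suc j) ?m h1" using I by (auto simp: Inv_def consts_ok_def)
    moreover have "m1 1 < m1 4" using I halvings(2)[OF \<tau> j] by (simp add: Inv_def consts_ok_def)
    ultimately show "m1 1 < m1 4 \<and> (\<exists>t'\<le>2. \<exists>m' h'. exec p pts (seqs [Arith Times 4 4 6] (Arith Plus 5 5 3)) (m1, h1) t' (m', h') \<and> Inv (Suc j) m' h')"
      by blast
  next
    fix m1 h1 assume I: "Inv (halvings \<tau>) m1 h1"
    then show "\<not> m1 1 < m1 4" using halvings(1)[OF \<tau>] by (simp add: Inv_def consts_ok_def)
  next
    show "Inv 0 m h" using m by (simp add: Inv_def)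
  qed
  then show ?thesis unfolding Inv_def by blast
qed

lemma exec_draw_loop:
  assumes N: "N = nat \<lceil>B\<rceil>" and pts: "\<And>j. pts (h + j) = \<omega> j"
    and m: "consts_ok T \<epsilon> \<tau> n m" "m 7 = B" "\<forall>k\<in>{8, 9, 13, 14, 15}. m k = 0"
  shows "\<exists>t\<le>1 + N * (1 + 4). \<exists>m' h'. exec p pts draw_loop (m, h) t (m', h') \<and>
    (consts_ok T \<epsilon> \<tau> n m' \<and> m' 8 = real N \<and> m' 9 = (\<Sum>j<N. p (\<omega> j)) \<and> (\<forall>k\<in>{13, 14, 15}. m' k = 0) \<and> h' = h + N)"
proof -
  define Inv where "Inv j m' h' \<longleftrightarrow> consts_ok T \<epsilon> \<tau> n m' \<and> m' 7 = B \<and> m' 8 = real j \<and> m' 9 = (\<Sum>i<j. p (\<omega> i))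
    \<and> (\<forall>k\<in>{13, 14, 15}. m' k = 0) \<and> h' = h + j" for j :: nat and m' :: mem and h' :: nat
  have "\<exists>t\<le>1 + N * (1 + 4). \<exists>m' h'. exec p pts draw_loop (m, h) t (m', h') \<and> Inv N m' h'"
    unfolding draw_loop_def
  proof (rule exec_while)
    fix j m1 h1 assume j: "j < N" and I: "Inv j m1 h1"
    let ?c = "Seq (Draw 10) (Seq (Eval 11 10) (seqs [Arith Plus 9 9 11] (Arith Plus 8 8 3)))"
    let ?m = "m1(10 := real h1, 11 := p (pts h1), 9 := m1 9 + p (pts h1), 8 := m1 8 + m1 3)"
    have "exec p pts ?c (m1, h1) (1 + (1 + (length [Arith Plus 9 9 11] + 1))) (?m, Suc h1)"
      by (rule exec.Seq[OF exec.Draw exec.Seq[OF exec.Eval[where k = h1] exec_eqI[OF exec_arith_seqs]]])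
         (auto simp: fun_upd_def)
    moreover have "1 + (1 + (length [Arith Plus 9 9 11] + 1)) = 4" by simp
    ultimately have "exec p pts ?c (m1, h1) 4 (?m, Suc h1)" by metis
    moreover have "Inv (Suc j) ?m (Suc h1)" using I pts[of j] by (auto simp: Inv_def consts_ok_def)
    moreover have "m1 8 < m1 7"
    proof -
      \<comment> \<open>An integer counter is below the real bound \<open>B\<close> exactly when it
        is below the ceiling, so \<open>N\<close> passes are made.\<close>
      have "int j < \<lceil>B\<rceil>" using j N by linarith
      then have "real j < B" by (simp add: less_ceiling_iff)
      then show ?thesis using I by (simp add: Inv_def)
    qed
    ultimately show "m1 8 < m1 7 \<and> (\<exists>t'\<le>4. \<exists>m' h'. exec p pts ?c (m1, h1) t' (m', h') \<and> Inv (Suc j) m' h')"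
      by blast
  next
    fix m1 h1 assume I: "Inv N m1 h1"
    then show "\<not> m1 8 < m1 7" using N real_nat_ceiling_ge[of B] by (simp add: Inv_def)
  next
    show "Inv 0 m h" using m by (simp add: Inv_def)
  qed
  then show ?thesis unfolding Inv_def by blast
qed

text \<open>The clause on unchanged cells carries the first average, the centre and the number of
  draws through the second pass. The condition \<open>k + N \<le> h\<close> makes every handle that
  is read available.\<close>

lemma exec_clip_loop:
  assumes T: "0 \<le> T" and b: "b \<in> {2, 12}" and r: "r \<in> {14, 15}" and h: "k + N \<le> h"
    and m: "consts_ok T \<epsilon> \<tau> n m" "m 13 = real k" "m b = real (k + N)" "m r = 0"
  shows "\<exists>t\<le>1 + N * (1 + 8). \<exists>m' h'. exec p pts (clip_loop b r) (m, h) t (m', h') \<and>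
    (consts_ok T \<epsilon> \<tau> n m' \<and> m' 13 = real (k + N) \<and> m' r = (\<Sum>j<N. clip T (p (pts (k + j)) - m 9))
      \<and> (\<forall>i. i \<notin> {11, 13, r} \<longrightarrow> m' i = m i) \<and> h' = h)"
proof -
  define Inv where "Inv j m' h' \<longleftrightarrow> consts_ok T \<epsilon> \<tau> n m' \<and> m' 13 = real (k + j) \<and> m' r = (\<Sum>i<j. clip T (p (pts (k + i)) - m 9))
      \<and> (\<forall>i. i \<notin> {11, 13, r} \<longrightarrow> m' i = m i) \<and> h' = h" for j :: nat and m' :: mem and h' :: nat
  have "\<exists>t\<le>1 + N * (1 + 8). \<exists>m' h'. exec p pts (clip_loop b r) (m, h) t (m', h') \<and> Inv N m' h'"
    unfolding clip_loop_def
  proof (rule exec_while)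
    fix j m1 h1 assume j: "j < N" and I: "Inv j m1 h1"
    let ?c = "Seq (Eval 11 13) (Seq (Arith Minus 11 11 9) (Seq clip_com (seqs [Arith Plus r r 11] (Arith Plus 13 13 3))))"
    let ?v = "p (pts (k + j))"
    let ?w = "clip T (?v - m 9)"
    let ?m1 = "m1(11 := ?v)" and ?m2 = "m1(11 := ?v - m 9)" and ?m3 = "m1(11 := ?w)"
    let ?m4 = "m1(11 := ?w, r := m1 r + ?w, 13 := real (k + Suc j))"
    have c: "m1 16 = T" "m1 17 = - T" "m1 18 = 0" "m1 3 = 1" "m1 13 = real (k + j)" "h1 = h"
      using I by (auto simp: Inv_def consts_ok_def)
    have "m1 9 = m 9" and mb: "m1 b = real (k + N)" using I m r b by (auto simp: Inv_def)
    have 1: "exec p pts (Eval 11 13) (m1, h) 1 (?m1, h)"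
      by (rule exec.Eval) (use c h j in auto)
    have 2: "exec p pts (Arith Minus 11 11 9) (?m1, h) 1 (?m2, h)"
      by (rule exec_eqI[OF exec.Arith]) (use \<open>m1 9 = m 9\<close> in auto)
    have 3: "exec p pts clip_com (?m2, h) 4 (?m3, h)"
      by (rule exec_eqI[OF exec_clip_com[where T = T]]) (use c T in auto)
    have 4: "exec p pts (seqs [Arith Plus r r 11] (Arith Plus 13 13 3)) (?m3, h) (length [Arith Plus r r 11] + 1) (?m4, h)"
      by (rule exec_eqI[OF exec_arith_seqs]) (use c r in \<open>auto simp: fun_eq_iff\<close>)
    have "exec p pts ?c (m1, h1) (1 + (1 + (4 + (length [Arith Plus r r 11] + 1)))) (?m4, h)"
      unfolding \<open>h1 = h\<close> by (intro exec.Seq[OF 1] exec.Seq[OF 2] exec.Seq[OF 3] 4)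
    moreover have "1 + (1 + (4 + (length [Arith Plus r r 11] + 1))) = 8" by simp
    ultimately have "exec p pts ?c (m1, h1) 8 (?m4, h)" by metis
    moreover have "Inv (Suc j) ?m4 h" using I r by (auto simp: Inv_def consts_ok_def)
    moreover have "m1 13 < m1 b" using c mb j by simp
    ultimately show "m1 13 < m1 b \<and> (\<exists>t'\<le>8. \<exists>m' h'. exec p pts ?c (m1, h1) t' (m', h') \<and> Inv (Suc j) m' h')"
      by blast
  next
    fix m1 h1 assume I: "Inv N m1 h1"
    then have "m1 13 = real (k + N)" "m1 b = real (k + N)" using m r b by (auto simp: Inv_def)
    then show "\<not> m1 13 < m1 b" by simp
  next
    show "Inv 0 m h" using m by (simp add: Inv_def)
  qed
  then show ?thesis unfolding Inv_def by blast
qed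

text \<open>Stated for each tape separately; randomness matters only for the value of
  \<open>estimate\<close>. A halving costs 3 steps, an input point 9, a draw 5 when sampled and 9
  when clipped; 20 is 16 straight-line instructions plus 4 final loop tests.\<close>

proposition run_estimator:
  fixes T :: rat and \<epsilon> \<tau> :: real
  assumes T: "0 \<le> T" and \<tau>: "0 < \<tau>"
  defines "N \<equiv> num_draws \<epsilon> \<tau>"
  shows "\<exists>t\<le>20 + 3 * halvings \<tau> + 14 * N + 9 * length xs.
    run (estimator T) p xs \<epsilon> \<tau> \<omega> t (estimate (of_rat T) p xs N \<omega>)"
proof -
  let ?n = "length xs" and ?T = "of_rat T :: real"
  define pts where "pts = (\<lambda>k. if k < ?n then xs ! k else \<omega> (k - ?n))"
  define B where "B = 27 * (real (halvings \<tau>) + 1) / \<epsilon> / \<epsilon>"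
  have N: "N = nat \<lceil>B\<rceil>" by (simp add: N_def num_draws_def B_def)
  have T0: "0 \<le> ?T" using T by simp
  have pts: "pts (?n + j) = \<omega> j" for j by (simp add: pts_def)
  define m0 :: mem where "m0 = (\<lambda>_. 0)(0 := \<epsilon>, 1 := \<tau>, 2 := real ?n)"
  define c1 where "c1 = [Const 3 1, Const 4 1, Const 5 1, Const 6 (1 / 2), Const 16 T, Const 17 (- T), Const 7 27]"
  define c2 where "c2 = [Arith Times 7 7 5, Arith Divide 7 7 0, Arith Divide 7 7 0]"
  define c3 where "c3 = [Arith Divide 9 9 8, Arith Plus 12 2 8]"
  define c4 where "c4 = [Arith Divide 14 14 2]"
  define c5 where "c5 = [Arith Divide 15 15 8, Arith Minus 0 14 15]"
  let ?eff = "foldl (\<lambda>m c. arith_eff c m)"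
  have ok: "list_all is_arith c1" "list_all is_arith c2" "list_all is_arith c3" "list_all is_arith c4" "list_all is_arith c5"
    by (auto simp: c1_def c2_def c3_def c4_def c5_def)
  define m1 where "m1 = ?eff m0 c1"
  have m1: "consts_ok ?T \<epsilon> \<tau> ?n m1" "m1 4 = 1" "m1 5 = 1" "m1 6 = 1 / 2" "m1 7 = 27" "\<forall>k\<in>{8, 9, 13, 14, 15}. m1 k = 0"
    by (auto simp: m1_def c1_def m0_def consts_ok_def of_rat_divide of_rat_minus)
  obtain t1 m2 where L1: "t1 \<le> 1 + halvings \<tau> * (1 + 2)" "exec p pts halve_loop (m1, ?n) t1 (m2, ?n)"
    and m2: "consts_ok ?T \<epsilon> \<tau> ?n m2" "m2 5 = real (halvings \<tau>) + 1" "m2 7 = 27" "\<forall>k\<in>{8, 9, 13, 14, 15}. m2 k = 0"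
    using exec_halve_loop[OF \<tau> m1, of p pts ?n] by blast
  define m3 where "m3 = ?eff m2 c2"
  have m3: "consts_ok ?T \<epsilon> \<tau> ?n m3" "m3 7 = B" "\<forall>k\<in>{8, 9, 13, 14, 15}. m3 k = 0"
    using m2 by (auto simp: m3_def c2_def consts_ok_def B_def)
  obtain t2 m4 where L2: "t2 \<le> 1 + N * (1 + 4)" "exec p pts draw_loop (m3, ?n) t2 (m4, ?n + N)"
    and m4: "consts_ok ?T \<epsilon> \<tau> ?n m4" "m4 8 = real N" "m4 9 = (\<Sum>j<N. p (\<omega> j))" "\<forall>k\<in>{13, 14, 15}. m4 k = 0"
    using exec_draw_loop[where pts = pts and h = ?n and \<omega> = \<omega> and m = m3 and B = B, OF N pts m3, of p] by blast
  define m5 where "m5 = ?eff m4 c3"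
  have m5: "consts_ok ?T \<epsilon> \<tau> ?n m5" "m5 8 = real N" "m5 9 = draw_mean p N \<omega>" "m5 12 = real (?n + N)" "\<forall>k\<in>{13, 14, 15}. m5 k = 0"
    using m4 by (auto simp: m5_def c3_def consts_ok_def draw_mean_def)
  obtain t3 m6 where L3: "t3 \<le> 1 + ?n * (1 + 8)" "exec p pts (clip_loop 2 14) (m5, ?n + N) t3 (m6, ?n + N)"
    and m6: "consts_ok ?T \<epsilon> \<tau> ?n m6" "m6 13 = real (0 + ?n)" "m6 14 = (\<Sum>j<?n. clip ?T (p (pts (0 + j)) - m5 9))"
      "\<forall>i. i \<notin> {11, 13, 14} \<longrightarrow> m6 i = m5 i"
    using exec_clip_loop[OF T0, of 2 14 0 ?n "?n + N" \<epsilon> \<tau> ?n m5 p pts] m5 by (auto simp: consts_ok_def)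
  define m7 where "m7 = ?eff m6 c4"
  have m7: "consts_ok ?T \<epsilon> \<tau> ?n m7" "m7 8 = real N" "m7 9 = draw_mean p N \<omega>" "m7 12 = real (?n + N)" "m7 13 = real ?n"
    "m7 14 = (\<Sum>x\<leftarrow>xs. clip ?T (p x - draw_mean p N \<omega>)) / ?n" "m7 15 = 0"
  proof -
    have "(\<Sum>j<?n. clip ?T (p (pts (0 + j)) - m5 9)) = (\<Sum>j<?n. clip ?T (p (xs ! j) - draw_mean p N \<omega>))"
      using m5 by (intro sum.cong) (auto simp: pts_def)
    also have "\<dots> = (\<Sum>x\<leftarrow>xs. clip ?T (p x - draw_mean p N \<omega>))"
      by (simp add: sum_list_sum_nth lessThan_atLeast0)
    finally have "m6 14 = \<dots>" using m6(3) by simp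
    then show "m7 14 = (\<Sum>x\<leftarrow>xs. clip ?T (p x - draw_mean p N \<omega>)) / ?n"
      using m6(1) by (simp add: m7_def c4_def consts_ok_def)
  qed (use m6 m5 in \<open>auto simp: m7_def c4_def consts_ok_def\<close>)
  obtain t4 m8 where L4: "t4 \<le> 1 + N * (1 + 8)" "exec p pts (clip_loop 12 15) (m7, ?n + N) t4 (m8, ?n + N)"
    and m8: "m8 15 = (\<Sum>j<N. clip ?T (p (pts (?n + j)) - m7 9))" "\<forall>i. i \<notin> {11, 13, 15} \<longrightarrow> m8 i = m7 i"
    using exec_clip_loop[OF T0, of 12 15 ?n N "?n + N" \<epsilon> \<tau> ?n m7 p pts] m7 by (auto simp: consts_ok_def)
  define m9 where "m9 = arith_eff (Arith Plus 0 0 9) (?eff m8 c5)"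
  have L5: "exec p pts (seqs c5 (Arith Plus 0 0 9)) (m8, ?n + N) (length c5 + 1) (m9, ?n + N)"
    unfolding m9_def by (rule exec_arith_seqs) (use ok in auto)
  have m9: "m9 0 = estimate ?T p xs N \<omega>"
    using m8 m7 by (simp add: m9_def c5_def estimate_def pts)
  define t where "t = length c1 + (t1 + (length c2 + (t2 + (length c3 + (t3 + (length c4 + (t4 + (length c5 + 1))))))))"
  have "exec p pts (estimator T) (m0, ?n) t (m9, ?n + N)"
    unfolding estimator_def t_def c1_def[symmetric] c2_def[symmetric] c3_def[symmetric] c4_def[symmetric] c5_def[symmetric]
    by (rule exec_seqs[OF ok(1)], fold m1_def, rule exec.Seq[OF L1(2)],
        rule exec_seqs[OF ok(2)], fold m3_def, rule exec.Seq[OF L2(2)],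
        rule exec_seqs[OF ok(3)], fold m5_def, rule exec.Seq[OF L3(2)],
        rule exec_seqs[OF ok(4)], fold m7_def, rule exec.Seq[OF L4(2)], rule L5)
  then have "run (estimator T) p xs \<epsilon> \<tau> \<omega> t (estimate ?T p xs N \<omega>)"
    unfolding run_def m9[symmetric] pts_def m0_def by blast
  moreover have "t \<le> 20 + 3 * halvings \<tau> + 14 * N + 9 * ?n"
    using L1(1) L2(1) L3(1) L4(1) by (simp add: t_def c1_def c2_def c3_def c4_def c5_def)
  ultimately show ?thesis by blast
qed

section \<open>Error and running time\<close>

text \<open>Symmetrising the coefficients leaves the polynomial unchanged, and unit variance means
  squared norm 1/2 by \<open>std_gaussian_quad_square\<close>. In dimension 0 the norm would be 0,
  hence d > 0.\<close>

lemma P2_quad: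
  assumes "p \<in> P2 d"
  obtains c a where "p = quad d c a" "\<And>i j. a i j = a j i" "(\<Sum>i<d. \<Sum>j<d. (a i j)\<^sup>2) = 1 / 2" "0 < d"
proof -
  obtain c a0 where p: "p = (\<lambda>x. c + (\<Sum>i<d. \<Sum>j<d. a0 i j * x i * x j))"
    and v: "var (std_gaussian d) p = 1"
    using assms by (auto simp: P2_def even_deg2_def)
  define a where "a i j = (a0 i j + a0 j i) / 2" for i j
  have sym: "a i j = a j i" for i j by (simp add: a_def add.commute)
  have pq: "p = quad d c a"
  proof (rule ext)
    fix x :: point
    have sw: "(\<Sum>i<d. \<Sum>j<d. a0 j i * x i * x j) = (\<Sum>i<d. \<Sum>j<d. a0 i j * x i * x j)"
      by (subst sum.swap) (simp add: mult_ac)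
    have "(\<Sum>i<d. \<Sum>j<d. a i j * x i * x j) = (\<Sum>i<d. \<Sum>j<d. (a0 i j * x i * x j) / 2 + (a0 j i * x i * x j) / 2)"
      by (intro sum.cong) (auto simp: a_def field_simps)
    also have "\<dots> = (\<Sum>i<d. \<Sum>j<d. a0 i j * x i * x j) / 2 + (\<Sum>i<d. \<Sum>j<d. a0 j i * x i * x j) / 2"
      unfolding sum.distrib sum_divide_distrib ..
    finally show "p x = quad d c a x" unfolding sw by (simp add: p quad_def)
  qed
  have mu: "mean (std_gaussian d) p = c + (\<Sum>i<d. a i i)"
    unfolding pq mean_def by (rule has_bochner_integral_integral_eq[OF std_gaussian_mean_quad])
  let ?u = "c + (\<Sum>i<d. a i i)"
  have "(\<integral>\<^sup>+x. ennreal ((quad d (c - ?u) a x)\<^sup>2) \<partial>std_gaussian d) = ennreal ((c - ?u + (\<Sum>i<d. a i i))\<^sup>2 + 2 * (\<Sum>i<d. \<Sum>j<d. (a i j)\<^sup>2))"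
    by (rule std_gaussian_quad_square) (rule sym)
  then have "has_bochner_integral (std_gaussian d) (\<lambda>x. (quad d (c - ?u) a x)\<^sup>2) ((c - ?u + (\<Sum>i<d. a i i))\<^sup>2 + 2 * (\<Sum>i<d. \<Sum>j<d. (a i j)\<^sup>2))"
    by (intro has_bochner_integral_nn_integral) (auto intro!: add_nonneg_nonneg sum_nonneg)
  then have "(\<integral>x. (quad d (c - ?u) a x)\<^sup>2 \<partial>std_gaussian d) = 2 * (\<Sum>i<d. \<Sum>j<d. (a i j)\<^sup>2)"
    by (simp add: has_bochner_integral_integral_eq)
  moreover have "quad d (c - ?u) a x = quad d c a x - ?u" for x by (simp add: quad_def)
  ultimately have "2 * (\<Sum>i<d. \<Sum>j<d. (a i j)\<^sup>2) = 1"
    using v unfolding var_def mu unfolding mean_def pq by simp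
  then have nrm: "(\<Sum>i<d. \<Sum>j<d. (a i j)\<^sup>2) = 1 / 2" by simp
  then have "0 < d" by (cases d) auto
  with that[OF pq sym nrm] show thesis .
qed

text \<open>The difference is the Frobenius inner product of the coefficients with S - I. It places
  the target near the centre when \<epsilon> is bounded below.\<close>

lemma mean_quad_shift:
  assumes pd: "pos_def_mat d S" and nrm: "(\<Sum>i<d. \<Sum>j<d. (a i j)\<^sup>2) = 1 / 2"
  shows "\<bar>mean (gaussian d S) (quad d c a) - (c + (\<Sum>i<d. a i i))\<bar> \<le> frobenius_norm (S - 1\<^sub>m d)"
proof -
  let ?E = "\<lambda>i j. S $$ (i, j) - 1\<^sub>m d $$ (i, j)"
  have S: "S \<in> carrier_mat d d" using pd by (simp add: pos_def_mat_def)
  have 1: "mean (gaussian d S) (quad d c a) = c + (\<Sum>i<d. \<Sum>j<d. a i j * S $$ (i, j))"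
    unfolding mean_def by (rule has_bochner_integral_integral_eq[OF gaussian_mean_quad[OF pd]])
  have "(\<Sum>i<d. \<Sum>j<d. a i j * 1\<^sub>m d $$ (i, j)) = (\<Sum>i<d. \<Sum>j<d. if j = i then a i j else 0)"
    by (intro sum.cong) auto
  then have 2: "(\<Sum>i<d. a i i) = (\<Sum>i<d. \<Sum>j<d. a i j * 1\<^sub>m d $$ (i, j))" by simp
  have 3: "mean (gaussian d S) (quad d c a) - (c + (\<Sum>i<d. a i i)) = (\<Sum>i<d. \<Sum>j<d. a i j * ?E i j)"
    unfolding 1 2 right_diff_distrib sum_subtractf by simp
  have "(\<Sum>i<d. \<Sum>j<d. a i j * ?E i j)\<^sup>2 \<le> (1 / 2) * (frobenius_norm (S - 1\<^sub>m d))\<^sup>2"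
    using sum2_Cauchy_Schwarz[of a ?E d] unfolding nrm frobenius_norm_square[OF S] .
  also have "\<dots> \<le> (frobenius_norm (S - 1\<^sub>m d))\<^sup>2" by simp
  finally show ?thesis unfolding 3 using frobenius_norm_nonneg by (simp add: abs_le_square_iff[symmetric])
qed

section \<open>Error bounds for a fixed tape\<close>

lemma avg_clip_shift:
  fixes N :: nat
  shows "\<bar>(\<Sum>j<N. clip T (f j - u)) / N - (\<Sum>j<N. clip T (f j - v)) / N\<bar> \<le> \<bar>u - v\<bar>"
proof (cases "N = 0")
  case False
  have "\<bar>(\<Sum>j<N. clip T (f j - u)) - (\<Sum>j<N. clip T (f j - v))\<bar> \<le> (\<Sum>j<N. \<bar>clip T (f j - u) - clip T (f j - v)\<bar>)"
    unfolding sum_subtractf[symmetric] by (rule sum_abs)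
  also have "\<dots> \<le> (\<Sum>j<N. \<bar>u - v\<bar>)"
  proof (rule sum_mono)
    fix j show "\<bar>clip T (f j - u) - clip T (f j - v)\<bar> \<le> \<bar>u - v\<bar>"
      using clip_lipschitz[of T "f j - u" "f j - v"] by (simp add: abs_minus_commute)
  qed
  finally have "\<bar>(\<Sum>j<N. clip T (f j - u)) - (\<Sum>j<N. clip T (f j - v))\<bar> / N \<le> \<bar>u - v\<bar>"
    using False by (simp add: pos_divide_le_eq mult.commute)
  then show ?thesis by (simp add: diff_divide_distrib[symmetric])
qed simp

lemma avg_clip_le:
  fixes N :: nat
  assumes "0 \<le> T"
  shows "\<bar>(\<Sum>j<N. clip T (f j)) / N\<bar> \<le> T"
proof (cases "N = 0")
  case False
  have "\<bar>\<Sum>j<N. clip T (f j)\<bar> \<le> (\<Sum>j<N. \<bar>clip T (f j)\<bar>)" by (rule sum_abs)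
  also have "\<dots> \<le> (\<Sum>j<N. T)" by (intro sum_mono clip_bounds assms)
  finally show ?thesis using False by (simp add: pos_divide_le_eq mult.commute)
qed (use assms in simp)

lemma sum_list_nth: "(\<Sum>x\<leftarrow>xs. f x) = (\<Sum>j<length xs. f (xs ! j))" for f :: "_ \<Rightarrow> real"
  by (simp add: sum_list_sum_nth lessThan_atLeast0)

lemma estimate_trivial:
  assumes "0 \<le> T"
  shows "\<bar>estimate T p xs N \<omega> - draw_mean p N \<omega>\<bar> \<le> 2 * T"
  using avg_clip_le[OF assms, of "\<lambda>j. p (xs ! j) - draw_mean p N \<omega>" "length xs"]
    avg_clip_le[OF assms, of "\<lambda>j. p (\<omega> j) - draw_mean p N \<omega>" N]
  unfolding estimate_def sum_list_nth by linarith

text \<open>The centre occurs in two clipped averages, each 1-Lipschitz in it, and once by itself.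
  Afterwards only a function fixed in advance is averaged over the draws, as concentration
  requires.\<close>

lemma estimate_recentre:
  "\<bar>estimate T p xs N \<omega> - ((\<Sum>x\<leftarrow>xs. clip T (p x - u)) / length xs - (\<Sum>j<N. clip T (p (\<omega> j) - u)) / N + u)\<bar>
    \<le> 3 * \<bar>draw_mean p N \<omega> - u\<bar>"
proof -
  have tri: "\<bar>A - A'\<bar> \<le> \<bar>v - u\<bar> \<Longrightarrow> \<bar>B - B'\<bar> \<le> \<bar>v - u\<bar> \<Longrightarrow> \<bar>(A - B + v) - (A' - B' + u)\<bar> \<le> 3 * \<bar>v - u\<bar>"
    for A A' B B' v :: real by (smt (verit))
  show ?thesis unfolding estimate_def sum_list_nth by (intro tri avg_clip_shift)
qed

text \<open>The error telescopes: fixing the centre costs 3 \<epsilon>, removing the corruptions 2 T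
  (1 + B) \<epsilon>, passing from \<open>G\<close> to N(0,S) 4 T K \<epsilon>, and the clipped mean
  over the draws T \<epsilon>. What is left is the change in the mean of the excess
  \<open>?g\<close> between the two Gaussians.\<close>

lemma estimate_error:
  assumes pd: "pos_def_mat d S" and s: "frobenius_norm (S - 1\<^sub>m d) \<le> 1 / 9"
    and p: "p = quad d c a" and sym: "\<And>i j. a i j = a j i" and nrm: "(\<Sum>i<d. \<Sum>j<d. (a i j)\<^sup>2) = 1 / 2"
    and u: "u = c + (\<Sum>i<d. a i i)"
    and good: "good K d \<epsilon> \<epsilon> \<delta> S G" and K: "0 < K" and e: "0 < \<epsilon>" "\<epsilon> \<le> 1 / 2"
    and d: "0 < d" and xs: "xs \<noteq> []"
    and ph: "phi (mset xs) G \<le> B * \<epsilon>" and ps: "psi (mset xs) G \<le> \<epsilon>"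
    and T: "0 \<le> T" and N: "0 < N"
    and E1: "\<bar>draw_mean p N \<omega> - u\<bar> \<le> \<epsilon>"
    and E2: "\<bar>(\<Sum>j<N. clip T (p (\<omega> j) - u)) / N - mean (std_gaussian d) (\<lambda>x. clip T (p x - u))\<bar> \<le> T * \<epsilon>"
  shows "\<bar>estimate T p xs N \<omega> - mean (gaussian d S) p\<bar>
    \<le> 75 * exp (- T / 24) * frobenius_norm (S - 1\<^sub>m d) + (3 + T * (3 + 2 * B + 4 * K)) * \<epsilon>"
proof -
  let ?U = "measure_pmf (pmf_of_set G)"
  let ?s = "frobenius_norm (S - 1\<^sub>m d)"
  let ?h = "\<lambda>x. clip T (p x - u)"
  let ?g = "\<lambda>x. (p x - u) - clip T (p x - u)"
  let ?L = "real d * ln (real (card G) / \<delta>)"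
  interpret I: prob_space "std_gaussian d" by (rule prob_space_gaussian[OF pos_def_one_mat])
  interpret S: prob_space "gaussian d S" by (rule prob_space_gaussian[OF pd])
  have [measurable]: "p \<in> borel_measurable (lebs d)" unfolding p by measurable
  have G: "finite G" "G \<noteq> {}" using good by (auto simp: good_def Let_def)
  have L: "1 / 2 \<le> K * ?L" by (rule good_log_factor_lower[OF pd good e d])
  then have "0 < K * ?L" by linarith
  then have L0: "0 < ?L" using K by (simp add: zero_less_mult_iff)
  have 1: "\<bar>(\<Sum>x\<leftarrow>xs. ?h x) / length xs - mean ?U ?h\<bar> \<le> 2 * T * ((1 + B) * \<epsilon>)"
  proof -
    have "\<bar>(\<Sum>x\<leftarrow>xs. ?h x) / length xs - mean ?U ?h\<bar> \<le> 2 * T * (psi (mset xs) G + phi (mset xs) G)"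
      by (rule corrupted_mean_bounded[OF xs G]) (rule clip_bounds[OF T])
    also have "\<dots> \<le> 2 * T * ((1 + B) * \<epsilon>)"
      using ph ps T by (intro mult_left_mono) (auto simp: algebra_simps)
    finally show ?thesis .
  qed
  have 2: "\<bar>mean ?U ?h - mean (gaussian d S) ?h\<bar> \<le> 2 * T * (2 * K * \<epsilon>)"
  proof -
    have "\<bar>mean ?U ?h - mean (gaussian d S) ?h\<bar> \<le> 2 * T * (\<epsilon>\<^sup>2 / ?L)"
      unfolding p by (rule good_mean_clip[OF pd good T L0])
    \<comment> \<open>One factor \<epsilon> is given away as at most 1; the constant comes from
      \<open>1 / 2 \<le> K * ?L\<close>.\<close>
    also have "\<epsilon>\<^sup>2 / ?L \<le> 2 * K * \<epsilon>"
    proof -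
      have "\<epsilon>\<^sup>2 \<le> \<epsilon> * 1" unfolding power2_eq_square using e by (intro mult_left_mono) auto
      also have "\<epsilon> * 1 \<le> \<epsilon> * (2 * (K * ?L))" using e L by (intro mult_left_mono) auto
      finally show ?thesis using L0 by (simp add: pos_divide_le_eq mult_ac)
    qed
    finally show ?thesis using T by (simp add: mult_left_mono)
  qed
  have gs: "\<bar>mean (gaussian d S) ?g - mean (std_gaussian d) ?g\<bar> \<le> 3 * ?s * (25 * exp (- T / 24))"
  proof (rule gaussian_mean_diff_le[OF pd s])
    show "(\<integral>\<^sup>+x. ennreal ((?g x)\<^sup>2) \<partial>std_gaussian d) \<le> ennreal ((25 * exp (- T / 24))\<^sup>2)"
      unfolding p using std_gaussian_clip_excess[of d a T u c] sym nrm T u by blast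
  qed auto
  have mg: "mean M ?g = mean M p - u - mean M ?h" if M: "prob_space M" "p \<in> borel_measurable M" "integrable M p" for M
  proof -
    interpret M: prob_space M by fact
    have "integrable M ?h" by (rule integrable_clip[OF M(1) _ T]) (use M(2) in measurable)
    then show ?thesis using M(3) M.prob_space by (simp add: mean_def)
  qed
  have intp: "integrable (gaussian d S) p" "integrable (std_gaussian d) p"
    unfolding p using gaussian_mean_quad[OF pd, of c a] gaussian_mean_quad[OF pos_def_one_mat, of d c a]
    by (auto simp: has_bochner_integral_iff)
  have mu: "mean (std_gaussian d) p = u"
    unfolding u p mean_def by (rule has_bochner_integral_integral_eq[OF std_gaussian_mean_quad])
  \<comment> \<open>As p has mean u under N(0,I), the mean of the excess there is minus that of
    \<open>?h\<close>, so this is \<open>gs\<close> rewritten.\<close>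
  have 3: "\<bar>(mean (gaussian d S) p - u - mean (gaussian d S) ?h) + mean (std_gaussian d) ?h\<bar> \<le> 75 * exp (- T / 24) * ?s"
    using gs mg[OF S.prob_space_axioms _ intp(1)] mg[OF I.prob_space_axioms _ intp(2)] mu by (simp add: mult_ac)
  have "3 * \<epsilon> + 2 * T * ((1 + B) * \<epsilon>) + 2 * T * (2 * K * \<epsilon>) + T * \<epsilon> = (3 + T * (3 + 2 * B + 4 * K)) * \<epsilon>"
    by (simp add: algebra_simps)
  moreover have "\<bar>E - P\<bar> \<le> b4 + (3 * e + b1 + b3 + b2)"
    if "\<bar>E - (A - Y + u)\<bar> \<le> 3 * D" "D \<le> e" "\<bar>Y - m\<bar> \<le> b2" "\<bar>A - g\<bar> \<le> b1" "\<bar>g - h\<bar> \<le> b3"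
      "\<bar>(P - u - h) + m\<bar> \<le> b4" for E A Y D e m b2 g b1 h b3 P b4
    using that by (smt (verit))
  from this[OF estimate_recentre E1 E2 1 2 3]
  have "\<bar>estimate T p xs N \<omega> - mean (gaussian d S) p\<bar> \<le> 75 * exp (- T / 24) * ?s
     + (3 * \<epsilon> + 2 * T * ((1 + B) * \<epsilon>) + 2 * T * (2 * K * \<epsilon>) + T * \<epsilon>)" .
  ultimately show ?thesis by (simp only:)
qed

section \<open>Number of draws and failure probability\<close>

lemma halvings_le:
  assumes "0 < \<tau>" "\<tau> \<le> 1"
  shows "real (halvings \<tau>) \<le> 1 + 2 * ln (1 / \<tau>)"
proof (cases "halvings \<tau>")
  case 0
  then show ?thesis using assms by simp
next
  case (Suc k)
  then have "\<tau> < (1 / 2) ^ k" using halvings(2)[OF assms(1), of k] by simp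
  then have "ln \<tau> < ln ((1 / 2) ^ k)" using assms by simp
  also have "\<dots> = - (real k * ln 2)" by (simp add: ln_realpow ln_div)
  finally have "real k * ln 2 < ln (1 / \<tau>)" using assms by (simp add: ln_div)
  moreover have "real k * (1 / 2) \<le> real k * ln 2" using ln2_ge_two_thirds by (intro mult_left_mono) auto
  ultimately show ?thesis using Suc by simp
qed

lemma num_draws_bounds:
  assumes e: "0 < \<epsilon>" and \<tau>: "0 < \<tau>"
  defines "N \<equiv> num_draws \<epsilon> \<tau>"
  shows "27 * (real (halvings \<tau>) + 1) \<le> real N * \<epsilon>\<^sup>2" "0 < N"
    "real N \<le> 27 * (real (halvings \<tau>) + 1) / \<epsilon>\<^sup>2 + 1"
proof -
  let ?B = "27 * (real (halvings \<tau>) + 1) / \<epsilon> / \<epsilon>"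
  have B: "?B > 0" using e by (auto intro!: divide_pos_pos)
  have N: "N = nat \<lceil>?B\<rceil>" by (simp add: N_def num_draws_def)
  have "?B \<le> real N" unfolding N by (rule real_nat_ceiling_ge)
  then show "27 * (real (halvings \<tau>) + 1) \<le> real N * \<epsilon>\<^sup>2"
    using e by (simp add: power2_eq_square field_simps)
  show "0 < N" using \<open>?B \<le> real N\<close> B by (metis less_le_trans of_nat_0_less_iff)
  have "real N < ?B + 1" unfolding N using B by linarith
  then show "real N \<le> 27 * (real (halvings \<tau>) + 1) / \<epsilon>\<^sup>2 + 1" by (simp add: power2_eq_square)
qed

text \<open>With J halvings and exp(-3) \<le> 1/8, the left side is at most 4 * 8^-(J+1) = 8^-J / 2,
  hence at most 2^-J and so at most \<tau>. The factor 4 stands for two events with two sides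
  each.\<close>

lemma exp_num_draws:
  assumes e: "0 < \<epsilon>" and \<tau>: "0 < \<tau>"
  shows "4 * exp (- (real (num_draws \<epsilon> \<tau>) * \<epsilon>\<^sup>2 / 9)) \<le> \<tau>"
proof -
  let ?J = "halvings \<tau>"
  have "(8 :: real) \<le> (5 / 2) ^ 3" by (simp add: power3_eq_cube)
  also have "\<dots> \<le> exp 1 ^ 3" using exp_lower_Taylor_quadratic[of 1] by (intro power_mono) auto
  also have "\<dots> = exp 3" by (simp add: exp_of_nat_mult[symmetric])
  finally have "exp (- 3) \<le> (1 / 8 :: real)" by (simp add: exp_minus field_simps)
  then have "exp (- 3) ^ Suc ?J \<le> (1 / 8 :: real) ^ Suc ?J" by (intro power_mono) auto
  also have "exp (- 3 :: real) ^ Suc ?J = exp (real (Suc ?J) * - 3)" by (rule exp_of_nat_mult[symmetric])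
  finally have 1: "exp (real (Suc ?J) * - 3) \<le> (1 / 8) ^ Suc ?J" .
  have "4 * exp (- (real (num_draws \<epsilon> \<tau>) * \<epsilon>\<^sup>2 / 9)) \<le> 4 * exp (real (Suc ?J) * - 3)"
    using num_draws_bounds(1)[OF e \<tau>] by simp
  also have "\<dots> \<le> 4 * (1 / 8) ^ Suc ?J" using 1 by simp
  also have "\<dots> = 1 / 2 * (1 / 8) ^ ?J" by simp
  also have "\<dots> \<le> 1 / 2 * (1 / 2) ^ ?J" by (intro mult_left_mono power_mono) auto
  also have "\<dots> \<le> (1 / 2) ^ ?J" by simp
  also have "\<dots> \<le> \<tau>" by (rule halvings(1)[OF \<tau>])
  finally show ?thesis .
qed

lemma measurable_tape_quad [measurable]: "(\<lambda>\<omega>. quad d c a (\<omega> j)) \<in> borel_measurable (tape d)"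
proof -
  have "(\<lambda>\<omega>. \<omega> j) \<in> measurable (tape d) (std_gaussian d)" unfolding tape_def by measurable
  moreover have "quad d c a \<in> borel_measurable (std_gaussian d)" by measurable
  ultimately show ?thesis by (rule measurable_compose)
qed

lemma measurable_estimate [measurable]: "estimate T (quad d c a) xs N \<in> borel_measurable (tape d)"
  unfolding estimate_def[abs_def] sum_list_nth draw_mean_def by measurable

text \<open>A union bound over two failures: the empirical centre is off by \<epsilon>, or the
  clipped mean over the draws by T \<epsilon>. All other parts of the error analysis hold for a
  fixed tape, which is the content of \<open>imp\<close>.\<close>

lemma estimate_events:
  assumes sym: "\<And>i j. a i j = a j i" and nrm: "(\<Sum>i<d. \<Sum>j<d. (a i j)\<^sup>2) = 1 / 2"
    and u: "u = c + (\<Sum>i<d. a i i)" and e: "0 < \<epsilon>" "\<epsilon> \<le> 1" and \<tau>: "0 < \<tau>" and T: "0 < T"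
    and p: "p = quad d c a" and N: "N = num_draws \<epsilon> \<tau>"
    and A: "A \<in> sets (tape d)"
    and imp: "\<And>\<omega>. \<omega> \<in> space (tape d) \<Longrightarrow> \<bar>draw_mean p N \<omega> - u\<bar> \<le> \<epsilon> \<Longrightarrow>
      \<bar>(\<Sum>j<N. clip T (p (\<omega> j) - u)) / N - mean (std_gaussian d) (\<lambda>x. clip T (p x - u))\<bar> \<le> T * \<epsilon> \<Longrightarrow> \<omega> \<in> A"
  shows "1 - \<tau> \<le> measure (tape d) A"
proof -
  interpret W: prob_space "tape d"
    unfolding tape_def by (rule prob_space_PiM) (rule prob_space_gaussian[OF pos_def_one_mat])
  let ?m = "mean (std_gaussian d) (\<lambda>x. clip T (p x - u))"
  have N0: "0 < N" using num_draws_bounds(2)[OF e(1) \<tau>] by (simp add: N)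
  define X where "X = {\<omega> \<in> space (tape d). real N * \<epsilon> \<le> \<bar>\<Sum>j<N. p (\<omega> j) - u\<bar>}"
  define Y where "Y = {\<omega> \<in> space (tape d). real N * (T * \<epsilon>) \<le> \<bar>\<Sum>j<N. clip T (p (\<omega> j) - u) - ?m\<bar>}"
  have XY: "X \<in> sets (tape d)" "Y \<in> sets (tape d)"
    unfolding X_def Y_def p by measurable
  have PX: "W.prob X \<le> 2 * exp (- (real N * \<epsilon>\<^sup>2 / 9))"
    unfolding X_def p by (rule tape_mean_quad_concentration[OF _ nrm u e]) (rule sym)
  have "W.prob Y \<le> 2 * exp (- (real N * \<epsilon>\<^sup>2 / 2))"
    unfolding Y_def p by (rule tape_mean_clip_concentration[OF T e(1)])
  also have "\<dots> \<le> 2 * exp (- (real N * \<epsilon>\<^sup>2 / 9))"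
    by (intro mult_left_mono iffD2[OF exp_le_cancel_iff] le_imp_neg_le divide_left_mono) auto
  finally have PY: "W.prob Y \<le> 2 * exp (- (real N * \<epsilon>\<^sup>2 / 9))" .
  have avg: "\<bar>(\<Sum>j<N. f j) / N - v\<bar> \<le> b" if "\<not> real N * b \<le> \<bar>\<Sum>j<N. f j - v\<bar>" for f :: "nat \<Rightarrow> real" and v b
  proof -
    have "(\<Sum>j<N. f j - v) = real N * ((\<Sum>j<N. f j) / N - v)"
      using N0 by (simp add: sum_subtractf field_simps)
    then have "real N * \<bar>(\<Sum>j<N. f j) / N - v\<bar> \<le> real N * b" using that by (simp add: abs_mult)
    then show ?thesis using N0 by simp
  qed
  have sub: "space (tape d) - A \<subseteq> X \<union> Y"
  proof
    fix \<omega> assume w: "\<omega> \<in> space (tape d) - A"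
    show "\<omega> \<in> X \<union> Y"
    proof (rule ccontr)
      assume "\<omega> \<notin> X \<union> Y"
      then have "\<not> real N * \<epsilon> \<le> \<bar>\<Sum>j<N. p (\<omega> j) - u\<bar>"
        "\<not> real N * (T * \<epsilon>) \<le> \<bar>\<Sum>j<N. clip T (p (\<omega> j) - u) - ?m\<bar>"
        using w by (auto simp: X_def Y_def)
      then show False using imp[of \<omega>] w avg[of \<epsilon> "\<lambda>j. p (\<omega> j)" u] avg[of "T * \<epsilon>" "\<lambda>j. clip T (p (\<omega> j) - u)" ?m]
        unfolding draw_mean_def by blast
    qed
  qed
  have "1 - W.prob A = W.prob (space (tape d) - A)" using W.prob_compl[OF A] by simp
  also have "\<dots> \<le> W.prob (X \<union> Y)" by (intro W.finite_measure_mono sub) (use XY in auto)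
  also have "\<dots> \<le> W.prob X + W.prob Y" by (intro measure_Un_le XY)
  also have "\<dots> \<le> 4 * exp (- (real N * \<epsilon>\<^sup>2 / 9))" using PX PY by simp
  also have "\<dots> \<le> \<tau>" unfolding N by (rule exp_num_draws[OF e(1) \<tau>])
  finally show ?thesis by simp
qed

text \<open>Combines \<open>good_card_lower\<close> with 2 log(1/\<epsilon>) \<ge> 1 and L \<ge>
  1/(2 K), then passes to the sample by |G| \<le> 2 n. This charges the draws that do not depend on
  \<tau> to the size of the input.\<close>

lemma sample_size_lower:
  assumes pd: "pos_def_mat d S" and good: "good K d \<epsilon> \<epsilon> \<delta> S G" and K: "0 < K" and e: "0 < \<epsilon>" "\<epsilon> \<le> 1 / 2"
    and d: "0 < d" and xs: "xs \<noteq> []" and ph: "phi (mset xs) G \<le> 1"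
  shows "1 / \<epsilon>\<^sup>2 \<le> 8 * K\<^sup>2 * real (length xs)"
proof -
  let ?L = "real d * ln (real (card G) / \<delta>)"
  have G: "finite G" "G \<noteq> {}" using good by (auto simp: good_def Let_def)
  then have g0: "0 < real (card G)" by (simp add: card_gt_0_iff)
  have L: "1 / 2 \<le> K * ?L" by (rule good_log_factor_lower[OF pd good e d])
  then have "(1 / 2)\<^sup>2 \<le> (K * ?L)\<^sup>2" by (intro power_mono) auto
  moreover have "(1 / 2)\<^sup>2 = (1 / 4 :: real)" by (simp add: power2_eq_square)
  ultimately have L2: "1 / 4 \<le> K\<^sup>2 * ?L\<^sup>2" using power_mult_distrib[of K ?L 2] by (simp only:)
  then have L20: "0 < ?L\<^sup>2" using K by (cases "?L = 0") auto
  have "2 \<le> 1 / \<epsilon>" using e by (simp add: field_simps)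
  then have "ln 2 \<le> ln (1 / \<epsilon>)" using e by (subst ln_le_cancel_iff) auto
  then have l: "1 / 2 \<le> ln (1 / \<epsilon>)" using ln2_ge_two_thirds by linarith
  have "1 / real (card G) \<le> \<epsilon>\<^sup>2 / (2 * ln (1 / \<epsilon>) * ?L\<^sup>2)" by (rule good_card_lower[OF pd good d])
  then have "2 * ln (1 / \<epsilon>) * ?L\<^sup>2 \<le> \<epsilon>\<^sup>2 * real (card G)"
    using g0 l L20 by (simp add: divide_le_eq le_divide_eq mult_ac)
  moreover have "1 * ?L\<^sup>2 \<le> 2 * ln (1 / \<epsilon>) * ?L\<^sup>2" using l by (intro mult_right_mono) auto
  ultimately have "?L\<^sup>2 \<le> \<epsilon>\<^sup>2 * real (card G)" by linarith
  then have "K\<^sup>2 * ?L\<^sup>2 \<le> K\<^sup>2 * (\<epsilon>\<^sup>2 * real (card G))" by (intro mult_left_mono) auto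
  also have "real (card G) \<le> 2 * real (length xs)"
  proof -
    have "real (length xs) * phi (mset xs) G \<le> real (length xs) * 1" using ph by (intro mult_left_mono) auto
    moreover have "0 \<le> real (length xs) * psi (mset xs) G" using phi_psi_nonneg by simp
    ultimately show ?thesis using phi_psi_size(3,4)[OF xs G(1)] by linarith
  qed
  then have "K\<^sup>2 * (\<epsilon>\<^sup>2 * real (card G)) \<le> K\<^sup>2 * (\<epsilon>\<^sup>2 * (2 * real (length xs)))" by (intro mult_left_mono) auto
  finally have "1 / 4 \<le> K\<^sup>2 * (\<epsilon>\<^sup>2 * (2 * real (length xs)))" using L2 by linarith
  then show ?thesis using e by (simp add: field_simps)
qed

text \<open>The first bound keeps the Frobenius distance bounded for every \<epsilon>; the second,
  from log x \<le> x - 1 at x = 1/sqrt \<epsilon>, makes it small with \<epsilon>.\<close>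

lemma entropy_term_le:
  fixes \<epsilon> :: real
  assumes e: "0 < \<epsilon>"
  shows "\<epsilon> * ln (1 / \<epsilon>) \<le> 1" "\<epsilon> * ln (1 / \<epsilon>) \<le> 2 * sqrt \<epsilon>"
proof -
  have "ln (1 / \<epsilon>) \<le> 1 / \<epsilon>" using ln_le_minus_one[of "1 / \<epsilon>"] e by simp
  then have "\<epsilon> * ln (1 / \<epsilon>) \<le> \<epsilon> * (1 / \<epsilon>)" using e by (intro mult_left_mono) auto
  then show "\<epsilon> * ln (1 / \<epsilon>) \<le> 1" using e by simp
  have "ln (1 / sqrt \<epsilon>) \<le> 1 / sqrt \<epsilon>" using ln_le_minus_one[of "1 / sqrt \<epsilon>"] e by simp
  moreover have "ln (1 / \<epsilon>) = 2 * ln (1 / sqrt \<epsilon>)" using e by (simp add: ln_div ln_sqrt)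
  ultimately have "\<epsilon> * ln (1 / \<epsilon>) \<le> \<epsilon> * (2 * (1 / sqrt \<epsilon>))" using e by (intro mult_left_mono) auto
  also have "\<dots> = 2 * sqrt \<epsilon>" using e by (simp add: field_simps)
  finally show "\<epsilon> * ln (1 / \<epsilon>) \<le> 2 * sqrt \<epsilon>" .
qed

text \<open>Since 144 = 24 * 6, T/24 is at least 6 max 1 (log C), which is at least 5 + log C, and
  75 \<le> exp 5.\<close>

lemma exp_truncation:
  fixes C T :: real
  assumes C: "0 < C" and T: "144 * max 1 (ln C) \<le> T"
  shows "75 * exp (- T / 24) \<le> 1 / C"
proof -
  let ?M = "max 1 (ln C)"
  have "(75 :: real) \<le> (5 / 2) ^ 5" by (simp add: eval_nat_numeral)
  also have "\<dots> \<le> exp 1 ^ 5" using exp_lower_Taylor_quadratic[of 1] by (intro power_mono) auto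
  also have "\<dots> = exp 5" by (simp add: exp_of_nat_mult[symmetric])
  finally have 75: "75 \<le> exp (5 :: real)" .
  have "75 * C = 75 * exp (ln C)" using C by simp
  also have "\<dots> \<le> exp 5 * exp (ln C)" using 75 by (intro mult_right_mono) auto
  also have "\<dots> = exp (5 + ln C)" by (simp add: exp_add)
  also have "\<dots> \<le> exp (T / 24)"
  proof -
    have "1 \<le> ?M" "ln C \<le> ?M" by auto
    then have "5 + ln C \<le> T / 24" using T by linarith
    then show ?thesis by simp
  qed
  finally have "75 * C \<le> exp (T / 24)" .
  then have "75 * C * exp (- T / 24) \<le> exp (T / 24) * exp (- T / 24)" by (intro mult_right_mono) auto
  also have "\<dots> = 1" by (simp add: exp_add[symmetric])
  finally show ?thesis using C by (simp add: field_simps)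
qed

lemma run_output_unique:
  assumes "run prog p xs \<epsilon> \<tau> \<omega> t out" "run prog p xs \<epsilon> \<tau> \<omega> t' out'"
  shows "out = out'"
proof -
  obtain m h m' h' where
    "exec p (\<lambda>k. if k < length xs then xs ! k else \<omega> (k - length xs)) prog
        ((\<lambda>_. 0)(0 := \<epsilon>, 1 := \<tau>, 2 := real (length xs)), length xs) t (m, h)" "out = m 0"
    "exec p (\<lambda>k. if k < length xs then xs ! k else \<omega> (k - length xs)) prog
        ((\<lambda>_. 0)(0 := \<epsilon>, 1 := \<tau>, 2 := real (length xs)), length xs) t' (m', h')" "out' = m' 0"
    using assms unfolding run_def by blast
  with exec_deterministic[OF this(1) this(3)] show ?thesis by simp
qed

text \<open>J is the number of halvings and E is 1/\<epsilon>^2. The product (J + 1) E contains a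
  bare multiple of E, which E \<le> k n charges to the input. The constants are 762 = 2 (3 + 14 *
  27) and 805 = 762 + 20 + 14 + 9.\<close>

lemma running_time_le:
  fixes J N n l E k :: real
  assumes J: "0 \<le> J" "J \<le> 1 + 2 * l" and N: "N \<le> 27 * (J + 1) / e + 1"
    and E: "E = 1 / e" "1 \<le> E" "E \<le> k * n" and n: "1 \<le> n" and l: "0 \<le> l" and k: "0 \<le> k"
  shows "20 + 3 * J + 14 * N + 9 * n \<le> (805 + 762 * k) * (n + l * E)"
proof -
  define X Y Z W where "X = (J + 1) * E" and "Y = l * E" and "Z = k * n" and "W = k * (l * E)"
  have E0: "0 \<le> E" using E(2) by linarith
  have "(J + 1) * 1 \<le> (J + 1) * E" using J E(2) by (intro mult_left_mono) auto
  then have 1: "J + 1 \<le> X" by (simp add: X_def)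
  have "(J + 1) * E \<le> (2 + 2 * l) * E" using J E0 by (intro mult_right_mono) auto
  then have 2: "X \<le> 2 * E + 2 * Y" by (simp add: X_def Y_def algebra_simps)
  have 3: "N \<le> 27 * X + 1" using N by (simp add: X_def E(1))
  have 4: "0 \<le> Y" "0 \<le> W" using E(2) l k by (auto simp: Y_def W_def)
  have 5: "E \<le> Z" using E(3) by (simp add: Z_def)
  have "20 + 3 * J + 14 * N + 9 * n \<le> 805 * n + 762 * Z + 805 * Y + 762 * W"
    using 1 2 3 4 5 n by linarith
  also have "\<dots> = (805 + 762 * k) * (n + l * E)"
    by (simp add: Y_def Z_def W_def algebra_simps)
  finally show ?thesis .
qed

theorem theorem5p4:
  fixes K\<^sub>\<Sigma> K\<^sub>G b :: real
  assumes "0 < K\<^sub>\<Sigma>" and "0 < K\<^sub>G" and "b < 1"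
  shows "\<exists>K>0. \<forall>C>0. \<exists>prog. \<forall>d \<epsilon> \<delta> \<tau> \<Sigma> p G\<^sub>0 xs.
    0 < \<epsilon> \<longrightarrow> 0 < \<delta> \<longrightarrow> 0 < \<tau> \<longrightarrow> \<tau> \<le> 1 \<longrightarrow>
    pos_def_mat d \<Sigma> \<longrightarrow>
    frobenius_norm (\<Sigma> - 1\<^sub>m d) \<le> K\<^sub>\<Sigma> * (\<epsilon> * ln (1 / \<epsilon>)) \<longrightarrow>
    p \<in> P2 d \<longrightarrow>
    good K\<^sub>G d \<epsilon> \<epsilon> \<delta> \<Sigma> G\<^sub>0 \<longrightarrow>
    xs \<noteq> [] \<longrightarrow> set xs \<subseteq> extensional {..<d} \<longrightarrow>
    phi (mset xs) G\<^sub>0 \<le> b \<longrightarrow> Delta (mset xs) G\<^sub>0 \<le> \<epsilon> \<longrightarrow>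
    measure (tape d) {\<omega> \<in> space (tape d). \<exists>t out. run prog p xs \<epsilon> \<tau> \<omega> t out \<and>
        \<bar>out - mean (gaussian d \<Sigma>) p\<bar>
          \<le> frobenius_norm (\<Sigma> - 1\<^sub>m d) / C + K * max 1 (ln C) * \<epsilon>} \<ge> 1 - \<tau> \<and>
    (\<forall>\<omega>\<in>space (tape d). \<exists>t out. run prog p xs \<epsilon> \<tau> \<omega> t out \<and>
        real t \<le> K * (real (length xs) + ln (1 / \<tau>) / \<epsilon>\<^sup>2))"
proof -
  \<comment> \<open>Raising \<open>b\<close> to at least 1/2 makes \<open>b'\<close> positive, so
    that log(1/b') is a genuine positive number also for b \<le> 0.\<close>
  define b' where "b' = max b (1 / 2)"
  have b': "0 < b'" "b' < 1" "b \<le> b'" using assms by (auto simp: b'_def)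
  define B where "B = 1 / ln (1 / b')"
  have B: "0 < B" using b' by (simp add: B_def)
  \<comment> \<open>For \<epsilon> \<le> e0 the Frobenius distance is at most
    \<open>K\<^sub>\<Sigma> * (2 * sqrt \<epsilon>)\<close>, hence at most 1/9, the range in which
    the two Gaussians are compared.\<close>
  define e0 where "e0 = min (1 / 2) ((1 / (18 * K\<^sub>\<Sigma>))\<^sup>2)"
  have e0: "0 < e0" "e0 \<le> 1 / 2" "e0 \<le> (1 / (18 * K\<^sub>\<Sigma>))\<^sup>2" using assms by (auto simp: e0_def)
  \<comment> \<open>\<open>K1\<close> serves small \<epsilon> and \<open>K2\<close> the trivial
    bound for large \<epsilon>, with 145 the upper end of the window for the level and 291 = 2 * 145
    + 1. \<open>K3\<close> bounds 1/\<epsilon>^2 per input point.\<close>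
  define K1 where "K1 = 3 + 145 * (3 + 2 * B + 4 * K\<^sub>G)"
  define K2 where "K2 = (291 + K\<^sub>\<Sigma>) / e0"
  define K3 where "K3 = 8 * K\<^sub>G\<^sup>2 + 1 / e0\<^sup>2"
  define K where "K = K1 + K2 + (805 + 762 * K3)"
  have K0: "0 < K1" "0 < K2" "0 < K3"
    using assms B e0 by (auto simp: K1_def K2_def K3_def intro!: add_pos_pos add_nonneg_pos)
  have K: "0 < K" "K1 \<le> K" "K2 \<le> K" "805 + 762 * K3 \<le> K" using K0 by (auto simp: K_def)
  show ?thesis
  proof (intro exI[of _ K] conjI K(1) allI impI)
    fix C :: real assume C: "0 < C"
    let ?M = "max 1 (ln C)"
    have M: "1 \<le> ?M" by simp
    \<comment> \<open>Program constants are rational, so the level is picked from a window. It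
      depends on C alone, and so does the program.\<close>
    have "144 * ?M < 145 * ?M" using M by linarith
    then obtain T where T: "144 * ?M < of_rat T" "of_rat T < 145 * ?M" using of_rat_dense by blast
    let ?T = "of_rat T :: real"
    have T0: "0 < ?T" using T M by linarith
    then have TQ: "0 \<le> T" by (simp add: zero_less_of_rat_iff less_imp_le)
    have trunc: "75 * exp (- ?T / 24) \<le> 1 / C" using T by (intro exp_truncation C) auto
    show "\<exists>prog. \<forall>d \<epsilon> \<delta> \<tau> \<Sigma> p G\<^sub>0 xs.
      0 < \<epsilon> \<longrightarrow> 0 < \<delta> \<longrightarrow> 0 < \<tau> \<longrightarrow> \<tau> \<le> 1 \<longrightarrow>
      pos_def_mat d \<Sigma> \<longrightarrow>
      frobenius_norm (\<Sigma> - 1\<^sub>m d) \<le> K\<^sub>\<Sigma> * (\<epsilon> * ln (1 / \<epsilon>)) \<longrightarrow>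
      p \<in> P2 d \<longrightarrow>
      good K\<^sub>G d \<epsilon> \<epsilon> \<delta> \<Sigma> G\<^sub>0 \<longrightarrow>
      xs \<noteq> [] \<longrightarrow> set xs \<subseteq> extensional {..<d} \<longrightarrow>
      phi (mset xs) G\<^sub>0 \<le> b \<longrightarrow> Delta (mset xs) G\<^sub>0 \<le> \<epsilon> \<longrightarrow>
      measure (tape d) {\<omega> \<in> space (tape d). \<exists>t out. run prog p xs \<epsilon> \<tau> \<omega> t out \<and>
          \<bar>out - mean (gaussian d \<Sigma>) p\<bar>
            \<le> frobenius_norm (\<Sigma> - 1\<^sub>m d) / C + K * max 1 (ln C) * \<epsilon>} \<ge> 1 - \<tau> \<and>
      (\<forall>\<omega>\<in>space (tape d). \<exists>t out. run prog p xs \<epsilon> \<tau> \<omega> t out \<and>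
          real t \<le> K * (real (length xs) + ln (1 / \<tau>) / \<epsilon>\<^sup>2))"
    proof (rule exI[of _ "estimator T"], intro allI impI)
      fix d and \<epsilon> \<delta> \<tau> :: real and \<Sigma> p G\<^sub>0 and xs :: "point list"
      assume e: "0 < \<epsilon>" and \<tau>: "0 < \<tau>" "\<tau> \<le> 1" and pd: "pos_def_mat d \<Sigma>"
        and s: "frobenius_norm (\<Sigma> - 1\<^sub>m d) \<le> K\<^sub>\<Sigma> * (\<epsilon> * ln (1 / \<epsilon>))"
        and P2: "p \<in> P2 d" and good: "good K\<^sub>G d \<epsilon> \<epsilon> \<delta> \<Sigma> G\<^sub>0"
        and xs: "xs \<noteq> []" and phi: "phi (mset xs) G\<^sub>0 \<le> b" and Delta: "Delta (mset xs) G\<^sub>0 \<le> \<epsilon>"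
      let ?s = "frobenius_norm (\<Sigma> - 1\<^sub>m d)"
      let ?v = "mean (gaussian d \<Sigma>) p"
      define N where "N = num_draws \<epsilon> \<tau>"
      obtain c a where p: "p = quad d c a" and sym: "\<And>i j. a i j = a j i"
        and nrm: "(\<Sum>i<d. \<Sum>j<d. (a i j)\<^sup>2) = 1 / 2" and d: "0 < d"
        using P2_quad[OF P2] by blast
      define u where "u = c + (\<Sum>i<d. a i i)"
      have s0: "0 \<le> ?s" by (rule frobenius_norm_nonneg)
      \<comment> \<open>A norm is nonnegative, so the bound imposed on it forces log(1/\<epsilon>)
        \<ge> 0.\<close>
      have e1: "\<epsilon> \<le> 1"
      proof (rule ccontr)
        assume "\<not> \<epsilon> \<le> 1"
        then have "ln (1 / \<epsilon>) < 0" by (simp add: ln_div)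
        then have "K\<^sub>\<Sigma> * (\<epsilon> * ln (1 / \<epsilon>)) < 0" using assms e by (simp add: mult_pos_neg)
        then show False using s s0 by linarith
      qed
      have ps: "psi (mset xs) G\<^sub>0 \<le> \<epsilon>" and ph: "phi (mset xs) G\<^sub>0 \<le> B * \<epsilon>"
        using phi_psi_le[of "mset xs" G\<^sub>0 b' \<epsilon>] phi b' Delta by (auto simp: B_def)
      let ?err = "?s / C + K * ?M * \<epsilon>"
      let ?A = "{\<omega> \<in> space (tape d). \<bar>estimate ?T p xs N \<omega> - ?v\<bar> \<le> ?err}"
      have run: "\<exists>t\<le>20 + 3 * halvings \<tau> + 14 * N + 9 * length xs.
          run (estimator T) p xs \<epsilon> \<tau> \<omega> t (estimate ?T p xs N \<omega>)" for \<omega>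
        unfolding N_def by (rule run_estimator[OF TQ \<tau>(1)])
      \<comment> \<open>Determinism of execution makes \<open>estimate\<close> the only possible
        output, which turns the event on runs into a visibly measurable set.\<close>
      have "{\<omega> \<in> space (tape d). \<exists>t out. run (estimator T) p xs \<epsilon> \<tau> \<omega> t out \<and> \<bar>out - ?v\<bar> \<le> ?err} = ?A"
        using run run_output_unique by blast
      moreover have "1 - \<tau> \<le> measure (tape d) ?A"
      proof (rule estimate_events[OF sym nrm u_def e e1 \<tau>(1) T0 p N_def])
        show "?A \<in> sets (tape d)" unfolding p by measurable
        fix \<omega> assume \<omega>: "\<omega> \<in> space (tape d)" and E1: "\<bar>draw_mean p N \<omega> - u\<bar> \<le> \<epsilon>"
          and E2: "\<bar>(\<Sum>j<N. clip ?T (p (\<omega> j) - u)) / N - mean (std_gaussian d) (\<lambda>x. clip ?T (p x - u))\<bar> \<le> ?T * \<epsilon>"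
        have "\<bar>estimate ?T p xs N \<omega> - ?v\<bar> \<le> ?err"
        proof (cases "\<epsilon> \<le> e0")
          case True
          have "K\<^sub>\<Sigma> * (\<epsilon> * ln (1 / \<epsilon>)) \<le> K\<^sub>\<Sigma> * (2 * sqrt \<epsilon>)"
            using assms entropy_term_le(2)[OF e] by (intro mult_left_mono) auto
          also have "\<dots> \<le> K\<^sub>\<Sigma> * (2 * (1 / (18 * K\<^sub>\<Sigma>)))"
          proof -
            have "\<epsilon> \<le> (1 / (18 * K\<^sub>\<Sigma>))\<^sup>2" using True e0 by linarith
            then have "sqrt \<epsilon> \<le> 1 / (18 * K\<^sub>\<Sigma>)" using assms by (intro real_le_lsqrt) (use e in auto)
            then show ?thesis using assms by (intro mult_left_mono) auto
          qed
          also have "\<dots> = 1 / 9" using assms by simp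
          finally have s9: "?s \<le> 1 / 9" using s by linarith
          have "\<bar>estimate ?T p xs N \<omega> - ?v\<bar>
            \<le> 75 * exp (- ?T / 24) * ?s + (3 + ?T * (3 + 2 * B + 4 * K\<^sub>G)) * \<epsilon>"
            using True e0 T0 num_draws_bounds(2)[OF e \<tau>(1)]
            by (intro estimate_error[OF pd s9 p sym nrm u_def good assms(2) e _ d xs ph ps _ _ E1 E2])
               (auto simp: N_def)
          also have "75 * exp (- ?T / 24) * ?s \<le> 1 / C * ?s"
            using trunc s0 by (rule mult_right_mono)
          also have "(3 + ?T * (3 + 2 * B + 4 * K\<^sub>G)) * \<epsilon> \<le> K * ?M * \<epsilon>"
          proof (rule mult_right_mono)
            have "?T * (3 + 2 * B + 4 * K\<^sub>G) \<le> (145 * ?M) * (3 + 2 * B + 4 * K\<^sub>G)"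
              using T B assms by (intro mult_right_mono) auto
            then have "3 + ?T * (3 + 2 * B + 4 * K\<^sub>G) \<le> 3 * ?M + (145 * ?M) * (3 + 2 * B + 4 * K\<^sub>G)"
              using M by linarith
            also have "\<dots> = K1 * ?M" by (simp add: K1_def algebra_simps)
            also have "\<dots> \<le> K * ?M" using K M by (intro mult_right_mono) auto
            finally show "3 + ?T * (3 + 2 * B + 4 * K\<^sub>G) \<le> K * ?M" .
          qed (use e in simp)
          finally show ?thesis by simp
        next
          case False
          have "K\<^sub>\<Sigma> * (\<epsilon> * ln (1 / \<epsilon>)) \<le> K\<^sub>\<Sigma> * 1"
            using assms entropy_term_le(1)[OF e] by (intro mult_left_mono) auto
          then have "\<bar>?v - u\<bar> \<le> K\<^sub>\<Sigma>"
            using mean_quad_shift[OF pd nrm, of c] s unfolding p u_def by linarith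
          then have "\<bar>estimate ?T p xs N \<omega> - ?v\<bar> \<le> 2 * ?T + \<epsilon> + K\<^sub>\<Sigma>"
            using estimate_trivial[of ?T p xs N \<omega>] T0 E1 by linarith
          also have "\<dots> \<le> 290 * ?M + 1 * ?M + K\<^sub>\<Sigma> * ?M"
          proof -
            have "K\<^sub>\<Sigma> * 1 \<le> K\<^sub>\<Sigma> * ?M" using assms M by (intro mult_left_mono) auto
            then show ?thesis using T M e1 by linarith
          qed
          also have "\<dots> = K2 * ?M * e0" using e0 by (simp add: K2_def field_simps)
          also have "\<dots> \<le> K * ?M * \<epsilon>" using K K0 M False e0 by (intro mult_mono) auto
          also have "\<dots> \<le> ?err" using s0 C by simp
          finally show ?thesis .
        qed
        then show "\<omega> \<in> ?A" using \<omega> by simp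
      qed
      moreover have "\<exists>t out. run (estimator T) p xs \<epsilon> \<tau> \<omega> t out \<and>
          real t \<le> K * (real (length xs) + ln (1 / \<tau>) / \<epsilon>\<^sup>2)" for \<omega>
      proof -
        obtain t where t: "t \<le> 20 + 3 * halvings \<tau> + 14 * N + 9 * length xs"
          "run (estimator T) p xs \<epsilon> \<tau> \<omega> t (estimate ?T p xs N \<omega>)" using run by blast
        have n: "1 \<le> real (length xs)" using xs by (cases xs) auto
        have E: "1 / \<epsilon>\<^sup>2 \<le> K3 * real (length xs)"
        proof (cases "\<epsilon> \<le> e0")
          case True
          have "1 / \<epsilon>\<^sup>2 \<le> 8 * K\<^sub>G\<^sup>2 * real (length xs)"
            using True e0 phi b' by (intro sample_size_lower[OF pd good assms(2) e _ d xs]) auto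
          also have "\<dots> \<le> K3 * real (length xs)" using e0 by (intro mult_right_mono) (auto simp: K3_def)
          finally show ?thesis .
        next
          case False
          have "1 / \<epsilon>\<^sup>2 \<le> 1 / e0\<^sup>2" using False e0 by (intro divide_left_mono power_mono) auto
          also have "\<dots> \<le> K3 * 1" using assms by (simp add: K3_def)
          also have "\<dots> \<le> K3 * real (length xs)" using K0 n by (intro mult_left_mono) auto
          finally show ?thesis .
        qed
        have "\<epsilon>\<^sup>2 \<le> 1" using e e1 by (simp add: power_le_one)
        then have E1: "1 \<le> 1 / \<epsilon>\<^sup>2" using e by (simp add: field_simps)
        have l: "0 \<le> ln (1 / \<tau>)" using \<tau> by simp
        have "real t \<le> 20 + 3 * real (halvings \<tau>) + 14 * real N + 9 * real (length xs)"
          using t(1) by linarith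
        also have "\<dots> \<le> (805 + 762 * K3) * (real (length xs) + ln (1 / \<tau>) * (1 / \<epsilon>\<^sup>2))"
          using halvings_le[OF \<tau>] num_draws_bounds(3)[OF e \<tau>(1)] E E1 n l K0
          by (intro running_time_le) (auto simp: N_def)
        also have "\<dots> \<le> K * (real (length xs) + ln (1 / \<tau>) * (1 / \<epsilon>\<^sup>2))"
          using K l by (intro mult_right_mono) auto
        finally show ?thesis using t(2) by auto
      qed
      ultimately show "1 - \<tau> \<le> measure (tape d) {\<omega> \<in> space (tape d). \<exists>t out. run (estimator T) p xs \<epsilon> \<tau> \<omega> t out \<and> \<bar>out - ?v\<bar> \<le> ?err} \<and>
        (\<forall>\<omega>\<in>space (tape d). \<exists>t out. run (estimator T) p xs \<epsilon> \<tau> \<omega> t out \<and>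
          real t \<le> K * (real (length xs) + ln (1 / \<tau>) / \<epsilon>\<^sup>2))"
        by simp
    qed
  qed
qed

end
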